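(* Let $1\le g\le r$ and let $\Gamma=(\gamma_1,\dots,\gamma_r)$ be a tuple of symmetric noncommutative polynomials in $x_1,\dots,x_g$ with $\gamma_j=x_j$ for $1\le j\le g$ and $\Gamma(0)=0$. Let $\mathsf{Conv}_\Gamma$ be the category whose objects are the compact (closed and bounded) $\Gamma$-convex sets $\boldsymbol K\subseteq\mathbb S^g$ with $0\in K_1$ and $\boldsymbol K=\Gamma^{-1}(\overline{\operatorname{matco}}(\Gamma(\boldsymbol K)))$, and whose morphisms are the $\Gamma$-coordinate affine maps. Let $\mathsf{OS}_\Gamma$ be the category of the corresponding $\Gamma$-operator systems, with admissible $\Gamma$-ucp maps as morphisms. Then the assignments $$\boldsymbol K\mapsto\widehat{\boldsymbol K},\quad \Phi\mapsto\Psi_\Phi\qquad\text{and}\qquad \mathcal R_A^\Gamma\mapsto W^\Gamma(A),\quad \Psi\mapsto\Phi_\Psi$$ define contravariant functors between $\mathsf{Conv}_\Gamma$ and $\mathsf{OS}_\Gamma$ (in the two respective directions). These functors are mutually inverse up to the natural identifications $W^\Gamma(\widehat{\boldsymbol K})=\boldsymbol K$ and $\widehat{W^\Gamma(A)}\cong\mathcal R^\Gamma_A$. Hence $\mathsf{Conv}_\Gamma$ and $\mathsf{OS}_\Gamma$ are contravariantly equivalent categories. In particular, two such $\Gamma$-convex sets $\boldsymbol K$ and $\boldsymbol L$ are isomorphic by a $\Gamma$-coordinate affine bijection if and only if their dual $\Gamma$-operator systems $\widehat{\boldsymbol K}$ and $\widehat{\boldsymbol L}$ are isomorphic by admissible $\Gamma$-ucp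 maps.
   Context: Polynomials. $\mathbb C\langle x\rangle$ is the free algebra in noncommuting variables $x_1,\dots,x_g$ with the conjugate-linear involution satisfying $x_j^*=x_j$ and $(uw)^*=w^*u^*$; $q$ is symmetric if $q^*=q$. For a tuple $X$ of self-adjoint operators $\Gamma(X)=(\gamma_1(X),\dots,\gamma_r(X))$. Graded sets. $\mathbb S_n$ is the set of self-adjoint $n\times n$ complex matrices and $\mathbb S^g=(\mathbb S_n^g)_{n\in\mathbb N}$. A graded set $\boldsymbol K=(K_n)_n$, $K_n\subseteq\mathbb S^g_n$, is closed if each $K_n$ is closed, and bounded if there is $R\ge0$ with $\sum_jX_j^2\preceq R^2$ for all $X\in\boldsymbol K$. It is free if closed under direct sums and simultaneous unitary conjugation. A pair $(X,V)$, with $X\in\mathbb S^g_n$ and $V:\mathbb C^m\to\mathbb C^n$ an isometry, is a $\Gamma$-pair if $V^*\Gamma(X)V=\Gamma(V^*XV)$. $\boldsymbol K$ is $\Gamma$-convex if it is free and $V^*XV\in\boldsymbol K$ whenever $X\in\boldsymbol K$ and $(X,V)$ is a $\Gamma$-pair. A matrix convex set is a free set closed under $X\mapsto V^*XV$ for all isometries $V$; $\overline{\operatorname{matco}}$ is the level-wise closure of the matrix convex hull. $\Gamma$-operator systems. For a tuple $A$ of $g$ self-adjoint operators on a Hilbert space $\mathcal H$, $\mathcal R_A^\Gamma=\operatorname{span}\{I_{\mathcal H},\gamma_1(A),\dots,\gamma_r(A)\}$ (the generating tuple $A$ is part of the data). A linear map $\varphi:\mathcal R^\Gamma_A\to\mathcal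 B(\mathcal K)$ is $\Gamma$-ucp if it is unital, completely positive and $\varphi(\gamma_i(A))=\gamma_i(\varphi(A_1),\dots,\varphi(A_g))$ for all $i$. A $\Gamma$-ucp map $\Psi:\mathcal R_A^\Gamma\to\mathcal R_B^\Gamma$ is admissible if $\phi\circ\Psi$ is $\Gamma$-ucp for every $n\in\mathbb N$ and every $\Gamma$-ucp map $\phi:\mathcal R^\Gamma_B\to M_n(\mathbb C)$. $W^\Gamma(A)=(W_n^\Gamma(A))_n$, where $W_n^\Gamma(A)=\{(\varphi(A_1),\dots,\varphi(A_g)):\varphi:\mathcal R^\Gamma_A\to M_n(\mathbb C)\ \Gamma\text{-ucp}\}$. For an object $\boldsymbol K$ of $\mathsf{Conv}_\Gamma$, $\widehat Y_{\boldsymbol K}=\bigoplus_{X\in\boldsymbol K}X$, the corresponding (dual) $\Gamma$-operator system is $\widehat{\boldsymbol K}=\mathcal R^\Gamma_{\widehat Y_{\boldsymbol K}}$, and $W^\Gamma(\widehat{\boldsymbol K})$ means $W^\Gamma(\widehat Y_{\boldsymbol K})$. Morphisms. A level-preserving map $\Phi:\boldsymbol K\to\boldsymbol L$ is $\Gamma$-coordinate affine if there are scalars $\lambda_{j\ell}$ ($1\le j\le r$, $0\le\ell\le r$) such that $\gamma_j(\Phi(X))=\lambda_{j0}I+\sum_{\ell=1}^r\lambda_{j\ell}\gamma_\ell(X)$ for all $X\in\boldsymbol K$ and $1\le j\le r$. For such $\Phi$, $\Psi_\Phi:\widehat{\boldsymbol L}\to\widehat{\boldsymbol K}$ is the unital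 linear map with $\Psi_\Phi(\gamma_j(\widehat Y_{\boldsymbol L}))=\gamma_j(\Phi(\widehat Y_{\boldsymbol K}))$ for $1\le j\le r$, where $\Phi(\widehat Y_{\boldsymbol K})=\bigoplus_{X\in\boldsymbol K}\Phi(X)$. For an admissible $\Gamma$-ucp map $\Psi:\mathcal R_A^\Gamma\to\mathcal R_B^\Gamma$, $\Phi_\Psi:W^\Gamma(B)\to W^\Gamma(A)$ sends $Y=(\phi(B_1),\dots,\phi(B_g))$, with $\phi:\mathcal R_B^\Gamma\to M_n(\mathbb C)$ $\Gamma$-ucp, to $(\phi(\Psi(A_1)),\dots,\phi(\Psi(A_g)))$. *)

theory Defs
  imports
    "HOL-Analysis.Infinite_Sum"
    "HOL-Library.FuncSet"
    "HOL-Library.Poly_Mapping"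
    "Jordan_Normal_Form.Schur_Decomposition"
begin

text \<open>Indices are 0-based throughout: the variables are \<open>x\<^sub>0, \<dots>, x\<^sub>g\<^sub>-\<^sub>1\<close>, and
  tuples of matrices, operators and polynomials are lists.\<close>


section \<open>Noncommutative polynomials\<close>

text \<open>An element of the free algebra is a finitely supported function from words (lists of
  variable indices) to coefficients.\<close>

type_synonym ncpoly = "nat list \<Rightarrow>\<^sub>0 complex"

definition nc_poly_in :: "nat \<Rightarrow> ncpoly \<Rightarrow> bool" where
  "nc_poly_in g p \<longleftrightarrow> (\<forall>w\<in>Poly_Mapping.keys p. set w \<subseteq> {..<g})"

definition nc_var :: "nat \<Rightarrow> ncpoly" where
  "nc_var j = Poly_Mapping.single [j] 1"

definition nc_star :: "ncpoly \<Rightarrow> ncpoly" where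
  "nc_star p = Poly_Mapping.map_key rev (Poly_Mapping.map cnj p)"


section \<open>Matrix tuples\<close>

type_synonym mtuple = "complex mat list"

definition mat_sum :: "nat \<Rightarrow> 'b set \<Rightarrow> ('b \<Rightarrow> complex mat) \<Rightarrow> complex mat" where
  "mat_sum n I F = mat n n (\<lambda>(a, b). \<Sum>i\<in>I. F i $$ (a, b))"

definition mat_word :: "nat \<Rightarrow> mtuple \<Rightarrow> nat list \<Rightarrow> complex mat" where
  "mat_word n X w = foldr (\<lambda>j M. X ! j * M) w (1\<^sub>m n)"

definition mat_eval :: "nat \<Rightarrow> mtuple \<Rightarrow> ncpoly \<Rightarrow> complex mat" where
  "mat_eval n X p =
     mat_sum n (Poly_Mapping.keys p) (\<lambda>w. Poly_Mapping.lookup p w \<cdot>\<^sub>m mat_word n X w)"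

definition Gam :: "ncpoly list \<Rightarrow> nat \<Rightarrow> mtuple \<Rightarrow> mtuple" where
  "Gam \<Gamma> n X = map (mat_eval n X) \<Gamma>"

definition sa_tuples :: "nat \<Rightarrow> nat \<Rightarrow> mtuple set" where
  "sa_tuples g n =
     {X. length X = g \<and> (\<forall>M\<in>set X. M \<in> carrier_mat n n \<and> mat_adjoint M = M)}"

definition psd :: "nat \<Rightarrow> complex mat \<Rightarrow> bool" where
  "psd n M \<longleftrightarrow> M \<in> carrier_mat n n \<and> (\<forall>v\<in>carrier_vec n. 0 \<le> (M *\<^sub>v v) \<bullet>c v)"

definition isometry :: "nat \<Rightarrow> nat \<Rightarrow> complex mat \<Rightarrow> bool" where
  "isometry n m V \<longleftrightarrow> V \<in> carrier_mat n m \<and> mat_adjoint V * V = 1\<^sub>m m"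

definition unitary :: "nat \<Rightarrow> complex mat \<Rightarrow> bool" where
  "unitary n U \<longleftrightarrow>
     U \<in> carrier_mat n n \<and> mat_adjoint U * U = 1\<^sub>m n \<and> U * mat_adjoint U = 1\<^sub>m n"

definition compress :: "complex mat \<Rightarrow> mtuple \<Rightarrow> mtuple" where
  "compress V X = map (\<lambda>M. mat_adjoint V * M * V) X"

definition tuple_dsum :: "nat \<Rightarrow> nat \<Rightarrow> mtuple \<Rightarrow> mtuple \<Rightarrow> mtuple" where
  "tuple_dsum n m X Y = map2 (\<lambda>M N. four_block_mat M (0\<^sub>m n m) (0\<^sub>m m n) N) X Y"


section \<open>Graded sets\<close>

text \<open>The levels are \<open>n \<ge> 1\<close>; a graded set is represented by a function on all naturals that is
  empty at \<open>0\<close>, so that equality of graded sets is equality of functions.\<close>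

type_synonym gset = "nat \<Rightarrow> mtuple set"

definition graded :: "nat \<Rightarrow> gset \<Rightarrow> bool" where
  "graded g K \<longleftrightarrow> K 0 = {} \<and> (\<forall>n. K n \<subseteq> sa_tuples g n)"

definition points :: "gset \<Rightarrow> mtuple set" where
  "points K = (\<Union>n. K n)"

definition gclosure :: "nat \<Rightarrow> gset \<Rightarrow> gset" where
  "gclosure g K n = {Y \<in> sa_tuples g n. \<exists>X :: nat \<Rightarrow> mtuple. (\<forall>k. X k \<in> K n) \<and>
     (\<forall>j<g. \<forall>a<n. \<forall>b<n. (\<lambda>k. (X k ! j) $$ (a, b)) \<longlonglongrightarrow> (Y ! j) $$ (a, b))}"

definition gclosed :: "nat \<Rightarrow> gset \<Rightarrow> bool" where
  "gclosed g K \<longleftrightarrow> (\<forall>n. gclosure g K n \<subseteq> K n)"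

definition gbounded :: "nat \<Rightarrow> gset \<Rightarrow> bool" where
  "gbounded g K \<longleftrightarrow> (\<exists>R::real. R \<ge> 0 \<and> (\<forall>n. \<forall>X\<in>K n.
     psd n (complex_of_real (R\<^sup>2) \<cdot>\<^sub>m 1\<^sub>m n - mat_sum n {..<g} (\<lambda>j. X ! j * X ! j))))"

definition free_set :: "nat \<Rightarrow> gset \<Rightarrow> bool" where
  "free_set g K \<longleftrightarrow> graded g K \<and>
     (\<forall>n m. \<forall>X\<in>K n. \<forall>Y\<in>K m. tuple_dsum n m X Y \<in> K (n + m)) \<and>
     (\<forall>n U. \<forall>X\<in>K n. unitary n U \<longrightarrow> compress U X \<in> K n)"

definition Gamma_pair :: "ncpoly list \<Rightarrow> nat \<Rightarrow> nat \<Rightarrow> mtuple \<Rightarrow> complex mat \<Rightarrow> bool" where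
  "Gamma_pair \<Gamma> n m X V \<longleftrightarrow>
     isometry n m V \<and> compress V (Gam \<Gamma> n X) = Gam \<Gamma> m (compress V X)"

definition Gamma_convex :: "nat \<Rightarrow> ncpoly list \<Rightarrow> gset \<Rightarrow> bool" where
  "Gamma_convex g \<Gamma> K \<longleftrightarrow> free_set g K \<and>
     (\<forall>n m X V. 0 < m \<and> X \<in> K n \<and> Gamma_pair \<Gamma> n m X V \<longrightarrow> compress V X \<in> K m)"

definition matrix_convex :: "nat \<Rightarrow> gset \<Rightarrow> bool" where
  "matrix_convex g K \<longleftrightarrow> free_set g K \<and>
     (\<forall>n m X V. 0 < m \<and> X \<in> K n \<and> isometry n m V \<longrightarrow> compress V X \<in> K m)"

definition matco :: "nat \<Rightarrow> gset \<Rightarrow> gset" where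
  "matco g S n = \<Inter> {M n | M. matrix_convex g M \<and> (\<forall>k. S k \<subseteq> M k)}"

definition Gam_image :: "ncpoly list \<Rightarrow> gset \<Rightarrow> gset" where
  "Gam_image \<Gamma> K n = Gam \<Gamma> n ` K n"

definition Gam_preimage :: "nat \<Rightarrow> ncpoly list \<Rightarrow> gset \<Rightarrow> gset" where
  "Gam_preimage g \<Gamma> M n = {X \<in> sa_tuples g n. Gam \<Gamma> n X \<in> M n}"

definition Conv_obj :: "nat \<Rightarrow> ncpoly list \<Rightarrow> gset \<Rightarrow> bool" where
  "Conv_obj g \<Gamma> K \<longleftrightarrow>
     gclosed g K \<and> gbounded g K \<and> Gamma_convex g \<Gamma> K \<and> replicate g (0\<^sub>m 1 1) \<in> K 1 \<and>
     K = Gam_preimage g \<Gamma> (gclosure (length \<Gamma>) (matco (length \<Gamma>) (Gam_image \<Gamma> K)))"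

definition coord_affine :: "ncpoly list \<Rightarrow> gset \<Rightarrow> gset \<Rightarrow> (mtuple \<Rightarrow> mtuple) \<Rightarrow> bool" where
  "coord_affine \<Gamma> K L \<Phi> \<longleftrightarrow> (\<forall>n. \<forall>X\<in>K n. \<Phi> X \<in> L n) \<and>
     (\<exists>(c :: nat \<Rightarrow> complex) (d :: nat \<Rightarrow> nat \<Rightarrow> complex). \<forall>n. \<forall>X\<in>K n. \<forall>j<length \<Gamma>.
        mat_eval n (\<Phi> X) (\<Gamma> ! j) =
          c j \<cdot>\<^sub>m 1\<^sub>m n + mat_sum n {..<length \<Gamma>} (\<lambda>l. d j l \<cdot>\<^sub>m mat_eval n X (\<Gamma> ! l)))"


section \<open>Operators on Hilbert space\<close>

text \<open>Hilbert spaces are taken in coordinates, as \<open>\<ell>\<^sup>2(S)\<close> for an index set \<open>S\<close>; so \<open>\<complex>\<^sup>n\<close> is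
  \<open>\<ell>\<^sup>2({..<n})\<close>, and \<open>n \<times> n\<close> matrices are the operators on it (\<open>mat_of_op\<close> below).  An operator is a function that vanishes off \<open>\<ell>\<^sup>2(S)\<close>, so that
  equality of operators is equality of functions.\<close>

type_synonym 'i op = "('i \<Rightarrow> complex) \<Rightarrow> ('i \<Rightarrow> complex)"

definition ell2 :: "'i set \<Rightarrow> ('i \<Rightarrow> complex) set" where
  "ell2 S = {f. (\<forall>i. i \<notin> S \<longrightarrow> f i = 0) \<and> (\<lambda>i. (cmod (f i))\<^sup>2) summable_on UNIV}"

definition l2_inner :: "('i \<Rightarrow> complex) \<Rightarrow> ('i \<Rightarrow> complex) \<Rightarrow> complex" where
  "l2_inner f h = (\<Sum>\<^sub>\<infinity>i. f i * cnj (h i))"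

definition l2_norm :: "('i \<Rightarrow> complex) \<Rightarrow> real" where
  "l2_norm f = sqrt (\<Sum>\<^sub>\<infinity>i. (cmod (f i))\<^sup>2)"

definition bounded_op :: "'i set \<Rightarrow> 'i op \<Rightarrow> bool" where
  "bounded_op S T \<longleftrightarrow>
     (\<forall>f\<in>ell2 S. T f \<in> ell2 S) \<and> (\<forall>f. f \<notin> ell2 S \<longrightarrow> T f = (\<lambda>_. 0)) \<and>
     (\<forall>f\<in>ell2 S. \<forall>h\<in>ell2 S. \<forall>a b. T (\<lambda>i. a * f i + b * h i) = (\<lambda>i. a * T f i + b * T h i)) \<and>
     (\<exists>M. \<forall>f\<in>ell2 S. l2_norm (T f) \<le> M * l2_norm f)"

definition id_op :: "'i set \<Rightarrow> 'i op" where
  "id_op S f = (if f \<in> ell2 S then f else (\<lambda>_. 0))"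

definition op_word :: "'i set \<Rightarrow> 'i op list \<Rightarrow> nat list \<Rightarrow> 'i op" where
  "op_word S A w = foldr (\<lambda>j T. A ! j \<circ> T) w (id_op S)"

definition op_eval :: "'i set \<Rightarrow> 'i op list \<Rightarrow> ncpoly \<Rightarrow> 'i op" where
  "op_eval S A p =
     (\<lambda>f i. \<Sum>w\<in>Poly_Mapping.keys p. Poly_Mapping.lookup p w * op_word S A w f i)"

text \<open>Positivity of the operator matrix \<open>(P k l)\<close>, \<open>k, l < m\<close>, on the \<open>m\<close>-fold direct sum
  of \<open>\<ell>\<^sup>2(S)\<close>; the order on \<open>complex\<close> makes \<open>0 \<le> z\<close> include that \<open>z\<close> is real.\<close>

definition block_positive :: "'i set \<Rightarrow> nat \<Rightarrow> (nat \<Rightarrow> nat \<Rightarrow> 'i op) \<Rightarrow> bool" where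
  "block_positive S m P \<longleftrightarrow> (\<forall>v :: nat \<Rightarrow> 'i \<Rightarrow> complex. (\<forall>k<m. v k \<in> ell2 S) \<longrightarrow>
     0 \<le> (\<Sum>k<m. \<Sum>l<m. l2_inner (P k l (v l)) (v k)))"


section \<open>Operator systems of a polynomial tuple\<close>

text \<open>Since the generating tuple is part of the data, an operator system is represented by its
  index set and its generating tuple.\<close>

type_synonym 'i opsys = "'i set \<times> 'i op list"

definition Rsys :: "ncpoly list \<Rightarrow> 'i opsys \<Rightarrow> 'i op set" where
  "Rsys \<Gamma> a = (case a of (S, A) \<Rightarrow>
     {T. \<exists>(c :: complex) (d :: nat \<Rightarrow> complex).
        T = (\<lambda>f i. c * id_op S f i + (\<Sum>j<length \<Gamma>. d j * op_eval S A (\<Gamma> ! j) f i))})"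

definition lin_on :: "'i op set \<Rightarrow> ('i op \<Rightarrow> 'k op) \<Rightarrow> bool" where
  "lin_on R \<phi> \<longleftrightarrow> (\<forall>P\<in>R. \<forall>Q\<in>R. \<forall>c d.
     \<phi> (\<lambda>f i. c * P f i + d * Q f i) = (\<lambda>f i. c * \<phi> P f i + d * \<phi> Q f i))"

definition completely_positive :: "'i set \<Rightarrow> 'i op set \<Rightarrow> 'k set \<Rightarrow> ('i op \<Rightarrow> 'k op) \<Rightarrow> bool" where
  "completely_positive S R T \<phi> \<longleftrightarrow> (\<forall>m P. (\<forall>k<m. \<forall>l<m. P k l \<in> R) \<and> block_positive S m P \<longrightarrow>
     block_positive T m (\<lambda>k l. \<phi> (P k l)))"

definition Gamma_ucp :: "ncpoly list \<Rightarrow> 'i opsys \<Rightarrow> 'k set \<Rightarrow> ('i op \<Rightarrow> 'k op) \<Rightarrow> bool" where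
  "Gamma_ucp \<Gamma> a T \<phi> \<longleftrightarrow> (case a of (S, A) \<Rightarrow>
     (\<forall>P\<in>Rsys \<Gamma> a. bounded_op T (\<phi> P)) \<and> lin_on (Rsys \<Gamma> a) \<phi> \<and> \<phi> (id_op S) = id_op T \<and>
     completely_positive S (Rsys \<Gamma> a) T \<phi> \<and>
     (\<forall>p\<in>set \<Gamma>. \<phi> (op_eval S A p) = op_eval T (map \<phi> A) p))"

definition admissible ::
    "ncpoly list \<Rightarrow> 'i opsys \<Rightarrow> 'k opsys \<Rightarrow> ('i op \<Rightarrow> 'k op) \<Rightarrow> bool" where
  "admissible \<Gamma> a b \<Psi> \<longleftrightarrow>
     Gamma_ucp \<Gamma> a (fst b) \<Psi> \<and> \<Psi> ` Rsys \<Gamma> a \<subseteq> Rsys \<Gamma> b \<and>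
     (\<forall>n>0. \<forall>\<phi> :: 'k op \<Rightarrow> nat op.
        Gamma_ucp \<Gamma> b {..<n} \<phi> \<longrightarrow> Gamma_ucp \<Gamma> a {..<n} (\<phi> \<circ> \<Psi>))"

definition mat_of_op :: "nat \<Rightarrow> nat op \<Rightarrow> complex mat" where
  "mat_of_op n T = mat n n (\<lambda>(i, k). T (\<lambda>l. if l = k then 1 else 0) i)"

definition mtuple_of :: "nat \<Rightarrow> ('i op \<Rightarrow> nat op) \<Rightarrow> 'i opsys \<Rightarrow> mtuple" where
  "mtuple_of n \<phi> a = map (\<lambda>P. mat_of_op n (\<phi> P)) (snd a)"

definition WGamma :: "ncpoly list \<Rightarrow> 'i opsys \<Rightarrow> gset" where
  "WGamma \<Gamma> a n = {mtuple_of n \<phi> a | \<phi>. 0 < n \<and> Gamma_ucp \<Gamma> a {..<n} \<phi>}"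

text \<open>\<open>\<Psi>\<close> is the unital linear map on \<open>Rsys \<Gamma> a\<close> sending each \<open>\<gamma>\<^sub>j(A)\<close> to \<open>\<gamma>\<^sub>j(B)\<close>.
  Morphisms are extensional functions.\<close>

definition is_gen_map ::
    "ncpoly list \<Rightarrow> 'i opsys \<Rightarrow> 'k opsys \<Rightarrow> ('i op \<Rightarrow> 'k op) \<Rightarrow> bool" where
  "is_gen_map \<Gamma> a b \<Psi> \<longleftrightarrow> (case (a, b) of ((S, A), (T, B)) \<Rightarrow>
     \<Psi> \<in> extensional (Rsys \<Gamma> a) \<and> lin_on (Rsys \<Gamma> a) \<Psi> \<and> \<Psi> (id_op S) = id_op T \<and>
     (\<forall>p\<in>set \<Gamma>. \<Psi> (op_eval S A p) = op_eval T B p))"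

definition gen_map :: "ncpoly list \<Rightarrow> 'i opsys \<Rightarrow> 'k opsys \<Rightarrow> ('i op \<Rightarrow> 'k op)" where
  "gen_map \<Gamma> a b = (THE \<Psi>. is_gen_map \<Gamma> a b \<Psi>)"


section \<open>The two dualities on objects and morphisms\<close>

text \<open>The Hilbert space direct sum of \<open>\<complex>\<^sup>n\<close> over all \<open>n\<close> and \<open>X \<in> K n\<close> is \<open>\<ell>\<^sup>2(dsum_index K)\<close>.\<close>

type_synonym dsix = "nat \<times> mtuple \<times> nat"

definition dsum_index :: "gset \<Rightarrow> dsix set" where
  "dsum_index K = {(n, X, i). X \<in> K n \<and> i < n}"

definition dsum_op :: "gset \<Rightarrow> (mtuple \<Rightarrow> complex mat) \<Rightarrow> dsix op" where
  "dsum_op K F f = (if f \<in> ell2 (dsum_index K)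
     then (\<lambda>(n, X, i). if (n, X, i) \<in> dsum_index K
             then (\<Sum>k<n. F X $$ (i, k) * f (n, X, k)) else 0)
     else (\<lambda>_. 0))"

text \<open>The tuple \<open>\<Oplus>\<^sub>X \<Phi>(X)\<close>, \<open>X\<close> ranging over \<open>K\<close>; for the identity it generates the dual
  system of \<open>K\<close>.\<close>

definition dsum_sys :: "nat \<Rightarrow> gset \<Rightarrow> (mtuple \<Rightarrow> mtuple) \<Rightarrow> dsix opsys" where
  "dsum_sys g K \<Phi> = (dsum_index K, map (\<lambda>j. dsum_op K (\<lambda>X. \<Phi> X ! j)) [0..<g])"

definition hat :: "nat \<Rightarrow> gset \<Rightarrow> dsix opsys" where
  "hat g K = dsum_sys g K (\<lambda>X. X)"

definition unitarily_equiv :: "'i opsys \<Rightarrow> 'k opsys \<Rightarrow> bool" where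
  "unitarily_equiv a b \<longleftrightarrow> (case (a, b) of ((S, A), (T, B)) \<Rightarrow>
     length A = length B \<and> (\<forall>P\<in>set A. bounded_op S P) \<and> (\<forall>P\<in>set B. bounded_op T P) \<and>
     (\<exists>U :: ('i \<Rightarrow> complex) \<Rightarrow> ('k \<Rightarrow> complex). U ` ell2 S = ell2 T \<and>
        (\<forall>f\<in>ell2 S. \<forall>h\<in>ell2 S. \<forall>c d. U (\<lambda>i. c * f i + d * h i) = (\<lambda>i. c * U f i + d * U h i)) \<and>
        (\<forall>f\<in>ell2 S. \<forall>h\<in>ell2 S. l2_inner (U f) (U h) = l2_inner f h) \<and>
        (\<forall>j<length A. \<forall>f\<in>ell2 S. U ((A ! j) f) = (B ! j) (U f))))"

definition Psi_of ::
    "nat \<Rightarrow> ncpoly list \<Rightarrow> gset \<Rightarrow> gset \<Rightarrow> (mtuple \<Rightarrow> mtuple) \<Rightarrow> (dsix op \<Rightarrow> dsix op)" where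
  "Psi_of g \<Gamma> K L \<Phi> = gen_map \<Gamma> (hat g L) (dsum_sys g K \<Phi>)"

definition Phi_of ::
    "ncpoly list \<Rightarrow> 'i opsys \<Rightarrow> 'k opsys \<Rightarrow> ('i op \<Rightarrow> 'k op) \<Rightarrow> (mtuple \<Rightarrow> mtuple)" where
  "Phi_of \<Gamma> a b \<Psi> = restrict
     (\<lambda>Y. THE Z. \<exists>n>0. \<exists>\<phi>. Gamma_ucp \<Gamma> b {..<n} \<phi> \<and>
        Y = mtuple_of n \<phi> b \<and> Z = mtuple_of n (\<phi> \<circ> \<Psi>) a)
     (points (WGamma \<Gamma> b))"


section \<open>Categories and contravariant equivalence\<close>

text \<open>\<open>Cmp C a b c k f\<close> is the composite of \<open>f\<close> from \<open>a\<close> to \<open>b\<close> followed by \<open>k\<close> from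
  \<open>b\<close> to \<open>c\<close>.\<close>

record ('o, 'm) cat =
  Obj :: "'o set"
  Hom :: "'o \<Rightarrow> 'o \<Rightarrow> 'm set"
  Idt :: "'o \<Rightarrow> 'm"
  Cmp :: "'o \<Rightarrow> 'o \<Rightarrow> 'o \<Rightarrow> 'm \<Rightarrow> 'm \<Rightarrow> 'm"

definition category :: "('o, 'm) cat \<Rightarrow> bool" where
  "category C \<longleftrightarrow>
     (\<forall>a\<in>Obj C. Idt C a \<in> Hom C a a) \<and>
     (\<forall>a\<in>Obj C. \<forall>b\<in>Obj C. \<forall>c\<in>Obj C. \<forall>f\<in>Hom C a b. \<forall>k\<in>Hom C b c. Cmp C a b c k f \<in> Hom C a c) \<and>
     (\<forall>a\<in>Obj C. \<forall>b\<in>Obj C. \<forall>f\<in>Hom C a b.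
        Cmp C a a b f (Idt C a) = f \<and> Cmp C a b b (Idt C b) f = f) \<and>
     (\<forall>a\<in>Obj C. \<forall>b\<in>Obj C. \<forall>c\<in>Obj C. \<forall>d\<in>Obj C.
        \<forall>f\<in>Hom C a b. \<forall>k\<in>Hom C b c. \<forall>h\<in>Hom C c d.
        Cmp C a c d h (Cmp C a b c k f) = Cmp C a b d (Cmp C b c d h k) f)"

definition contra_functor ::
    "('o, 'm) cat \<Rightarrow> ('p, 'q) cat \<Rightarrow> ('o \<Rightarrow> 'p) \<Rightarrow> ('o \<Rightarrow> 'o \<Rightarrow> 'm \<Rightarrow> 'q) \<Rightarrow> bool" where
  "contra_functor C D Fo Fm \<longleftrightarrow>
     (\<forall>a\<in>Obj C. Fo a \<in> Obj D) \<and>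
     (\<forall>a\<in>Obj C. \<forall>b\<in>Obj C. \<forall>f\<in>Hom C a b. Fm a b f \<in> Hom D (Fo b) (Fo a)) \<and>
     (\<forall>a\<in>Obj C. Fm a a (Idt C a) = Idt D (Fo a)) \<and>
     (\<forall>a\<in>Obj C. \<forall>b\<in>Obj C. \<forall>c\<in>Obj C. \<forall>f\<in>Hom C a b. \<forall>k\<in>Hom C b c.
        Fm a c (Cmp C a b c k f) = Cmp D (Fo c) (Fo b) (Fo a) (Fm a b f) (Fm b c k))"

definition iso_arrow :: "('o, 'm) cat \<Rightarrow> 'o \<Rightarrow> 'o \<Rightarrow> 'm \<Rightarrow> bool" where
  "iso_arrow C a b f \<longleftrightarrow> f \<in> Hom C a b \<and>
     (\<exists>k\<in>Hom C b a. Cmp C a b a k f = Idt C a \<and> Cmp C b a b f k = Idt C b)"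

text \<open>\<open>\<eta>\<close> is a natural isomorphism from the identity functor to the endofunctor \<open>(Fo, Fm)\<close>.\<close>

definition nat_iso_from_id ::
    "('o, 'm) cat \<Rightarrow> ('o \<Rightarrow> 'o) \<Rightarrow> ('o \<Rightarrow> 'o \<Rightarrow> 'm \<Rightarrow> 'm) \<Rightarrow> ('o \<Rightarrow> 'm) \<Rightarrow> bool" where
  "nat_iso_from_id C Fo Fm \<eta> \<longleftrightarrow>
     (\<forall>a\<in>Obj C. iso_arrow C a (Fo a) (\<eta> a)) \<and>
     (\<forall>a\<in>Obj C. \<forall>b\<in>Obj C. \<forall>f\<in>Hom C a b.
        Cmp C a b (Fo b) (\<eta> b) f = Cmp C a (Fo a) (Fo b) (Fm a b f) (\<eta> a))"

definition contra_equivalent :: "('o, 'm) cat \<Rightarrow> ('p, 'q) cat \<Rightarrow> bool" where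
  "contra_equivalent C D \<longleftrightarrow> (\<exists>Fo Fm Go Gm \<eta> \<theta>.
     contra_functor C D Fo Fm \<and> contra_functor D C Go Gm \<and>
     nat_iso_from_id C (\<lambda>a. Go (Fo a)) (\<lambda>a b f. Gm (Fo b) (Fo a) (Fm a b f)) \<eta> \<and>
     nat_iso_from_id D (\<lambda>a. Fo (Go a)) (\<lambda>a b f. Fm (Go b) (Go a) (Gm a b f)) \<theta>)"

definition Conv :: "nat \<Rightarrow> ncpoly list \<Rightarrow> (gset, mtuple \<Rightarrow> mtuple) cat" where
  "Conv g \<Gamma> = \<lparr>
     Obj = {K. Conv_obj g \<Gamma> K},
     Hom = (\<lambda>K L. {\<Phi> \<in> extensional (points K). coord_affine \<Gamma> K L \<Phi>}),
     Idt = (\<lambda>K. restrict (\<lambda>X. X) (points K)),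
     Cmp = (\<lambda>K L M \<Phi>' \<Phi>. compose (points K) \<Phi>' \<Phi>)\<rparr>"

text \<open>The direct sum generating a dual system is determined only up to unitary equivalence, so the
  objects of \<open>OS\<close> are the dual systems with the generating tuple taken up to unitary
  equivalence.  A complete order isomorphism fixing the generators would be too coarse a notion
  here: it need not preserve polynomials in them, and composites of admissible maps may then fail
  to be \<open>\<Gamma>\<close>-ucp.\<close>

definition OS_obj :: "nat \<Rightarrow> ncpoly list \<Rightarrow> dsix opsys \<Rightarrow> bool" where
  "OS_obj g \<Gamma> a \<longleftrightarrow> (\<exists>K. Conv_obj g \<Gamma> K \<and> unitarily_equiv a (hat g K))"

definition OS :: "nat \<Rightarrow> ncpoly list \<Rightarrow> (dsix opsys, dsix op \<Rightarrow> dsix op) cat" where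
  "OS g \<Gamma> = \<lparr>
     Obj = {a. OS_obj g \<Gamma> a},
     Hom = (\<lambda>a b. {\<Psi> \<in> extensional (Rsys \<Gamma> a). admissible \<Gamma> a b \<Psi>}),
     Idt = (\<lambda>a. restrict (\<lambda>P. P) (Rsys \<Gamma> a)),
     Cmp = (\<lambda>a b c \<Psi>' \<Psi>. compose (Rsys \<Gamma> a) \<Psi>' \<Psi>)\<rparr>"

end

theory Submission
  imports Defs "HOL-Analysis.Elementary_Metric_Spaces" "HOL-Analysis.Convex"
begin

text \<open>An operator system in the category is represented by functions on a graded set: the element
  \<open>c + \<Sum>\<^sub>j d\<^sub>j \<gamma>\<^sub>j(A)\<close> has the value \<open>c + \<Sum>\<^sub>j d\<^sub>j \<gamma>\<^sub>j(X)\<close> at \<open>X\<close>, and equality, matrix positivity and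
  polynomial relations hold in the system iff they hold at every point.  Point evaluations are
  \<open>\<Gamma>\<close>-ucp.  Conversely, the tuple \<open>Y\<close> of a \<open>\<Gamma>\<close>-ucp map into \<open>M\<^sub>n\<close> satisfies every matrix inequality
  that is valid on \<open>K\<close>, so by a Hahn-Banach argument in the cone of the tuples
  \<open>(V\<^sup>* V, V\<^sup>* \<Gamma>(X) V)\<close> the tuple \<open>\<Gamma>(Y)\<close> is a limit of compressions of points of \<open>\<Gamma>(K)\<close> by isometries,
  and the defining equation of the objects gives \<open>Y \<in> K\<close>; no extension theorem for completely
  positive maps is needed.  Morphisms correspond by \<open>(\<Psi> P)(Y) = P(\<Phi> Y)\<close>, where each of \<open>\<Phi>\<close>, \<open>\<Psi>\<close>
  determines the other, and all functor laws follow from this uniqueness.\<close>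


text \<open>A realized system records polynomial relations at arbitrary tuples of its elements,
  beyond those at the generators. A morphism replaces the generators by another tuple of the same
  system, whose polynomials are known point by point only; the recorded relations lift the pointwise
  formula to an operator identity. The cone in the Hahn-Banach step carries
  \<open>V\<^sup>* V\<close> as an extra coordinate because compressions by isometries alone do not
  form a cone. Its sums come from direct sums in \<open>K\<close>, the sizes of the points involved
  are unbounded, and the cone is not known to be closed. So the separation argument yields
  approximations; the condition \<open>V\<^sup>* V = I\<close> is then restored exactly by means of
  the point 0, and the remaining error disappears in the closure contained in the defining equation
  of the objects. A \<open>\<Gamma>\<close>-ucp map is only known to preserve the polynomials of
  \<open>\<Gamma>\<close> at the generators, and admissibility tests it against matrix-valued maps
  only; hence even closure of the morphisms under composition is proved by passing to the maps of
  points and back.\<close>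

section \<open>Separation from a convex cone\<close>

text \<open>First-order condition at a one-sided minimum: for small \<open>t\<close> the linear term
  decides the sign, so a negative \<open>b\<close> would make the expression negative.\<close>

lemma quadratic_nonneg_imp:
  fixes b s :: real
  assumes "\<And>t. 0 \<le> t \<Longrightarrow> t \<le> 1 \<Longrightarrow> 0 \<le> 2 * t * b + t\<^sup>2 * s" and "0 \<le> s"
  shows "0 \<le> b"
proof (rule ccontr)
  assume "\<not> 0 \<le> b"
  then have b: "b < 0" by simp
  \<comment> \<open>The denominator exceeds both \<open>- b\<close> and \<open>s\<close>, so
    \<open>t \<le> 1\<close> and \<open>t * s \<le> - b\<close>; hence
    \<open>2 * b + t * s \<le> b < 0\<close>.\<close>
  define t where "t = - b / (s - b + 1)"
  have t: "0 < t" "t \<le> 1" "t * s \<le> - b"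
    using b assms(2) by (auto simp: t_def field_simps mult_nonneg_nonpos)
  have "0 \<le> t * (2 * b + t * s)"
    using assms(1)[of t] t by (simp add: algebra_simps power2_eq_square)
  then show False using t b by (simp add: zero_le_mult_iff)
qed

lemma cmod_add_square: "(cmod (x + of_real t * y))\<^sup>2 = (cmod x)\<^sup>2 + 2 * t * Re (cnj x * y) + t\<^sup>2 * (cmod y)\<^sup>2"
  unfolding cmod_power2 by (simp add: algebra_simps power2_eq_square)

text \<open>Near-minimisers of the distance from \<open>p\<close> to the cone \<open>Q\<close> form a Cauchy sequence by the
  parallelogram law, so no closedness of \<open>Q\<close> is needed; \<open>h\<close> is the limit of their differences
  with \<open>p\<close>.\<close>

lemma cone_separation:
  fixes p :: "'a \<Rightarrow> complex" and Q :: "('a \<Rightarrow> complex) set"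
  assumes I: "finite I" and ne: "Q \<noteq> {}"
    and add: "\<And>q q'. q \<in> Q \<Longrightarrow> q' \<in> Q \<Longrightarrow> (\<lambda>i. q i + q' i) \<in> Q"
    and scl: "\<And>q t. q \<in> Q \<Longrightarrow> 0 \<le> t \<Longrightarrow> (\<lambda>i. complex_of_real t * q i) \<in> Q"
    and eps: "0 < \<epsilon>" and gap: "\<And>q. q \<in> Q \<Longrightarrow> \<epsilon> \<le> (\<Sum>i\<in>I. (cmod (q i - p i))\<^sup>2)"
  obtains h where "\<And>q. q \<in> Q \<Longrightarrow> 0 \<le> Re (\<Sum>i\<in>I. cnj (h i) * q i)"
    and "Re (\<Sum>i\<in>I. cnj (h i) * p i) < 0"
proof -
  define N where "N q = (\<Sum>i\<in>I. (cmod (q i - p i))\<^sup>2)" for q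
  define \<delta> where "\<delta> = (INF q\<in>Q. N q)"
  have bdd: "bdd_below (N ` Q)"
    by (rule bdd_belowI2[where m = 0]) (auto simp: N_def intro: sum_nonneg)
  have \<delta>_le: "\<delta> \<le> N q" if "q \<in> Q" for q
    unfolding \<delta>_def using bdd that by (rule cINF_lower)
  have \<epsilon>_le: "\<epsilon> \<le> \<delta>"
    unfolding \<delta>_def using ne gap by (intro cINF_greatest) (auto simp: N_def)
  have "\<exists>q\<in>Q. N q < \<delta> + 1 / real (Suc k)" for k
  proof -
    have "(INF q\<in>Q. N q) < \<delta> + 1 / real (Suc k)" unfolding \<delta>_def[symmetric] by simp
    then show ?thesis by (subst (asm) cINF_less_iff[OF ne bdd])
  qed
  then obtain q where qQ: "\<And>k. q k \<in> Q" and qN: "\<And>k. N (q k) < \<delta> + 1 / real (Suc k)"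
    by metis
  have par: "(cmod (q k i - q l i))\<^sup>2 \<le> 2 / real (Suc k) + 2 / real (Suc l)" if "i \<in> I" for i k l
  proof -
    define a where "a i = q k i - p i" for i
    define b where "b i = q l i - p i" for i
    \<comment> \<open>The midpoint of \<open>q k\<close> and \<open>q l\<close> belongs to the cone,
      so its squared distance from \<open>p\<close> is at least \<open>\<delta>\<close>; the
      parallelogram law then bounds the difference of \<open>q k\<close> and
      \<open>q l\<close>.\<close>
    define m where "m = (\<lambda>i. complex_of_real (1/2) * (q k i + q l i))"
    have "m \<in> Q" unfolding m_def by (rule scl) (auto intro: add qQ)
    then have "\<delta> \<le> N m" by (rule \<delta>_le)
    have pt: "(cmod (a j - b j))\<^sup>2 = 2 * (cmod (a j))\<^sup>2 + 2 * (cmod (b j))\<^sup>2 - 4 * (cmod (m j - p j))\<^sup>2" for j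
    proof -
      have "m j - p j = (a j + b j) / 2" by (simp add: m_def a_def b_def field_simps)
      then have *: "(cmod (m j - p j))\<^sup>2 = (cmod (a j + b j))\<^sup>2 / 4"
        by (simp only: norm_divide power_divide) simp
      show ?thesis unfolding * unfolding cmod_power2 by (simp add: algebra_simps power2_eq_square)
    qed
    have "(cmod (q k i - q l i))\<^sup>2 = (cmod (a i - b i))\<^sup>2" by (simp add: a_def b_def)
    also have "\<dots> \<le> (\<Sum>j\<in>I. (cmod (a j - b j))\<^sup>2)"
      using that I by (intro member_le_sum) auto
    also have "\<dots> = 2 * N (q k) + 2 * N (q l) - 4 * N m"
      unfolding pt N_def by (simp add: sum.distrib sum_subtractf sum_distrib_left a_def b_def)
    also have "\<dots> \<le> 2 / real (Suc k) + 2 / real (Suc l)"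
      using \<open>\<delta> \<le> N m\<close> qN[of k] qN[of l] by argo
    finally show ?thesis .
  qed
  have conv: "convergent (\<lambda>k. q k i)" if "i \<in> I" for i
  proof -
    have "Cauchy (\<lambda>k. q k i)"
    proof (rule metric_CauchyI)
      fix e :: real assume e: "0 < e"
      obtain M where M: "4 / e\<^sup>2 < real M" using reals_Archimedean2 by blast
      have "dist (q k i) (q l i) < e" if "M \<le> k" "M \<le> l" for k l
      proof -
        have "2 / real (Suc k') < e\<^sup>2 / 2" if "M \<le> k'" for k'
        proof -
          have "4 / e\<^sup>2 < real (Suc k')" using M that by linarith
          then show ?thesis using e by (simp add: field_simps)
        qed
        from this[OF that(1)] this[OF that(2)] par[OF \<open>i \<in> I\<close>, of k l]
        have "(cmod (q k i - q l i))\<^sup>2 < e\<^sup>2" by linarith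
        then show ?thesis using e by (simp add: dist_norm power_less_imp_less_base)
      qed
      then show "\<exists>M. \<forall>m\<ge>M. \<forall>n\<ge>M. dist (q m i) (q n i) < e" by blast
    qed
    then show ?thesis by (simp add: Cauchy_convergent_iff)
  qed
  define u where "u i = lim (\<lambda>k. q k i)" for i
  have qu: "(\<lambda>k. q k i) \<longlonglongrightarrow> u i" if "i \<in> I" for i
    using conv[OF that] unfolding u_def by (simp add: convergent_LIMSEQ_iff)
  define h where "h i = u i - p i" for i
  \<comment> \<open>\<open>2 * B x\<close> is the derivative at \<open>u\<close>, in the direction
    \<open>x\<close>, of the squared distance from \<open>p\<close>, as \<open>expand\<close>
    shows.\<close>
  define B where "B x = Re (\<Sum>i\<in>I. cnj (h i) * x i)" for x
  define S where "S x = (\<Sum>i\<in>I. (cmod (x i))\<^sup>2)" for x :: "'a \<Rightarrow> complex"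
  have inv0: "(\<lambda>k. 1 / real (Suc k)) \<longlonglongrightarrow> 0"
    using LIMSEQ_inverse_real_of_nat by (simp add: inverse_eq_divide)
  have Nu: "(\<lambda>k. N (q k)) \<longlonglongrightarrow> N u"
    unfolding N_def by (intro tendsto_intros qu)
  have "N u = \<delta>"
  proof (rule LIMSEQ_unique[OF Nu])
    show "(\<lambda>k. N (q k)) \<longlonglongrightarrow> \<delta>"
    proof (rule tendsto_sandwich[where f = "\<lambda>_. \<delta>" and h = "\<lambda>k. \<delta> + 1 / real (Suc k)"])
      show "(\<lambda>k. \<delta> + 1 / real (Suc k)) \<longlonglongrightarrow> \<delta>" using tendsto_add[OF tendsto_const inv0] by simp
      show "\<forall>\<^sub>F k in sequentially. \<delta> \<le> N (q k)" by (simp add: \<delta>_le qQ)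
      show "\<forall>\<^sub>F k in sequentially. N (q k) \<le> \<delta> + 1 / real (Suc k)"
        by (intro always_eventually allI less_imp_le qN)
    qed simp
  qed
  have expand: "(\<Sum>i\<in>I. (cmod (u i + of_real t * x i - p i))\<^sup>2) = N u + 2 * t * B x + t\<^sup>2 * S x" for t x
  proof -
    have "(cmod (u i + of_real t * x i - p i))\<^sup>2 =
        (cmod (u i - p i))\<^sup>2 + 2 * t * Re (cnj (h i) * x i) + t\<^sup>2 * (cmod (x i))\<^sup>2" for i
      using cmod_add_square[of "h i" t "x i"] by (simp add: h_def algebra_simps)
    then show ?thesis
      by (simp only: N_def B_def S_def sum.distrib sum_distrib_left Re_sum)
  qed
  have Bnn: "0 \<le> B x" if x: "x \<in> Q" for x
  proof (rule quadratic_nonneg_imp)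
    fix t :: real assume t: "0 \<le> t" "t \<le> 1"
    \<comment> \<open>The limit \<open>u\<close> may lie outside \<open>Q\<close>; the bound holds
      for \<open>q k\<close> moved in the direction \<open>x\<close>, which stays in
      \<open>Q\<close>, and passes to the limit.\<close>
    have "\<delta> \<le> (\<Sum>i\<in>I. (cmod (u i + of_real t * x i - p i))\<^sup>2)"
    proof (rule LIMSEQ_le_const)
      show "(\<lambda>k. N (\<lambda>i. q k i + of_real t * x i)) \<longlonglongrightarrow> (\<Sum>i\<in>I. (cmod (u i + of_real t * x i - p i))\<^sup>2)"
        unfolding N_def by (intro tendsto_intros qu)
      show "\<exists>M. \<forall>k\<ge>M. \<delta> \<le> N (\<lambda>i. q k i + of_real t * x i)"
        using t x by (auto intro!: \<delta>_le add scl qQ)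
    qed
    then show "0 \<le> 2 * t * B x + t\<^sup>2 * S x"
      unfolding expand \<open>N u = \<delta>\<close> by simp
  qed (auto simp: S_def intro: sum_nonneg)
  \<comment> \<open>This variation moves towards the vertex: the multiples of \<open>q k\<close> by
    \<open>1 - t\<close> are in the cone because \<open>t \<le> 1\<close>.\<close>
  have "0 \<le> - B u"
  proof (rule quadratic_nonneg_imp)
    fix t :: real assume t: "0 \<le> t" "t \<le> 1"
    have "\<delta> \<le> (\<Sum>i\<in>I. (cmod (u i + of_real (- t) * u i - p i))\<^sup>2)"
    proof (rule LIMSEQ_le_const)
      show "(\<lambda>k. N (\<lambda>i. of_real (1 - t) * q k i)) \<longlonglongrightarrow> (\<Sum>i\<in>I. (cmod (u i + of_real (- t) * u i - p i))\<^sup>2)"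
      proof -
        have "(\<Sum>i\<in>I. (cmod (u i + of_real (- t) * u i - p i))\<^sup>2) = N (\<lambda>i. of_real (1 - t) * u i)"
          by (simp add: N_def algebra_simps)
        moreover have "(\<lambda>k. N (\<lambda>i. of_real (1 - t) * q k i)) \<longlonglongrightarrow> N (\<lambda>i. of_real (1 - t) * u i)"
          unfolding N_def by (intro tendsto_intros qu)
        ultimately show ?thesis by simp
      qed
      show "\<exists>M. \<forall>k\<ge>M. \<delta> \<le> N (\<lambda>i. of_real (1 - t) * q k i)"
        using t by (auto intro!: \<delta>_le scl qQ simp del: of_real_diff)
    qed
    then show "0 \<le> 2 * t * (- B u) + t\<^sup>2 * S u"
      unfolding expand \<open>N u = \<delta>\<close> by simp
  qed (auto simp: S_def intro: sum_nonneg)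
  \<comment> \<open>Since \<open>B u \<le> 0\<close> and
    \<open>N u = \<delta> \<ge> \<epsilon>\<close>, the value of the functional at \<open>p\<close>
    is at most \<open>- \<epsilon>\<close>, whence the strict sign.\<close>
  moreover have "B u = N u + Re (\<Sum>i\<in>I. cnj (h i) * p i)"
  proof -
    have "Re (cnj (h i) * u i) = (cmod (u i - p i))\<^sup>2 + Re (cnj (h i) * p i)" for i
      unfolding cmod_power2 h_def by (simp add: algebra_simps power2_eq_square)
    then show ?thesis by (simp add: B_def N_def sum.distrib)
  qed
  ultimately have "Re (\<Sum>i\<in>I. cnj (h i) * p i) < 0"
    using \<open>N u = \<delta>\<close> \<epsilon>_le eps by linarith
  with Bnn show thesis unfolding B_def by (rule that)
qed


section \<open>Matrices and noncommutative polynomials\<close>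

lemma mat_adjoint_simps [simp]:
  "dim_row (mat_adjoint A) = dim_col A" "dim_col (mat_adjoint A) = dim_row A"
  "i < dim_col A \<Longrightarrow> j < dim_row A \<Longrightarrow> mat_adjoint A $$ (i, j) = conjugate (A $$ (j, i))"
  by (auto simp: mat_adjoint_def mat_of_rows_def)

lemma mat_adjoint_carrier: "A \<in> carrier_mat n m \<Longrightarrow> mat_adjoint A \<in> carrier_mat m n"
  by (intro carrier_matI) auto

lemma mult_entry:
  assumes "A \<in> carrier_mat n m" "B \<in> carrier_mat m k" "i < n" "j < k"
  shows "(A * B) $$ (i, j) = (\<Sum>l<m. A $$ (i, l) * B $$ (l, j))"
  using assms by (auto simp: scalar_prod_def lessThan_atLeast0 intro!: sum.cong)

lemma mat_adjoint_mult:
  fixes A B :: "complex mat"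
  assumes "A \<in> carrier_mat n m" "B \<in> carrier_mat m k"
  shows "mat_adjoint (A * B) = mat_adjoint B * mat_adjoint A"
proof (rule eq_matI)
  fix i j assume "i < dim_row (mat_adjoint B * mat_adjoint A)" "j < dim_col (mat_adjoint B * mat_adjoint A)"
  then have ij: "i < k" "j < n" using assms by auto
  have "mat_adjoint (A * B) $$ (i, j) = cnj ((A * B) $$ (j, i))" using ij assms by simp
  also have "\<dots> = (\<Sum>l<m. cnj (A $$ (j, l)) * cnj (B $$ (l, i)))"
    using mult_entry[OF assms ij(2,1)] by simp
  also have "\<dots> = (\<Sum>l<m. mat_adjoint B $$ (i, l) * mat_adjoint A $$ (l, j))"
    using assms ij by (intro sum.cong) (auto simp: mult.commute)
  also have "\<dots> = (mat_adjoint B * mat_adjoint A) $$ (i, j)"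
    using assms ij by (subst mult_entry[of _ k m _ n]) (auto intro: mat_adjoint_carrier)
  finally show "mat_adjoint (A * B) $$ (i, j) = (mat_adjoint B * mat_adjoint A) $$ (i, j)" .
qed (use assms in auto)

text \<open>The tuple of a \<open>\<Gamma>\<close>-ucp map is at first only known to be of this
  kind; \<open>dominated_sa\<close> later derives self-adjointness from matrix inequalities.\<close>

definition mtuples :: "nat \<Rightarrow> nat \<Rightarrow> mtuple set" where
  "mtuples g n = {X. length X = g \<and> set X \<subseteq> carrier_mat n n}"

lemma sa_tuples_mtuples: "X \<in> sa_tuples g n \<Longrightarrow> X \<in> mtuples g n"
  by (auto simp: sa_tuples_def mtuples_def)

lemma mtuples_nth: "X \<in> mtuples g n \<Longrightarrow> j < g \<Longrightarrow> X ! j \<in> carrier_mat n n"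
  by (auto simp: mtuples_def)

section \<open>Words and polynomials in matrix tuples\<close>

lemma mat_word_carrier:
  assumes "X \<in> mtuples g n" "set w \<subseteq> {..<g}"
  shows "mat_word n X w \<in> carrier_mat n n"
  using assms(2) by (induction w) (auto simp: mat_word_def intro!: mult_carrier_mat mtuples_nth[OF assms(1)])

lemma mat_word_Cons: "mat_word n X (j # w) = X ! j * mat_word n X w"
  by (simp add: mat_word_def)

lemma mat_word_Nil [simp]: "mat_word n X [] = 1\<^sub>m n"
  by (simp add: mat_word_def)

lemma mat_word_append:
  assumes X: "X \<in> mtuples g n" and "set u \<subseteq> {..<g}" "set w \<subseteq> {..<g}"
  shows "mat_word n X (u @ w) = mat_word n X u * mat_word n X w"
  using assms(2)
proof (induction u)
  case Nil
  then show ?case using mat_word_carrier[OF X assms(3)] by simp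
next
  case (Cons j u)
  then have "j < g" "set u \<subseteq> {..<g}" by auto
  then show ?case
    using Cons.IH mtuples_nth[OF X] mat_word_carrier[OF X, of u] mat_word_carrier[OF X assms(3)]
    by (simp add: mat_word_Cons assoc_mult_mat[of _ n n _ n _ n])
qed

lemma mat_sum_carrier [simp]: "mat_sum n I F \<in> carrier_mat n n"
  by (simp add: mat_sum_def)

lemma mat_sum_dims [simp]: "dim_row (mat_sum n I F) = n" "dim_col (mat_sum n I F) = n"
  by (simp_all add: mat_sum_def)

lemma mat_sum_entry [simp]:
  "a < n \<Longrightarrow> b < n \<Longrightarrow> mat_sum n I F $$ (a, b) = (\<Sum>i\<in>I. F i $$ (a, b))"
  by (simp add: mat_sum_def)

lemma mat_eval_carrier [simp]: "mat_eval n X p \<in> carrier_mat n n"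
  by (simp add: mat_eval_def)

lemma mat_eval_dims [simp]: "dim_row (mat_eval n X p) = n" "dim_col (mat_eval n X p) = n"
  by (simp_all add: mat_eval_def)

lemma nc_poly_in_keys: "nc_poly_in g p \<Longrightarrow> w \<in> Poly_Mapping.keys p \<Longrightarrow> set w \<subseteq> {..<g}"
  by (auto simp: nc_poly_in_def)

lemma mat_eval_entry:
  assumes "X \<in> mtuples g n" "nc_poly_in g p" "a < n" "b < n"
  shows "mat_eval n X p $$ (a, b) =
    (\<Sum>w\<in>Poly_Mapping.keys p. Poly_Mapping.lookup p w * mat_word n X w $$ (a, b))"
proof -
  have "(Poly_Mapping.lookup p w \<cdot>\<^sub>m mat_word n X w) $$ (a, b) =
      Poly_Mapping.lookup p w * mat_word n X w $$ (a, b)" if "w \<in> Poly_Mapping.keys p" for w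
    using mat_word_carrier[OF assms(1) nc_poly_in_keys[OF assms(2) that]] assms(3,4) by simp
  then show ?thesis using assms(3,4) by (simp add: mat_eval_def)
qed

lemma keys_nc_var [simp]: "Poly_Mapping.keys (nc_var j) = {[j]}"
  by (simp add: nc_var_def)

lemma lookup_nc_var [simp]: "Poly_Mapping.lookup (nc_var j) [j] = 1"
  by (simp add: nc_var_def)

lemma nc_poly_in_var [simp]: "nc_poly_in g (nc_var j) \<longleftrightarrow> j < g"
  by (simp add: nc_poly_in_def)

lemma mat_eval_var:
  assumes "X \<in> mtuples g n" "j < g"
  shows "mat_eval n X (nc_var j) = X ! j"
  using mtuples_nth[OF assms] assms
  by (intro eq_matI) (auto simp: mat_eval_entry[OF assms(1)] mat_word_Cons)

lemma mat_word_adjoint: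
  assumes "X \<in> sa_tuples g n" "set w \<subseteq> {..<g}"
  shows "mat_adjoint (mat_word n X w) = mat_word n X (rev w)"
  using assms(2)
proof (induction w)
  case Nil
  show ?case by (intro eq_matI) auto
next
  case (Cons j w)
  note X = sa_tuples_mtuples[OF assms(1)]
  from Cons have jw: "j < g" "set w \<subseteq> {..<g}" "set (rev w) \<subseteq> {..<g}" "set [j] \<subseteq> {..<g}" by auto
  have "mat_adjoint (X ! j) = X ! j" using assms(1) jw by (auto simp: sa_tuples_def)
  then show ?case
    using mat_adjoint_mult[OF mtuples_nth[OF X jw(1)] mat_word_carrier[OF X jw(2)]] Cons.IH[OF jw(2)]
      mtuples_nth[OF X jw(1)]
    by (simp add: mat_word_Cons mat_word_append[OF X jw(3,4)])
qed

lemma lookup_nc_star: "Poly_Mapping.lookup (nc_star p) w = cnj (Poly_Mapping.lookup p (rev w))"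
proof -
  have "inj (rev :: nat list \<Rightarrow> nat list)" by (simp add: inj_on_def)
  then show ?thesis
    unfolding nc_star_def by (simp add: Poly_Mapping.map_key.rep_eq Poly_Mapping.map.rep_eq when_def)
qed

lemma mat_eval_adjoint:
  assumes X: "X \<in> sa_tuples g n" and p: "nc_poly_in g p" and star: "nc_star p = p"
  shows "mat_adjoint (mat_eval n X p) = mat_eval n X p"
proof (rule eq_matI)
  fix i j assume "i < dim_row (mat_eval n X p)" "j < dim_col (mat_eval n X p)"
  then have ij: "i < n" "j < n" by auto
  note Xm = sa_tuples_mtuples[OF X]
  have lk: "Poly_Mapping.lookup p (rev w) = cnj (Poly_Mapping.lookup p w)" for w
    using lookup_nc_star[of p "rev w"] star by simp
  \<comment> \<open>For a symmetric polynomial, reversal permutes the words that occur and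
    conjugates their coefficients.\<close>
  have bij: "bij_betw rev (Poly_Mapping.keys p) (Poly_Mapping.keys p)"
    by (rule bij_betw_byWitness[where f' = rev]) (auto simp: lk in_keys_iff)
  have "mat_adjoint (mat_eval n X p) $$ (i, j) = cnj (mat_eval n X p $$ (j, i))" using ij by simp
  also have "\<dots> = (\<Sum>w\<in>Poly_Mapping.keys p. cnj (Poly_Mapping.lookup p w) * cnj (mat_word n X w $$ (j, i)))"
    using ij by (simp add: mat_eval_entry[OF Xm p])
  also have "\<dots> = (\<Sum>w\<in>Poly_Mapping.keys p. Poly_Mapping.lookup p (rev w) * mat_word n X (rev w) $$ (i, j))"
  proof (rule sum.cong)
    fix w assume "w \<in> Poly_Mapping.keys p"
    note w = nc_poly_in_keys[OF p this]
    have "mat_word n X (rev w) $$ (i, j) = cnj (mat_word n X w $$ (j, i))"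
      using mat_word_carrier[OF Xm w] ij by (simp flip: mat_word_adjoint[OF X w])
    then show "cnj (Poly_Mapping.lookup p w) * cnj (mat_word n X w $$ (j, i)) =
        Poly_Mapping.lookup p (rev w) * mat_word n X (rev w) $$ (i, j)" by (simp add: lk)
  qed simp
  also have "\<dots> = (\<Sum>w\<in>Poly_Mapping.keys p. Poly_Mapping.lookup p w * mat_word n X w $$ (i, j))"
    by (rule sum.reindex_bij_betw[OF bij])
  also have "\<dots> = mat_eval n X p $$ (i, j)" using ij by (simp add: mat_eval_entry[OF Xm p])
  finally show "mat_adjoint (mat_eval n X p) $$ (i, j) = mat_eval n X p $$ (i, j)" .
qed auto

section \<open>Direct sums of matrix tuples\<close>

lemma tuple_dsum_nth:
  assumes "X \<in> mtuples g n" "Y \<in> mtuples g m" "j < g"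
  shows "tuple_dsum n m X Y ! j = four_block_mat (X ! j) (0\<^sub>m n m) (0\<^sub>m m n) (Y ! j)"
  using assms by (auto simp: tuple_dsum_def mtuples_def)

lemma tuple_dsum_mtuples:
  assumes "X \<in> mtuples g n" "Y \<in> mtuples g m"
  shows "tuple_dsum n m X Y \<in> mtuples g (n + m)"
proof -
  have len: "length (tuple_dsum n m X Y) = g" using assms by (simp add: tuple_dsum_def mtuples_def)
  moreover have "tuple_dsum n m X Y ! j \<in> carrier_mat (n + m) (n + m)" if "j < g" for j
    using tuple_dsum_nth[OF assms that] mtuples_nth[OF assms(1) that] mtuples_nth[OF assms(2) that] by auto
  ultimately show ?thesis by (auto simp: mtuples_def set_conv_nth)
qed

lemma mat_word_dsum:
  assumes X: "X \<in> mtuples g n" and Y: "Y \<in> mtuples g m" and "set w \<subseteq> {..<g}"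
  shows "mat_word (n + m) (tuple_dsum n m X Y) w =
    four_block_mat (mat_word n X w) (0\<^sub>m n m) (0\<^sub>m m n) (mat_word m Y w)"
  using assms(3)
proof (induction w)
  case Nil
  show ?case by (intro eq_matI) auto
next
  case (Cons j w)
  then have jw: "j < g" "set w \<subseteq> {..<g}" by auto
  show ?case
    unfolding mat_word_Cons Cons.IH[OF jw(2)] tuple_dsum_nth[OF X Y jw(1)]
    using mtuples_nth[OF X jw(1)] mtuples_nth[OF Y jw(1)] mat_word_carrier[OF X jw(2)] mat_word_carrier[OF Y jw(2)]
    by (subst mult_four_block_mat[of _ n n _ m _ m _ _ n _ m]) (auto simp: right_add_zero_mat left_add_zero_mat)
qed

lemma mat_eval_dsum:
  assumes X: "X \<in> mtuples g n" and Y: "Y \<in> mtuples g m" and p: "nc_poly_in g p"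
  shows "mat_eval (n + m) (tuple_dsum n m X Y) p =
    four_block_mat (mat_eval n X p) (0\<^sub>m n m) (0\<^sub>m m n) (mat_eval m Y p)"
proof (rule eq_matI)
  fix i j
  assume "i < dim_row (four_block_mat (mat_eval n X p) (0\<^sub>m n m) (0\<^sub>m m n) (mat_eval m Y p))"
    "j < dim_col (four_block_mat (mat_eval n X p) (0\<^sub>m n m) (0\<^sub>m m n) (mat_eval m Y p))"
  then have ij: "i < n + m" "j < n + m" by auto
  have word: "mat_word (n + m) (tuple_dsum n m X Y) w $$ (i, j) =
      (if i < n then if j < n then mat_word n X w $$ (i, j) else 0
       else if j < n then 0 else mat_word m Y w $$ (i - n, j - n))"
    if "w \<in> Poly_Mapping.keys p" for w
    unfolding mat_word_dsum[OF X Y nc_poly_in_keys[OF p that]]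
    using mat_word_carrier[OF X nc_poly_in_keys[OF p that]] mat_word_carrier[OF Y nc_poly_in_keys[OF p that]] ij
    by (subst index_mat_four_block) auto
  show "mat_eval (n + m) (tuple_dsum n m X Y) p $$ (i, j) =
      four_block_mat (mat_eval n X p) (0\<^sub>m n m) (0\<^sub>m m n) (mat_eval m Y p) $$ (i, j)"
    using ij by (simp add: mat_eval_entry[OF tuple_dsum_mtuples[OF X Y] p] word
        mat_eval_entry[OF X p] mat_eval_entry[OF Y p])
qed auto

text \<open>Vectors are functions here, as the elements of \<open>ell2\<close> are; the entries
  below \<open>n\<close> are the ones read.\<close>

definition mact :: "nat \<Rightarrow> complex mat \<Rightarrow> (nat \<Rightarrow> complex) \<Rightarrow> nat \<Rightarrow> complex" where
  "mact n M v i = (\<Sum>k<n. M $$ (i, k) * v k)"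

text \<open>In \<open>sqbound n M C\<close> the number \<open>C\<close> bounds the square of the norm of \<open>M\<close>.\<close>

definition sqbound :: "nat \<Rightarrow> complex mat \<Rightarrow> real \<Rightarrow> bool" where
  "sqbound n M C \<longleftrightarrow> (\<forall>v. (\<Sum>i<n. (cmod (mact n M v i))\<^sup>2) \<le> C * (\<Sum>i<n. (cmod (v i))\<^sup>2))"

lemma mact_mult:
  assumes "A \<in> carrier_mat n n" "B \<in> carrier_mat n n" "i < n"
  shows "mact n (A * B) v i = mact n A (mact n B v) i"
proof -
  have "mact n (A * B) v i = (\<Sum>k<n. \<Sum>l<n. A $$ (i, l) * B $$ (l, k) * v k)"
    unfolding mact_def using mult_entry[OF assms(1,2,3)] by (simp add: sum_distrib_right)
  also have "\<dots> = (\<Sum>l<n. \<Sum>k<n. A $$ (i, l) * B $$ (l, k) * v k)" by (rule sum.swap)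
  finally show ?thesis by (simp add: mact_def sum_distrib_left mult.assoc)
qed

lemma mact_one: "i < n \<Longrightarrow> mact n (1\<^sub>m n) v i = v i"
  by (simp add: mact_def if_distrib[of "\<lambda>x. x * _"] cong: if_cong)

lemma sqbound_mult:
  assumes "A \<in> carrier_mat n n" "B \<in> carrier_mat n n" "sqbound n A C" "sqbound n B D" "0 \<le> C"
  shows "sqbound n (A * B) (C * D)"
  unfolding sqbound_def
proof
  fix v :: "nat \<Rightarrow> complex"
  have "(\<Sum>i<n. (cmod (mact n (A * B) v i))\<^sup>2) = (\<Sum>i<n. (cmod (mact n A (mact n B v) i))\<^sup>2)"
    using mact_mult[OF assms(1,2)] by simp
  also have "\<dots> \<le> C * (\<Sum>i<n. (cmod (mact n B v i))\<^sup>2)" using assms(3) by (simp add: sqbound_def)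
  also have "\<dots> \<le> C * (D * (\<Sum>i<n. (cmod (v i))\<^sup>2))"
    using assms(4,5) by (intro mult_left_mono) (auto simp: sqbound_def)
  finally show "(\<Sum>i<n. (cmod (mact n (A * B) v i))\<^sup>2) \<le> C * D * (\<Sum>i<n. (cmod (v i))\<^sup>2)"
    by (simp add: mult.assoc)
qed

lemma cmod_sum_square_le:
  assumes "finite I"
  shows "(cmod (\<Sum>i\<in>I. f i))\<^sup>2 \<le> real (card I) * (\<Sum>i\<in>I. (cmod (f i))\<^sup>2)"
proof -
  have "(cmod (\<Sum>i\<in>I. f i))\<^sup>2 \<le> (\<Sum>i\<in>I. cmod (f i))\<^sup>2"
    by (intro power_mono norm_sum) auto
  also have "\<dots> \<le> real (card I) * (\<Sum>i\<in>I. (cmod (f i))\<^sup>2)"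
    using sum_squared_le_sum_of_squares[of "\<lambda>i. cmod (f i)" I] by (simp add: mult.commute)
  finally show ?thesis .
qed

text \<open>The block families in \<open>dsum_op\<close> depend on the tuple alone, so a block that
  mentions its level has to recover it from the tuple.\<close>

definition dimt :: "mtuple \<Rightarrow> nat" where
  "dimt X = dim_row (X ! 0)"

lemma dimt: "X \<in> mtuples g n \<Longrightarrow> 1 \<le> g \<Longrightarrow> dimt X = n"
  using mtuples_nth[of X g n 0] by (auto simp: dimt_def)

lemma graded_tuples: "graded g K \<Longrightarrow> X \<in> K n \<Longrightarrow> X \<in> sa_tuples g n"
  "graded g K \<Longrightarrow> X \<in> K n \<Longrightarrow> 0 < n"
  by (auto simp: graded_def intro: gr0I)

text \<open>Self-adjointness turns the form of the square of \<open>X ! l\<close> at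
  \<open>v\<close> into the squared norm of \<open>X ! l\<close> applied to \<open>v\<close>; each
  of these is at most their sum over \<open>l\<close>, which the hypothesis bounds. One constant
  serves all levels, and this makes the direct sum over \<open>K\<close> bounded.\<close>

lemma gbounded_sqbound:
  assumes "gbounded g K" "graded g K"
  obtains C where "0 \<le> C" "\<And>n X j. X \<in> K n \<Longrightarrow> j < g \<Longrightarrow> sqbound n (X ! j) C"
proof -
  from assms(1) obtain R :: real where R: "\<And>n X. X \<in> K n \<Longrightarrow>
     psd n (complex_of_real (R\<^sup>2) \<cdot>\<^sub>m 1\<^sub>m n - mat_sum n {..<g} (\<lambda>j. X ! j * X ! j))"
    by (auto simp: gbounded_def)
  have "sqbound n (X ! j) (R\<^sup>2)" if X: "X \<in> K n" and j: "j < g" for n X j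
    unfolding sqbound_def
  proof
    fix v :: "nat \<Rightarrow> complex"
    note Xs = graded_tuples(1)[OF assms(2) X]
    note Xm = sa_tuples_mtuples[OF Xs]
    let ?M = "complex_of_real (R\<^sup>2) \<cdot>\<^sub>m 1\<^sub>m n - mat_sum n {..<g} (\<lambda>j. X ! j * X ! j)"
    let ?v = "vec n v"
    have sq: "(\<Sum>i<n. mact n (X ! l * X ! l) v i * cnj (v i)) = of_real (\<Sum>i<n. (cmod (mact n (X ! l) v i))\<^sup>2)"
      if l: "l < g" for l
    proof -
      note c = mtuples_nth[OF Xm l]
      have adj: "(X ! l) $$ (i, k) = cnj ((X ! l) $$ (k, i))" if "i < n" "k < n" for i k
      proof -
        have "mat_adjoint (X ! l) = X ! l" using Xs l by (auto simp: sa_tuples_def)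
        then have "(X ! l) $$ (i, k) = mat_adjoint (X ! l) $$ (i, k)" by simp
        then show ?thesis using c that by simp
      qed
      have "(\<Sum>i<n. mact n (X ! l * X ! l) v i * cnj (v i)) =
          (\<Sum>i<n. \<Sum>k<n. (X ! l) $$ (i, k) * mact n (X ! l) v k * cnj (v i))"
        using mact_mult[OF c c] by (simp add: mact_def sum_distrib_right)
      also have "\<dots> = (\<Sum>k<n. \<Sum>i<n. (X ! l) $$ (i, k) * mact n (X ! l) v k * cnj (v i))" by (rule sum.swap)
      also have "\<dots> = (\<Sum>k<n. mact n (X ! l) v k * cnj (mact n (X ! l) v k))"
      proof (intro sum.cong refl)
        fix k assume k: "k \<in> {..<n}"
        have "cnj (mact n (X ! l) v k) = (\<Sum>i<n. (X ! l) $$ (i, k) * cnj (v i))"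
          unfolding mact_def cnj_sum complex_cnj_mult by (intro sum.cong refl) (metis adj k lessThan_iff)
        then show "(\<Sum>i<n. (X ! l) $$ (i, k) * mact n (X ! l) v k * cnj (v i)) =
            mact n (X ! l) v k * cnj (mact n (X ! l) v k)"
          by (simp add: sum_distrib_left mult_ac)
      qed
      also have "\<dots> = of_real (\<Sum>i<n. (cmod (mact n (X ! l) v i))\<^sup>2)"
        unfolding of_real_sum complex_norm_square ..
      finally show ?thesis .
    qed
    have ent: "?M $$ (i, k) = of_real (R\<^sup>2) * (1\<^sub>m n) $$ (i, k) - (\<Sum>l<g. (X ! l * X ! l) $$ (i, k))"
      if "i < n" "k < n" for i k using that by simp
    have "(?M *\<^sub>v ?v) \<bullet>c ?v = (\<Sum>i<n. mact n ?M v i * cnj (v i))"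
      by (simp add: scalar_prod_def mact_def lessThan_atLeast0)
    also have "\<dots> = (\<Sum>i<n. (of_real (R\<^sup>2) * mact n (1\<^sub>m n) v i - (\<Sum>l<g. mact n (X ! l * X ! l) v i)) * cnj (v i))"
    proof (intro sum.cong refl arg_cong2[where f = "(*)"])
      fix i assume "i \<in> {..<n}"
      then have "mact n ?M v i = (\<Sum>k<n. of_real (R\<^sup>2) * ((1\<^sub>m n) $$ (i, k) * v k) - (\<Sum>l<g. (X ! l * X ! l) $$ (i, k) * v k))"
        unfolding mact_def using ent by (intro sum.cong refl) (simp add: algebra_simps sum_distrib_left)
      also have "\<dots> = of_real (R\<^sup>2) * mact n (1\<^sub>m n) v i - (\<Sum>k<n. \<Sum>l<g. (X ! l * X ! l) $$ (i, k) * v k)"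
        by (simp add: sum_subtractf mact_def sum_distrib_left)
      also have "(\<Sum>k<n. \<Sum>l<g. (X ! l * X ! l) $$ (i, k) * v k) = (\<Sum>l<g. mact n (X ! l * X ! l) v i)"
        unfolding mact_def by (rule sum.swap)
      finally show "mact n ?M v i = of_real (R\<^sup>2) * mact n (1\<^sub>m n) v i - (\<Sum>l<g. mact n (X ! l * X ! l) v i)" .
    qed
    also have "\<dots> = of_real (R\<^sup>2) * (\<Sum>i<n. v i * cnj (v i)) - (\<Sum>l<g. \<Sum>i<n. mact n (X ! l * X ! l) v i * cnj (v i))"
    proof -
      have "(\<Sum>i<n. (\<Sum>l<g. mact n (X ! l * X ! l) v i) * cnj (v i)) =
          (\<Sum>l<g. \<Sum>i<n. mact n (X ! l * X ! l) v i * cnj (v i))"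
        unfolding sum_distrib_right by (rule sum.swap)
      then show ?thesis
        by (simp add: mact_one left_diff_distrib sum_subtractf sum_distrib_left mult.assoc)
    qed
    also have "\<dots> = of_real (R\<^sup>2 * (\<Sum>i<n. (cmod (v i))\<^sup>2) - (\<Sum>l<g. \<Sum>i<n. (cmod (mact n (X ! l) v i))\<^sup>2))"
      using sq by (simp add: complex_norm_square[symmetric])
    finally have "(?M *\<^sub>v ?v) \<bullet>c ?v =
      of_real (R\<^sup>2 * (\<Sum>i<n. (cmod (v i))\<^sup>2) - (\<Sum>l<g. \<Sum>i<n. (cmod (mact n (X ! l) v i))\<^sup>2))" .
    moreover have "0 \<le> (?M *\<^sub>v ?v) \<bullet>c ?v" using R[OF X] by (auto simp: psd_def)
    ultimately have "(\<Sum>l<g. \<Sum>i<n. (cmod (mact n (X ! l) v i))\<^sup>2) \<le> R\<^sup>2 * (\<Sum>i<n. (cmod (v i))\<^sup>2)"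
      by (simp add: less_eq_complex_def)
    moreover have "(\<Sum>i<n. (cmod (mact n (X ! j) v i))\<^sup>2) \<le> (\<Sum>l<g. \<Sum>i<n. (cmod (mact n (X ! l) v i))\<^sup>2)"
      using j by (intro member_le_sum) (auto intro: sum_nonneg)
    ultimately show "(\<Sum>i<n. (cmod (mact n (X ! j) v i))\<^sup>2) \<le> R\<^sup>2 * (\<Sum>i<n. (cmod (v i))\<^sup>2)" by linarith
  qed
  then show thesis by (intro that[of "R\<^sup>2"]) auto
qed


section \<open>Operators on \<open>\<ell>\<^sup>2\<close>\<close>

definition sqn :: "('i \<Rightarrow> complex) \<Rightarrow> real" where
  "sqn f = (\<Sum>\<^sub>\<infinity>i. (cmod (f i))\<^sup>2)"

lemma ell2_off: "f \<in> ell2 S \<Longrightarrow> i \<notin> S \<Longrightarrow> f i = 0"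
  by (simp add: ell2_def)

lemma ell2_summable: "f \<in> ell2 S \<Longrightarrow> (\<lambda>i. (cmod (f i))\<^sup>2) summable_on UNIV"
  by (simp add: ell2_def)

lemma cmod_add_square_le: "(cmod (x + y))\<^sup>2 \<le> 2 * (cmod x)\<^sup>2 + 2 * (cmod y)\<^sup>2"
proof -
  have "(cmod (x + y))\<^sup>2 + (cmod (x - y))\<^sup>2 = 2 * (cmod x)\<^sup>2 + 2 * (cmod y)\<^sup>2"
    unfolding cmod_power2 by (simp add: algebra_simps power2_eq_square)
  then show ?thesis by (smt (verit) zero_le_power2)
qed

lemma sqn_nonneg [simp]: "0 \<le> sqn f"
  by (simp add: sqn_def infsum_nonneg)

text \<open>The factor 2 is that of \<open>cmod_add_square_le\<close>; it is enough for membership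
  and boundedness, which avoids the triangle inequality for the norm.\<close>

lemma ell2_lin_sqn:
  assumes "f \<in> ell2 S" "h \<in> ell2 S"
  shows "(\<lambda>i. a * f i + b * h i) \<in> ell2 S"
    and "sqn (\<lambda>i. a * f i + b * h i) \<le> 2 * (cmod a)\<^sup>2 * sqn f + 2 * (cmod b)\<^sup>2 * sqn h"
proof -
  let ?g = "\<lambda>i. 2 * (cmod a)\<^sup>2 * (cmod (f i))\<^sup>2 + 2 * (cmod b)\<^sup>2 * (cmod (h i))\<^sup>2"
  have g1: "(\<lambda>i. 2 * (cmod a)\<^sup>2 * (cmod (f i))\<^sup>2) summable_on UNIV"
    and g2: "(\<lambda>i. 2 * (cmod b)\<^sup>2 * (cmod (h i))\<^sup>2) summable_on UNIV"
    using assms by (auto intro!: summable_on_cmult_right ell2_summable)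
  have g: "?g summable_on UNIV" by (rule summable_on_add[OF g1 g2])
  have le: "(cmod (a * f i + b * h i))\<^sup>2 \<le> ?g i" for i
    using cmod_add_square_le[of "a * f i" "b * h i"] by (simp add: norm_mult power_mult_distrib)
  have s: "(\<lambda>i. (cmod (a * f i + b * h i))\<^sup>2) summable_on UNIV"
    by (rule summable_on_comparison_test[OF g]) (use le in auto)
  then show "(\<lambda>i. a * f i + b * h i) \<in> ell2 S"
    using assms by (simp add: ell2_def)
  have "sqn (\<lambda>i. a * f i + b * h i) \<le> infsum ?g UNIV"
    unfolding sqn_def by (rule infsum_mono[OF s g]) (rule le)
  also have "\<dots> = 2 * (cmod a)\<^sup>2 * sqn f + 2 * (cmod b)\<^sup>2 * sqn h"
    unfolding infsum_add[OF g1 g2] sqn_def by (simp only: infsum_cmult_right')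
  finally show "sqn (\<lambda>i. a * f i + b * h i) \<le> 2 * (cmod a)\<^sup>2 * sqn f + 2 * (cmod b)\<^sup>2 * sqn h" .
qed

lemmas ell2_lin = ell2_lin_sqn(1)

lemma ell2_zero [simp]: "(\<lambda>_. 0) \<in> ell2 S"
  by (simp add: ell2_def)

lemma ell2_prod_summable:
  assumes "f \<in> ell2 S" "h \<in> ell2 S"
  shows "(\<lambda>i. f i * cnj (h i)) summable_on UNIV"
proof (rule abs_summable_summable, rule summable_on_comparison_test)
  show "(\<lambda>i. (cmod (f i))\<^sup>2 + (cmod (h i))\<^sup>2) summable_on UNIV"
    using assms by (intro summable_on_add ell2_summable)
  show "norm (f i * cnj (h i)) \<le> (cmod (f i))\<^sup>2 + (cmod (h i))\<^sup>2" for i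
  proof -
    have "0 \<le> (cmod (f i) - cmod (h i))\<^sup>2" by simp
    then have "2 * (cmod (f i) * cmod (h i)) \<le> (cmod (f i))\<^sup>2 + (cmod (h i))\<^sup>2"
      by (simp add: power2_diff)
    moreover have "0 \<le> cmod (f i) * cmod (h i)" by simp
    ultimately show ?thesis unfolding norm_mult complex_mod_cnj by linarith
  qed
qed simp

lemma l2_inner_self:
  assumes "f \<in> ell2 S"
  shows "l2_inner f f = of_real (sqn f)"
proof -
  have "((\<lambda>i. complex_of_real ((cmod (f i))\<^sup>2)) has_sum of_real (sqn f)) UNIV"
    unfolding sqn_def by (intro has_sum_of_real has_sum_infsum ell2_summable[OF assms])
  then show ?thesis unfolding l2_inner_def by (simp only: complex_norm_square infsumI)
qed

lemma sqn_zero_iff: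
  assumes "f \<in> ell2 S"
  shows "sqn f = 0 \<longleftrightarrow> f = (\<lambda>_. 0)"
proof
  assume 0: "sqn f = 0"
  show "f = (\<lambda>_. 0)"
  proof
    fix i
    have "(cmod (f i))\<^sup>2 = 0"
      by (rule nonneg_infsum_le_0D[of "\<lambda>i. (cmod (f i))\<^sup>2" UNIV])
        (use 0 ell2_summable[OF assms] in \<open>auto simp: sqn_def\<close>)
    then show "f i = 0" by simp
  qed
qed (simp add: sqn_def)

section \<open>The algebra of bounded operators\<close>

lemma bounded_opI:
  assumes "\<And>f. f \<in> ell2 S \<Longrightarrow> T f \<in> ell2 S" "\<And>f. f \<notin> ell2 S \<Longrightarrow> T f = (\<lambda>_. 0)"
    and "\<And>f h a b. f \<in> ell2 S \<Longrightarrow> h \<in> ell2 S \<Longrightarrow>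
      T (\<lambda>i. a * f i + b * h i) = (\<lambda>i. a * T f i + b * T h i)"
    and "\<And>f. f \<in> ell2 S \<Longrightarrow> sqn (T f) \<le> C * sqn f"
  shows "bounded_op S T"
proof -
  \<comment> \<open>\<open>C\<close> carries no sign, so it is cut off at 0 before the root is
    taken.\<close>
  have "l2_norm (T f) \<le> sqrt (max C 0) * l2_norm f" if "f \<in> ell2 S" for f
  proof -
    have "sqn (T f) \<le> max C 0 * sqn f"
      using assms(4)[OF that] mult_right_mono[of C "max C 0" "sqn f"] by simp
    then show ?thesis by (simp add: l2_norm_def sqn_def flip: real_sqrt_mult)
  qed
  then show ?thesis using assms(1-3) unfolding bounded_op_def by blast
qed

lemma bounded_opD:
  assumes "bounded_op S T"
  shows "\<And>f. f \<in> ell2 S \<Longrightarrow> T f \<in> ell2 S" "\<And>f. f \<notin> ell2 S \<Longrightarrow> T f = (\<lambda>_. 0)"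
    and "\<And>f h a b. f \<in> ell2 S \<Longrightarrow> h \<in> ell2 S \<Longrightarrow>
      T (\<lambda>i. a * f i + b * h i) = (\<lambda>i. a * T f i + b * T h i)"
    and "\<exists>C\<ge>0. \<forall>f\<in>ell2 S. sqn (T f) \<le> C * sqn f"
proof -
  from assms obtain M where M: "\<forall>f\<in>ell2 S. l2_norm (T f) \<le> M * l2_norm f"
    by (auto simp: bounded_op_def)
  have "sqn (T f) \<le> M\<^sup>2 * sqn f" if "f \<in> ell2 S" for f
  proof -
    have "(sqrt (sqn (T f)))\<^sup>2 \<le> (M * sqrt (sqn f))\<^sup>2"
      using M that by (intro power_mono) (auto simp: l2_norm_def sqn_def infsum_nonneg)
    then show ?thesis by (simp add: power_mult_distrib)
  qed
  then show "\<exists>C\<ge>0. \<forall>f\<in>ell2 S. sqn (T f) \<le> C * sqn f"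
    by (intro exI[of _ "M\<^sup>2"]) auto
qed (use assms in \<open>auto simp: bounded_op_def\<close>)

text \<open>An inner operator returns 0 off \<open>ell2 S\<close>; an outer operator keeps that
  value, so composites obey the same convention.\<close>

lemma bounded_op_zero_arg: "bounded_op S T \<Longrightarrow> T (\<lambda>_. 0) = (\<lambda>_. 0)"
  using bounded_opD(3)[of S T "\<lambda>_. 0" "\<lambda>_. 0" 0 0] by simp

lemma bounded_op_id [simp]: "bounded_op S (id_op S)"
  by (rule bounded_opI[where C = 1]) (auto simp: id_op_def ell2_lin)

lemma bounded_op_zero [simp]: "bounded_op S (\<lambda>_ _. 0)"
  by (rule bounded_opI[where C = 0]) (auto simp: sqn_def)

lemma bounded_op_comp:
  assumes "bounded_op S P" "bounded_op S Q"
  shows "bounded_op S (P \<circ> Q)"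
proof -
  note P = bounded_opD[OF assms(1)] and Q = bounded_opD[OF assms(2)]
  obtain C D where C: "0 \<le> C" "\<forall>f\<in>ell2 S. sqn (P f) \<le> C * sqn f"
    and D: "\<forall>f\<in>ell2 S. sqn (Q f) \<le> D * sqn f" using P(4) Q(4) by blast
  show ?thesis
  proof (rule bounded_opI[where C = "C * D"])
    fix f assume f: "f \<in> ell2 S"
    have "sqn (P (Q f)) \<le> C * sqn (Q f)" using C Q(1)[OF f] by blast
    also have "\<dots> \<le> C * (D * sqn f)" using C D f by (intro mult_left_mono) auto
    finally show "sqn ((P \<circ> Q) f) \<le> C * D * sqn f" by simp
  qed (use P Q bounded_op_zero_arg[OF assms(1)] in auto)
qed

lemma bounded_op_lin:
  assumes "bounded_op S P" "bounded_op S Q"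
  shows "bounded_op S (\<lambda>f i. c * P f i + d * Q f i)"
proof -
  note P = bounded_opD[OF assms(1)] and Q = bounded_opD[OF assms(2)]
  obtain C D where C: "\<forall>f\<in>ell2 S. sqn (P f) \<le> C * sqn f"
    and D: "\<forall>f\<in>ell2 S. sqn (Q f) \<le> D * sqn f" using P(4) Q(4) by blast
  show ?thesis
  proof (rule bounded_opI[where C = "2 * (cmod c)\<^sup>2 * C + 2 * (cmod d)\<^sup>2 * D"])
    fix f assume f: "f \<in> ell2 S"
    have "sqn (\<lambda>i. c * P f i + d * Q f i) \<le> 2 * (cmod c)\<^sup>2 * sqn (P f) + 2 * (cmod d)\<^sup>2 * sqn (Q f)"
      by (rule ell2_lin_sqn(2)[OF P(1)[OF f] Q(1)[OF f]])
    also have "\<dots> \<le> 2 * (cmod c)\<^sup>2 * (C * sqn f) + 2 * (cmod d)\<^sup>2 * (D * sqn f)"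
      using C D f by (intro add_mono mult_left_mono) auto
    finally show "sqn (\<lambda>i. c * P f i + d * Q f i) \<le> (2 * (cmod c)\<^sup>2 * C + 2 * (cmod d)\<^sup>2 * D) * sqn f"
      by (simp add: algebra_simps)
  qed (use P Q in \<open>auto intro: ell2_lin simp: algebra_simps\<close>)
qed

lemma bounded_op_sum:
  assumes "finite F" "\<And>w. w \<in> F \<Longrightarrow> bounded_op S (T w)"
  shows "bounded_op S (\<lambda>f i. \<Sum>w\<in>F. c w * T w f i)"
  using assms
proof (induction F rule: finite_induct)
  case (insert w F)
  have "bounded_op S (\<lambda>f i. c w * T w f i + 1 * (\<Sum>w\<in>F. c w * T w f i))"
    by (rule bounded_op_lin) (use insert in auto)
  then show ?case using insert by simp
qed simp

lemma op_word_Nil [simp]: "op_word S A [] = id_op S"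
  by (simp add: op_word_def)

lemma op_word_Cons: "op_word S A (j # w) = A ! j \<circ> op_word S A w"
  by (simp add: op_word_def)

lemma op_word_bounded:
  assumes "\<And>j. j < g \<Longrightarrow> bounded_op S (A ! j)" "set w \<subseteq> {..<g}"
  shows "bounded_op S (op_word S A w)"
  using assms(2) by (induction w) (auto simp: op_word_Cons intro!: bounded_op_comp assms(1))

lemma op_eval_bounded:
  assumes "\<And>j. j < g \<Longrightarrow> bounded_op S (A ! j)" "nc_poly_in g p"
  shows "bounded_op S (op_eval S A p)"
  unfolding op_eval_def
  using nc_poly_in_keys[OF assms(2)] by (intro bounded_op_sum op_word_bounded[OF assms(1)]) auto

lemma op_eval_var:
  assumes "bounded_op S (A ! j)"
  shows "op_eval S A (nc_var j) = A ! j"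
proof
  fix f
  show "op_eval S A (nc_var j) f = (A ! j) f"
    using bounded_op_zero_arg[OF assms] bounded_opD(2)[OF assms, of f]
    by (cases "f \<in> ell2 S") (auto simp: op_eval_def op_word_Cons id_op_def)
qed

section \<open>Matrices as operators on finite-dimensional space\<close>

lemma ell2_fin: "f \<in> ell2 {..<n} \<longleftrightarrow> (\<forall>i. n \<le> i \<longrightarrow> f i = 0)" for f :: "nat \<Rightarrow> complex"
proof -
  have "(\<lambda>i. (cmod (f i))\<^sup>2) summable_on UNIV" if "\<forall>i. n \<le> i \<longrightarrow> f i = 0"
  proof -
    have "(\<lambda>i. (cmod (f i))\<^sup>2) summable_on {..<n}" by simp
    moreover have "(\<lambda>i. (cmod (f i))\<^sup>2) summable_on {..<n} \<longleftrightarrow> (\<lambda>i. (cmod (f i))\<^sup>2) summable_on UNIV"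
      by (rule summable_on_cong_neutral) (use that in auto)
    ultimately show ?thesis by simp
  qed
  then show ?thesis by (auto simp: ell2_def)
qed

lemma sqn_fin: "f \<in> ell2 {..<n} \<Longrightarrow> sqn f = (\<Sum>i<n. (cmod (f i))\<^sup>2)" for f :: "nat \<Rightarrow> complex"
  unfolding sqn_def
  by (subst infsum_cong_neutral[where T = "{..<n}" and g = "\<lambda>i. (cmod (f i))\<^sup>2"]) (auto simp: ell2_fin)

lemma l2_inner_fin: "f \<in> ell2 {..<n} \<Longrightarrow> l2_inner f h = (\<Sum>i<n. f i * cnj (h i))" for f :: "nat \<Rightarrow> complex"
  unfolding l2_inner_def
  by (subst infsum_cong_neutral[where T = "{..<n}" and g = "\<lambda>i. f i * cnj (h i)"]) (auto simp: ell2_fin)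

definition op_of_mat :: "nat \<Rightarrow> complex mat \<Rightarrow> nat op" where
  "op_of_mat n M f = (if f \<in> ell2 {..<n} then (\<lambda>i. if i < n then mact n M f i else 0) else (\<lambda>_. 0))"

lemma mact_lin: "mact n M (\<lambda>i. a * f i + b * h i) i = a * mact n M f i + b * mact n M h i"
  by (simp add: mact_def algebra_simps sum.distrib sum_distrib_left)

lemma mact_cong: "(\<And>k. k < n \<Longrightarrow> f k = h k) \<Longrightarrow> mact n M f i = mact n M h i"
  by (simp add: mact_def)

lemma sqbound_exists: "\<exists>C\<ge>0. sqbound n M C"
proof -
  define C where "C = real n * (\<Sum>i<n. \<Sum>k<n. (cmod (M $$ (i, k)))\<^sup>2)"
  have "(\<Sum>i<n. (cmod (mact n M v i))\<^sup>2) \<le> C * (\<Sum>i<n. (cmod (v i))\<^sup>2)" for v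
  proof -
    have "(cmod (mact n M v i))\<^sup>2 \<le> real n * (\<Sum>k<n. (cmod (M $$ (i, k)))\<^sup>2) * (\<Sum>i<n. (cmod (v i))\<^sup>2)" for i
    proof -
      have "(cmod (mact n M v i))\<^sup>2 \<le> real n * (\<Sum>k<n. (cmod (M $$ (i, k) * v k))\<^sup>2)"
        unfolding mact_def using cmod_sum_square_le[of "{..<n}" "\<lambda>k. M $$ (i, k) * v k"] by simp
      also have "\<dots> \<le> real n * (\<Sum>k<n. (cmod (M $$ (i, k)))\<^sup>2 * (\<Sum>i<n. (cmod (v i))\<^sup>2))"
        by (intro mult_left_mono sum_mono) (auto simp: norm_mult power_mult_distrib intro!: mult_left_mono member_le_sum)
      finally show ?thesis by (simp add: sum_distrib_right mult.assoc)
    qed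
    then have "(\<Sum>i<n. (cmod (mact n M v i))\<^sup>2) \<le>
        (\<Sum>i<n. real n * (\<Sum>k<n. (cmod (M $$ (i, k)))\<^sup>2) * (\<Sum>i<n. (cmod (v i))\<^sup>2))"
      by (intro sum_mono)
    then show ?thesis unfolding C_def by (simp only: sum_distrib_left[symmetric] sum_distrib_right[symmetric])
  qed
  moreover have "0 \<le> C" unfolding C_def by (intro mult_nonneg_nonneg sum_nonneg) auto
  ultimately show ?thesis unfolding sqbound_def by blast
qed

lemma op_of_mat_bounded [simp]: "bounded_op {..<n} (op_of_mat n M)"
proof -
  obtain C where C: "sqbound n M C" using sqbound_exists by blast
  show ?thesis
  proof (rule bounded_opI[where C = C])
    fix f :: "nat \<Rightarrow> complex" assume f: "f \<in> ell2 {..<n}"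
    show in_e: "op_of_mat n M f \<in> ell2 {..<n}" using f by (auto simp: op_of_mat_def ell2_fin)
    show "sqn (op_of_mat n M f) \<le> C * sqn f"
      unfolding sqn_fin[OF f] sqn_fin[OF in_e] using C f by (simp add: op_of_mat_def sqbound_def)
  qed (auto simp: op_of_mat_def mact_lin ell2_lin)
qed

lemma mat_of_op_carrier [simp]: "mat_of_op n T \<in> carrier_mat n n"
  by (simp add: mat_of_op_def)

lemma mat_of_op_of_mat:
  assumes "M \<in> carrier_mat n n"
  shows "mat_of_op n (op_of_mat n M) = M"
proof (rule eq_matI)
  fix i j assume "i < dim_row M" "j < dim_col M"
  then have ij: "i < n" "j < n" using assms by auto
  have "(\<lambda>l. if l = j then 1 else 0) \<in> ell2 {..<n}" using ij by (auto simp: ell2_fin)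
  then show "mat_of_op n (op_of_mat n M) $$ (i, j) = M $$ (i, j)"
    using ij by (simp add: mat_of_op_def op_of_mat_def mact_def if_distrib[of "\<lambda>x. _ * x"] cong: if_cong)
qed (use assms in \<open>auto simp: mat_of_op_def\<close>)

lemma op_of_mat_of_op:
  assumes T: "bounded_op {..<n} T"
  shows "op_of_mat n (mat_of_op n T) = T"
proof
  fix f
  note B = bounded_opD[OF T]
  show "op_of_mat n (mat_of_op n T) f = T f"
  proof (cases "f \<in> ell2 {..<n}")
    case f: True
    let ?e = "\<lambda>k l :: nat. if l = k then 1 else 0 :: complex"
    have e: "?e k \<in> ell2 {..<n}" if "k < n" for k using that by (auto simp: ell2_fin)
    \<comment> \<open>Linearity is given for two summands at a time, so \<open>f\<close> is built
      from its truncations by adding one unit vector per step.\<close>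
    have part: "T (\<lambda>l. if l < m then f l else 0) = (\<lambda>i. \<Sum>k<m. f k * T (?e k) i) \<and>
        (\<lambda>l. if l < m then f l else 0) \<in> ell2 {..<n}" if "m \<le> n" for m
      using that
    proof (induction m)
      case 0
      then show ?case using bounded_op_zero_arg[OF T] by simp
    next
      case (Suc m)
      have "(\<lambda>l. if l < Suc m then f l else 0) = (\<lambda>l. 1 * (if l < m then f l else 0) + f m * ?e m l)"
        by (auto simp: fun_eq_iff less_Suc_eq)
      then show ?case using Suc e[of m] B(3)[of "\<lambda>l. if l < m then f l else 0" "?e m" 1 "f m"]
        by (auto simp: ell2_fin)
    qed
    have "(\<lambda>l. if l < n then f l else 0) = f" using f by (auto simp: ell2_fin fun_eq_iff)
    then have Tf: "T f = (\<lambda>i. \<Sum>k<n. f k * T (?e k) i)" using part[of n] by simp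
    have "T f i = 0" if "\<not> i < n" for i using B(1)[OF f] that by (auto simp: ell2_fin)
    then show ?thesis using f by (auto simp: op_of_mat_def fun_eq_iff mact_def mat_of_op_def Tf mult.commute)
  next
    case False
    then show ?thesis using B(2) by (simp add: op_of_mat_def)
  qed
qed

lemma op_of_mat_mult:
  assumes "A \<in> carrier_mat n n" "B \<in> carrier_mat n n"
  shows "op_of_mat n A \<circ> op_of_mat n B = op_of_mat n (A * B)"
proof
  fix f
  have "op_of_mat n B f \<in> ell2 {..<n}" if "f \<in> ell2 {..<n}"
    using that by (auto simp: op_of_mat_def ell2_fin)
  then show "(op_of_mat n A \<circ> op_of_mat n B) f = op_of_mat n (A * B) f"
    using assms by (auto simp: op_of_mat_def fun_eq_iff mact_mult mact_def[of n _ "\<lambda>_. 0"] cong: mact_cong)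
qed

lemma op_of_mat_one: "op_of_mat n (1\<^sub>m n) = id_op {..<n}"
  by (auto simp: op_of_mat_def id_op_def fun_eq_iff mact_one ell2_fin)

lemma op_word_op_of_mat:
  assumes "X \<in> mtuples g n" "set w \<subseteq> {..<g}"
  shows "op_word {..<n} (map (op_of_mat n) X) w = op_of_mat n (mat_word n X w)"
  using assms(2)
proof (induction w)
  case (Cons j w)
  then have "j < g" "set w \<subseteq> {..<g}" by auto
  moreover from this have "j < length X" using assms(1) by (simp add: mtuples_def)
  ultimately show ?case
    using Cons.IH op_of_mat_mult[OF mtuples_nth[OF assms(1), of j] mat_word_carrier[OF assms(1), of w]]
    by (simp add: op_word_Cons mat_word_Cons)
qed (simp add: op_of_mat_one)

lemma op_eval_op_of_mat:
  assumes X: "X \<in> mtuples g n" and p: "nc_poly_in g p"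
  shows "op_eval {..<n} (map (op_of_mat n) X) p = op_of_mat n (mat_eval n X p)"
proof (rule ext)+
  fix f i
  have "op_eval {..<n} (map (op_of_mat n) X) p f i =
      (\<Sum>w\<in>Poly_Mapping.keys p. Poly_Mapping.lookup p w * op_of_mat n (mat_word n X w) f i)"
    unfolding op_eval_def using op_word_op_of_mat[OF X nc_poly_in_keys[OF p]] by simp
  also have "\<dots> = op_of_mat n (mat_eval n X p) f i"
  proof (cases "f \<in> ell2 {..<n} \<and> i < n")
    case True
    have "mact n (mat_eval n X p) f i =
        (\<Sum>k<n. \<Sum>w\<in>Poly_Mapping.keys p. Poly_Mapping.lookup p w * mat_word n X w $$ (i, k) * f k)"
      using True by (simp add: mact_def mat_eval_entry[OF X p] sum_distrib_right)
    also have "\<dots> = (\<Sum>w\<in>Poly_Mapping.keys p. Poly_Mapping.lookup p w * mact n (mat_word n X w) f i)"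
      by (subst sum.swap) (simp add: mact_def sum_distrib_left mult.assoc)
    finally show ?thesis using True by (simp add: op_of_mat_def)
  qed (auto simp: op_of_mat_def)
  finally show "op_eval {..<n} (map (op_of_mat n) X) p f i = op_of_mat n (mat_eval n X p) f i" .
qed


section \<open>Direct sums\<close>

lemma mem_dsum_index [simp]: "(n, X, i) \<in> dsum_index K \<longleftrightarrow> X \<in> K n \<and> i < n"
  by (simp add: dsum_index_def)

lemma dsum_index_image:
  "dsum_index K = (\<lambda>((n, X), i). (n, X, i)) ` Sigma {(n, X). X \<in> K n} (\<lambda>(n, X). {..<n})"
  by (force simp: dsum_index_def)

lemma dsum_index_inj: "inj_on (\<lambda>((n, X), i). (n, X, i)) A"
  by (auto simp: inj_on_def)

text \<open>The index set fibres over the pairs of a level and a point, with finite fibres; this is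
  Fubini along the fibres.\<close>

lemma dsum_has_sum_blocks:
  fixes h :: "dsix \<Rightarrow> 'b :: {topological_comm_monoid_add, t3_space}"
  assumes "(h has_sum s) UNIV" "\<And>x. x \<notin> dsum_index K \<Longrightarrow> h x = 0"
  shows "((\<lambda>(n, X). \<Sum>i<n. h (n, X, i)) has_sum s) {(n, X). X \<in> K n}"
proof -
  have "(h has_sum s) (dsum_index K)"
    using assms(1) by (rule has_sum_cong_neutral[THEN iffD1, rotated -1]) (use assms(2) in auto)
  then have "((h \<circ> (\<lambda>((n, X), i). (n, X, i))) has_sum s) (Sigma {(n, X). X \<in> K n} (\<lambda>(n, X). {..<n}))"
    unfolding dsum_index_image by (simp only: has_sum_reindex[OF dsum_index_inj])
  then show ?thesis
    by (rule has_sum_SigmaD) (auto intro!: has_sum_finiteI)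
qed

text \<open>Nonnegativity permits the passage back from the block sums to the whole sum.\<close>

lemma dsum_summable_blocks:
  fixes h :: "dsix \<Rightarrow> real"
  assumes "(\<lambda>(n, X). \<Sum>i<n. h (n, X, i)) summable_on {(n, X). X \<in> K n}"
    and "\<And>x. 0 \<le> h x" "\<And>x. x \<notin> dsum_index K \<Longrightarrow> h x = 0"
  shows "h summable_on UNIV"
proof -
  have "(h \<circ> (\<lambda>((n, X), i). (n, X, i))) summable_on (Sigma {(n, X). X \<in> K n} (\<lambda>(n, X). {..<n}))"
    by (rule summable_on_SigmaI[OF _ assms(1)]) (use assms(2) in \<open>auto intro!: has_sum_finiteI\<close>)
  then have "h summable_on (dsum_index K)"
    unfolding dsum_index_image by (simp only: summable_on_reindex[OF dsum_index_inj])
  then show ?thesis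
    by (rule summable_on_cong_neutral[THEN iffD1, rotated -1]) (use assms(3) in auto)
qed

lemma dsum_op_apply:
  "f \<in> ell2 (dsum_index K) \<Longrightarrow>
    dsum_op K F f (n, X, i) = (if X \<in> K n \<and> i < n then mact n (F X) (\<lambda>k. f (n, X, k)) i else 0)"
  by (simp add: dsum_op_def mact_def)

text \<open>The constant is uniform in level and point, so the blockwise estimates can be summed
  over infinitely many blocks.\<close>

lemma dsum_op_bounded:
  assumes C: "\<And>n X. X \<in> K n \<Longrightarrow> sqbound n (F X) C"
  shows "bounded_op (dsum_index K) (dsum_op K F)"
proof -
  have main: "dsum_op K F f \<in> ell2 (dsum_index K) \<and> sqn (dsum_op K F f) \<le> C * sqn f"
    if f: "f \<in> ell2 (dsum_index K)" for f
  proof -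
    let ?L = "{(n, X). X \<in> K n}"
    let ?G = "\<lambda>(n, X). \<Sum>i<n. (cmod (f (n, X, i)))\<^sup>2"
    let ?H = "\<lambda>(n, X). \<Sum>i<n. (cmod (dsum_op K F f (n, X, i)))\<^sup>2"
    have "((\<lambda>i. (cmod (f i))\<^sup>2) has_sum sqn f) UNIV"
      unfolding sqn_def by (rule has_sum_infsum[OF ell2_summable[OF f]])
    then have G: "(?G has_sum sqn f) ?L"
      by (rule dsum_has_sum_blocks[where h = "\<lambda>x. (cmod (f x))\<^sup>2"]) (use ell2_off[OF f] in auto)
    then have CG: "((\<lambda>x. C * ?G x) has_sum C * sqn f) ?L" by (rule has_sum_cmult_right)
    have le: "?H x \<le> C * ?G x" if "x \<in> ?L" for x
      using C that by (auto simp: dsum_op_apply[OF f] sqbound_def)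
    have off: "dsum_op K F f x = 0" if "x \<notin> dsum_index K" for x
      using that f by (cases x) (auto simp: dsum_op_def)
    have sH: "?H summable_on ?L"
      using has_sum_imp_summable[OF CG] le by (rule summable_on_comparison_test) (auto intro: sum_nonneg)
    have sm: "(\<lambda>i. (cmod (dsum_op K F f i))\<^sup>2) summable_on UNIV"
      by (rule dsum_summable_blocks[OF sH]) (use off in auto)
    have "((\<lambda>i. (cmod (dsum_op K F f i))\<^sup>2) has_sum sqn (dsum_op K F f)) UNIV"
      unfolding sqn_def by (rule has_sum_infsum[OF sm])
    then have "(?H has_sum sqn (dsum_op K F f)) ?L"
      by (rule dsum_has_sum_blocks[where h = "\<lambda>x. (cmod (dsum_op K F f x))\<^sup>2"]) (use off in auto)
    then have "sqn (dsum_op K F f) \<le> C * sqn f"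
      using CG le by (rule has_sum_mono)
    moreover have "dsum_op K F f \<in> ell2 (dsum_index K)" using sm off by (simp add: ell2_def)
    ultimately show ?thesis by blast
  qed
  show ?thesis
  proof (rule bounded_opI[where C = C])
    fix f h a b assume fh: "f \<in> ell2 (dsum_index K)" "h \<in> ell2 (dsum_index K)"
    show "dsum_op K F (\<lambda>i. a * f i + b * h i) = (\<lambda>i. a * dsum_op K F f i + b * dsum_op K F h i)"
      by (auto simp: fun_eq_iff dsum_op_apply[OF fh(1)] dsum_op_apply[OF fh(2)]
          dsum_op_apply[OF ell2_lin[OF fh]] mact_lin)
  qed (use main in \<open>auto simp: dsum_op_def\<close>)
qed

text \<open>The inclusion of the summand at \<open>X\<close>; applying a direct sum to such vectors
  isolates its block at \<open>X\<close>.\<close>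

definition emb :: "nat \<Rightarrow> mtuple \<Rightarrow> (nat \<Rightarrow> complex) \<Rightarrow> dsix \<Rightarrow> complex" where
  "emb n X v = (\<lambda>(m, Y, i). if m = n \<and> Y = X \<and> i < n then v i else 0)"

lemma emb_sum:
  fixes h :: "dsix \<Rightarrow> 'b :: {topological_comm_monoid_add, t2_space}"
  assumes "\<And>m Y i. \<not> (m = n \<and> Y = X \<and> i < n) \<Longrightarrow> h (m, Y, i) = 0"
  shows "(h has_sum (\<Sum>i<n. h (n, X, i))) UNIV"
proof -
  have "(h has_sum (\<Sum>x\<in>(\<lambda>i. (n, X, i)) ` {..<n}. h x)) ((\<lambda>i. (n, X, i)) ` {..<n})"
    by (intro has_sum_finite) auto
  also have "(\<Sum>x\<in>(\<lambda>i. (n, X, i)) ` {..<n}. h x) = (\<Sum>i<n. h (n, X, i))"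
    by (subst sum.reindex) (auto simp: inj_on_def)
  finally show ?thesis
    by (rule has_sum_cong_neutral[THEN iffD1, rotated -1]) (use assms in auto)
qed

lemma emb_apply: "emb n X v (m, Y, i) = (if m = n \<and> Y = X \<and> i < n then v i else 0)"
  by (simp add: emb_def)

lemma emb_ell2:
  assumes "X \<in> K n"
  shows "emb n X v \<in> ell2 (dsum_index K)"
proof -
  have "(\<lambda>x. (cmod (emb n X v x))\<^sup>2) summable_on UNIV"
    by (rule has_sum_imp_summable, rule emb_sum[of n X]) (auto simp: emb_apply)
  moreover have "emb n X v x = 0" if "x \<notin> dsum_index K" for x
    using that assms by (cases x) (auto simp: emb_apply)
  ultimately show ?thesis by (simp add: ell2_def)
qed

lemma dsum_op_emb:
  assumes "X \<in> K n"
  shows "dsum_op K F (emb n X v) = emb n X (mact n (F X) v)"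
proof -
  have "dsum_op K F (emb n X v) (m, Y, i) = emb n X (mact n (F X) v) (m, Y, i)" for m Y i
    using assms by (auto simp: dsum_op_apply[OF emb_ell2[where K = K and n = n and X = X, OF assms]] emb_apply mact_def)
  then show ?thesis by auto
qed

lemma l2_inner_emb: "l2_inner (emb n X u) (emb n X v) = (\<Sum>i<n. u i * cnj (v i))"
proof -
  have "((\<lambda>x. emb n X u x * cnj (emb n X v x)) has_sum
      (\<Sum>i<n. emb n X u (n, X, i) * cnj (emb n X v (n, X, i)))) UNIV"
    by (rule emb_sum) (auto simp: emb_apply)
  then show ?thesis unfolding l2_inner_def by (simp add: infsumI emb_apply)
qed

lemma emb_eq_iff: "emb n X u = emb n X v \<longleftrightarrow> (\<forall>i<n. u i = v i)"
proof
  assume "emb n X u = emb n X v"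
  then have "emb n X u (n, X, i) = emb n X v (n, X, i)" for i by simp
  then show "\<forall>i<n. u i = v i" by (metis emb_apply)
qed (auto simp: emb_def fun_eq_iff)

lemma mat_eq_mact:
  assumes "A \<in> carrier_mat n n" "B \<in> carrier_mat n n" "\<And>v i. i < n \<Longrightarrow> mact n A v i = mact n B v i"
  shows "A = B"
proof (rule eq_matI)
  fix i j assume "i < dim_row B" "j < dim_col B"
  then have "i < n" "j < n" using assms by auto
  then show "A $$ (i, j) = B $$ (i, j)"
    using assms(3)[of i "\<lambda>k. if k = j then 1 else 0"]
    by (simp add: mact_def if_distrib[of "\<lambda>x. _ * x"] cong: if_cong)
qed (use assms in auto)

lemma dsum_op_eq_iff:
  assumes "\<And>n X. X \<in> K n \<Longrightarrow> F X \<in> carrier_mat n n" "\<And>n X. X \<in> K n \<Longrightarrow> G X \<in> carrier_mat n n"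
  shows "dsum_op K F = dsum_op K G \<longleftrightarrow> (\<forall>n. \<forall>X\<in>K n. F X = G X)"
proof
  assume eq: "dsum_op K F = dsum_op K G"
  show "\<forall>n. \<forall>X\<in>K n. F X = G X"
  proof (intro allI ballI)
    fix n X assume X: "X \<in> K n"
    have "emb n X (mact n (F X) v) = emb n X (mact n (G X) v)" for v
      using fun_cong[OF eq, of "emb n X v"] by (simp only: dsum_op_emb[where K = K and n = n, OF X])
    then show "F X = G X" by (intro mat_eq_mact[of _ n] assms X) (simp add: emb_eq_iff)
  qed
next
  assume "\<forall>n. \<forall>X\<in>K n. F X = G X"
  then have "dsum_op K F f x = dsum_op K G f x" for f x by (cases x) (auto simp: dsum_op_def)
  then show "dsum_op K F = dsum_op K G" by (simp add: fun_eq_iff)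
qed

lemma dsum_op_comp:
  assumes "\<And>n X. X \<in> K n \<Longrightarrow> F X \<in> carrier_mat n n" "\<And>n X. X \<in> K n \<Longrightarrow> G X \<in> carrier_mat n n"
    and bd: "bounded_op (dsum_index K) (dsum_op K G)"
  shows "dsum_op K F \<circ> dsum_op K G = dsum_op K (\<lambda>X. F X * G X)"
proof (rule ext)+
  fix f and x :: dsix
  obtain n X i where x: "x = (n, X, i)" by (cases x)
  show "(dsum_op K F \<circ> dsum_op K G) f x = dsum_op K (\<lambda>X. F X * G X) f x"
  proof (cases "f \<in> ell2 (dsum_index K) \<and> X \<in> K n \<and> i < n")
    case True
    then have f: "f \<in> ell2 (dsum_index K)" by blast
    show ?thesis using True mact_mult[OF assms(1)[of X n] assms(2)[of X n]]
      by (simp add: x dsum_op_apply[OF f] dsum_op_apply[OF bounded_opD(1)[OF bd f]] cong: mact_cong)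
  next
    case False
    then show ?thesis by (auto simp: x dsum_op_def)
  qed
qed

lemma dsum_op_one:
  assumes "\<And>n X. X \<in> K n \<Longrightarrow> dimt X = n"
  shows "id_op (dsum_index K) = dsum_op K (\<lambda>X. 1\<^sub>m (dimt X))"
proof (rule ext)+
  fix f :: "dsix \<Rightarrow> complex" and x :: dsix
  obtain n X i where x: "x = (n, X, i)" by (cases x)
  show "id_op (dsum_index K) f x = dsum_op K (\<lambda>X. 1\<^sub>m (dimt X)) f x"
  proof (cases "f \<in> ell2 (dsum_index K) \<and> X \<in> K n \<and> i < n")
    case True
    then show ?thesis using assms[of X n] by (simp add: x id_op_def dsum_op_apply mact_one)
  next
    case False
    then show ?thesis using ell2_off[of f "dsum_index K" x] by (auto simp: x id_op_def dsum_op_def)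
  qed
qed

text \<open>The tuple \<open>F X\<close> varies with the use: \<open>X\<close> itself for the
  generators, and tuples of elements of the system for the relation clause of
  \<open>realizes\<close>.\<close>

lemma op_eval_dsum_op:
  assumes F: "\<And>n X. X \<in> K n \<Longrightarrow> F X \<in> mtuples g n" and d: "\<And>n X. X \<in> K n \<Longrightarrow> dimt X = n"
    and A: "\<And>j. j < g \<Longrightarrow> A ! j = dsum_op K (\<lambda>X. F X ! j)"
    and bd: "\<And>j. j < g \<Longrightarrow> bounded_op (dsum_index K) (A ! j)" and p: "nc_poly_in g p"
  shows "op_eval (dsum_index K) A p = dsum_op K (\<lambda>X. mat_eval (dimt X) (F X) p)"
proof -
  have word: "op_word (dsum_index K) A w = dsum_op K (\<lambda>X. mat_word (dimt X) (F X) w)"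
    if "set w \<subseteq> {..<g}" for w
    using that
  proof (induction w)
    case Nil
    then show ?case using dsum_op_one[of K] d by simp
  next
    case (Cons j w)
    then have j: "j < g" and w: "set w \<subseteq> {..<g}" by auto
    have "dsum_op K (\<lambda>X. F X ! j) \<circ> dsum_op K (\<lambda>X. mat_word (dimt X) (F X) w) =
        dsum_op K (\<lambda>X. F X ! j * mat_word (dimt X) (F X) w)"
    proof (rule dsum_op_comp)
      show "bounded_op (dsum_index K) (dsum_op K (\<lambda>X. mat_word (dimt X) (F X) w))"
        using op_word_bounded[OF bd w] Cons.IH[OF w] by simp
    qed (use mtuples_nth[OF F j] mat_word_carrier[OF F w] d in auto)
    then show ?case using Cons.IH[OF w] A[OF j] by (simp add: op_word_Cons mat_word_Cons)
  qed
  show ?thesis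
  proof (rule ext)+
    fix f and x :: dsix
    obtain n X i where x: "x = (n, X, i)" by (cases x)
    have "op_eval (dsum_index K) A p f x = (\<Sum>w\<in>Poly_Mapping.keys p.
        Poly_Mapping.lookup p w * dsum_op K (\<lambda>X. mat_word (dimt X) (F X) w) f x)"
      unfolding op_eval_def using word[OF nc_poly_in_keys[OF p]] by simp
    also have "\<dots> = dsum_op K (\<lambda>X. mat_eval (dimt X) (F X) p) f x"
    proof (cases "f \<in> ell2 (dsum_index K) \<and> X \<in> K n \<and> i < n")
      case True
      then have f: "f \<in> ell2 (dsum_index K)" and X: "X \<in> K n" and i: "i < n" by auto
      have "mact n (mat_eval n (F X) p) v i =
          (\<Sum>k<n. \<Sum>w\<in>Poly_Mapping.keys p. Poly_Mapping.lookup p w * mat_word n (F X) w $$ (i, k) * v k)" for v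
        using i by (simp add: mact_def mat_eval_entry[OF F[OF X] p] sum_distrib_right)
      also have "\<dots> v = (\<Sum>w\<in>Poly_Mapping.keys p. Poly_Mapping.lookup p w * mact n (mat_word n (F X) w) v i)" for v
        by (subst sum.swap) (simp add: mact_def sum_distrib_left mult.assoc)
      finally show ?thesis using True d[OF X] by (simp add: x dsum_op_apply[OF f])
    qed (auto simp: x dsum_op_def)
    finally show "op_eval (dsum_index K) A p f x = dsum_op K (\<lambda>X. mat_eval (dimt X) (F X) p) f x" .
  qed
qed

section \<open>Positivity of block matrices over a direct sum\<close>

lemma infsum_sum_swap:
  fixes h :: "'a \<Rightarrow> 'b \<Rightarrow> complex"
  assumes "finite A" "\<And>a. a \<in> A \<Longrightarrow> h a summable_on UNIV"
  shows "((\<lambda>x. \<Sum>a\<in>A. h a x) has_sum (\<Sum>a\<in>A. infsum (h a) UNIV)) UNIV"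
  using assms by (induction A rule: finite_induct) (auto intro!: has_sum_add has_sum_infsum)

text \<open>As in \<open>block_positive\<close>, the order on \<open>complex\<close> makes the form
  real as well; the self-adjointness of dominated tuples will be drawn from this.\<close>

definition mat_block_pos :: "nat \<Rightarrow> nat \<Rightarrow> (nat \<Rightarrow> nat \<Rightarrow> complex mat) \<Rightarrow> bool" where
  "mat_block_pos n m M \<longleftrightarrow> (\<forall>v :: nat \<Rightarrow> nat \<Rightarrow> complex.
     0 \<le> (\<Sum>k<m. \<Sum>l<m. \<Sum>i<n. mact n (M k l) (v l) i * cnj (v k i)))"

lemma sum3_rotate:
  "(\<Sum>i\<in>A. \<Sum>k\<in>B. \<Sum>l\<in>C. h i k l) = (\<Sum>k\<in>B. \<Sum>l\<in>C. \<Sum>i\<in>A. h i k l)"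
proof -
  have "(\<Sum>i\<in>A. \<Sum>k\<in>B. \<Sum>l\<in>C. h i k l) = (\<Sum>k\<in>B. \<Sum>i\<in>A. \<Sum>l\<in>C. h i k l)" by (rule sum.swap)
  also have "\<dots> = (\<Sum>k\<in>B. \<Sum>l\<in>C. \<Sum>i\<in>A. h i k l)" by (intro sum.cong refl sum.swap)
  finally show ?thesis .
qed

text \<open>Vectors supported at one point detect the block there; conversely, the form of a vector
  is the sum over all points of the forms of its components, each nonnegative.\<close>

lemma block_positive_dsum:
  assumes bd: "\<And>k l. k < m \<Longrightarrow> l < m \<Longrightarrow> bounded_op (dsum_index K) (dsum_op K (F k l))"
  shows "block_positive (dsum_index K) m (\<lambda>k l. dsum_op K (F k l)) \<longleftrightarrow>
    (\<forall>n. \<forall>X\<in>K n. mat_block_pos n m (\<lambda>k l. F k l X))"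
proof (intro iffI allI ballI)
  fix n X assume pos: "block_positive (dsum_index K) m (\<lambda>k l. dsum_op K (F k l))" and X: "X \<in> K n"
  show "mat_block_pos n m (\<lambda>k l. F k l X)"
    unfolding mat_block_pos_def
  proof
    fix v :: "nat \<Rightarrow> nat \<Rightarrow> complex"
    have "0 \<le> (\<Sum>k<m. \<Sum>l<m. l2_inner (dsum_op K (F k l) (emb n X (v l))) (emb n X (v k)))"
      using pos emb_ell2[where K = K and n = n, OF X] by (simp add: block_positive_def)
    then show "0 \<le> (\<Sum>k<m. \<Sum>l<m. \<Sum>i<n. mact n (F k l X) (v l) i * cnj (v k i))"
      by (simp add: dsum_op_emb[where K = K and n = n, OF X] l2_inner_emb)
  qed
next
  assume pos: "\<forall>n. \<forall>X\<in>K n. mat_block_pos n m (\<lambda>k l. F k l X)"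
  show "block_positive (dsum_index K) m (\<lambda>k l. dsum_op K (F k l))"
    unfolding block_positive_def
  proof (intro allI impI)
    fix v :: "nat \<Rightarrow> dsix \<Rightarrow> complex" assume v: "\<forall>k<m. v k \<in> ell2 (dsum_index K)"
    let ?h = "\<lambda>x. \<Sum>(k, l)\<in>{..<m} \<times> {..<m}. dsum_op K (F k l) (v l) x * cnj (v k x)"
    have "(?h has_sum (\<Sum>(k, l)\<in>{..<m} \<times> {..<m}. l2_inner (dsum_op K (F k l) (v l)) (v k))) UNIV"
      unfolding l2_inner_def case_prod_beta
      by (rule infsum_sum_swap) (use v bounded_opD(1)[OF bd] in \<open>auto intro!: ell2_prod_summable\<close>)
    then have "((\<lambda>(n, X). \<Sum>i<n. ?h (n, X, i)) has_sum
        (\<Sum>(k, l)\<in>{..<m} \<times> {..<m}. l2_inner (dsum_op K (F k l) (v l)) (v k))) {(n, X). X \<in> K n}"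
    proof (rule dsum_has_sum_blocks[where h = ?h])
      fix x :: dsix assume "x \<notin> dsum_index K"
      then show "?h x = 0" using v ell2_off by (intro sum.neutral) fastforce
    qed
    moreover have "0 \<le> (\<lambda>(n, X). \<Sum>i<n. ?h (n, X, i)) x" if "x \<in> {(n, X). X \<in> K n}" for x
    proof -
      obtain n X where x: "x = (n, X)" and X: "X \<in> K n" using \<open>x \<in> _\<close> by blast
      have "(\<Sum>i<n. ?h (n, X, i)) =
          (\<Sum>i<n. \<Sum>k<m. \<Sum>l<m. mact n (F k l X) (\<lambda>i. v l (n, X, i)) i * cnj (v k (n, X, i)))"
        using v X by (simp add: sum.cartesian_product[symmetric] dsum_op_apply)
      also have "\<dots> = (\<Sum>k<m. \<Sum>l<m. \<Sum>i<n. mact n (F k l X) (\<lambda>i. v l (n, X, i)) i * cnj (v k (n, X, i)))"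
        by (rule sum3_rotate)
      finally have eq: "(\<Sum>i<n. ?h (n, X, i)) = \<dots>" .
      show ?thesis
        unfolding x prod.case eq
        using pos[rule_format, OF X, unfolded mat_block_pos_def, rule_format, of "\<lambda>k i. v k (n, X, i)"] .
    qed
    ultimately have "0 \<le> (\<Sum>(k, l)\<in>{..<m} \<times> {..<m}. l2_inner (dsum_op K (F k l) (v l)) (v k))"
      by (metis (no_types, lifting) infsumI infsum_nonneg_complex has_sum_imp_summable)
    then show "0 \<le> (\<Sum>k<m. \<Sum>l<m. l2_inner (dsum_op K (F k l) (v l)) (v k))"
      by (simp add: sum.cartesian_product)
  qed
qed


section \<open>Operator systems as functions on a graded set\<close>

text \<open>An element of the system given by coefficients. Linear relations among the
  \<open>\<gamma>\<^sub>j(A)\<close> make the coefficients non-unique, and every map defined through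
  them has to be shown well defined.\<close>

definition gop :: "ncpoly list \<Rightarrow> 'i opsys \<Rightarrow> complex \<Rightarrow> (nat \<Rightarrow> complex) \<Rightarrow> 'i op" where
  "gop \<Gamma> a c d =
    (\<lambda>f i. c * id_op (fst a) f i + (\<Sum>j<length \<Gamma>. d j * op_eval (fst a) (snd a) (\<Gamma> ! j) f i))"

text \<open>The value at the point \<open>X\<close> of the element with these coefficients.\<close>

definition lme :: "ncpoly list \<Rightarrow> nat \<Rightarrow> mtuple \<Rightarrow> complex \<Rightarrow> (nat \<Rightarrow> complex) \<Rightarrow> complex mat" where
  "lme \<Gamma> n X c d = c \<cdot>\<^sub>m 1\<^sub>m n + mat_sum n {..<length \<Gamma>} (\<lambda>l. d l \<cdot>\<^sub>m mat_eval n X (\<Gamma> ! l))"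

lemma Rsys_gop: "P \<in> Rsys \<Gamma> a \<longleftrightarrow> (\<exists>c d. P = gop \<Gamma> a c d)"
  by (cases a) (simp add: Rsys_def gop_def)

lemma gop_in [simp]: "gop \<Gamma> a c d \<in> Rsys \<Gamma> a"
  by (auto simp: Rsys_gop)

lemma gop_lin:
  "(\<lambda>f i. x * gop \<Gamma> a c d f i + y * gop \<Gamma> a c' d' f i) = gop \<Gamma> a (x * c + y * c') (\<lambda>j. x * d j + y * d' j)"
  by (simp add: gop_def fun_eq_iff algebra_simps sum.distrib sum_distrib_left)

lemma gop_one: "gop \<Gamma> a 1 (\<lambda>_. 0) = id_op (fst a)"
  by (simp add: gop_def fun_eq_iff)

lemma gop_gen: "j < length \<Gamma> \<Longrightarrow> gop \<Gamma> a 0 (\<lambda>l. if l = j then 1 else 0) = op_eval (fst a) (snd a) (\<Gamma> ! j)"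
  by (simp add: gop_def fun_eq_iff if_distrib[of "\<lambda>x. x * _"] cong: if_cong)

lemma gop_cong: "(\<And>j. j < length \<Gamma> \<Longrightarrow> d j = d' j) \<Longrightarrow> gop \<Gamma> a c d = gop \<Gamma> a c d'"
  by (simp add: gop_def)

lemma lme_carrier [simp]: "lme \<Gamma> n X c d \<in> carrier_mat n n"
  by (simp add: lme_def)

lemma lme_dims [simp]: "dim_row (lme \<Gamma> n X c d) = n" "dim_col (lme \<Gamma> n X c d) = n"
  by (simp_all add: lme_def)

lemma lme_entry:
  "i < n \<Longrightarrow> k < n \<Longrightarrow> lme \<Gamma> n X c d $$ (i, k) =
    c * (1\<^sub>m n) $$ (i, k) + (\<Sum>l<length \<Gamma>. d l * mat_eval n X (\<Gamma> ! l) $$ (i, k))"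
  by (simp add: lme_def)

lemma mact_lme:
  "i < n \<Longrightarrow> mact n (lme \<Gamma> n X c d) v i = c * v i + (\<Sum>l<length \<Gamma>. d l * mact n (mat_eval n X (\<Gamma> ! l)) v i)"
proof -
  assume i: "i < n"
  have "mact n (lme \<Gamma> n X c d) v i =
      (\<Sum>k<n. c * ((1\<^sub>m n) $$ (i, k) * v k) + (\<Sum>l<length \<Gamma>. d l * (mat_eval n X (\<Gamma> ! l) $$ (i, k) * v k)))"
    using i by (simp add: mact_def lme_entry distrib_right sum_distrib_right mult.assoc)
  also have "\<dots> = c * mact n (1\<^sub>m n) v i + (\<Sum>k<n. \<Sum>l<length \<Gamma>. d l * (mat_eval n X (\<Gamma> ! l) $$ (i, k) * v k))"
    by (simp add: sum.distrib sum_distrib_left mact_def)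
  also have "(\<Sum>k<n. \<Sum>l<length \<Gamma>. d l * (mat_eval n X (\<Gamma> ! l) $$ (i, k) * v k)) =
      (\<Sum>l<length \<Gamma>. d l * mact n (mat_eval n X (\<Gamma> ! l)) v i)"
    by (subst sum.swap) (simp add: mact_def sum_distrib_left)
  finally show ?thesis using mact_one[OF i] by simp
qed

text \<open>\<open>lin_on\<close> treats two elements of the system at a time, so the coefficients
  are switched on one by one and every partial sum is again an element of the system.\<close>

lemma lin_on_gop:
  assumes lin: "lin_on (Rsys \<Gamma> a) \<phi>"
  shows "\<phi> (gop \<Gamma> a c d) =
    (\<lambda>f i. c * \<phi> (id_op (fst a)) f i + (\<Sum>j<length \<Gamma>. d j * \<phi> (op_eval (fst a) (snd a) (\<Gamma> ! j)) f i))"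
proof -
  have part: "\<phi> (gop \<Gamma> a c (\<lambda>j. if j < m then d j else 0)) =
    (\<lambda>f i. c * \<phi> (id_op (fst a)) f i + (\<Sum>j<m. d j * \<phi> (op_eval (fst a) (snd a) (\<Gamma> ! j)) f i))"
    if "m \<le> length \<Gamma>" for m
    using that
  proof (induction m)
    case 0
    have "\<phi> (\<lambda>f i. c * id_op (fst a) f i + 0 * id_op (fst a) f i) =
        (\<lambda>f i. c * \<phi> (id_op (fst a)) f i + 0 * \<phi> (id_op (fst a)) f i)"
      using lin gop_in[of \<Gamma> a 1 "\<lambda>_. 0"] unfolding lin_on_def gop_one by blast
    then show ?case by (simp add: gop_def)
  next
    case (Suc m)
    have "gop \<Gamma> a c (\<lambda>j. if j < Suc m then d j else 0) =
        (\<lambda>f i. 1 * gop \<Gamma> a c (\<lambda>j. if j < m then d j else 0) f i +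
          d m * gop \<Gamma> a 0 (\<lambda>l. if l = m then 1 else 0) f i)"
    proof -
      have "(\<lambda>j. if j < Suc m then d j else 0) =
          (\<lambda>j. 1 * (if j < m then d j else 0) + d m * (if j = m then 1 else 0))"
        by (auto simp: fun_eq_iff less_Suc_eq)
      then show ?thesis unfolding gop_lin by simp
    qed
    moreover have "\<phi> \<dots> = (\<lambda>f i. 1 * \<phi> (gop \<Gamma> a c (\<lambda>j. if j < m then d j else 0)) f i +
          d m * \<phi> (gop \<Gamma> a 0 (\<lambda>l. if l = m then 1 else 0)) f i)"
      using lin gop_in unfolding lin_on_def by blast
    ultimately show ?case using Suc gop_gen[of m \<Gamma> a] by (simp add: add.assoc)
  qed
  have "gop \<Gamma> a c (\<lambda>j. if j < length \<Gamma> then d j else 0) = gop \<Gamma> a c d"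
    by (rule gop_cong) simp
  from part[OF order_refl, unfolded this] show ?thesis .
qed

text \<open>\<open>realizes g \<Gamma> a K\<close>: the operator system of \<open>a\<close> has the matrix order and the polynomial
  relations of the functions \<open>X \<mapsto> c + \<Sum>\<^sub>j d\<^sub>j \<gamma>\<^sub>j(X)\<close> on the graded set \<open>K\<close>.\<close>

definition realizes :: "nat \<Rightarrow> ncpoly list \<Rightarrow> 'i opsys \<Rightarrow> gset \<Rightarrow> bool" where
  "realizes g \<Gamma> a K \<longleftrightarrow>
     length (snd a) = g \<and> (\<forall>P\<in>set (snd a). bounded_op (fst a) P) \<and>
     (\<forall>m c d. block_positive (fst a) m (\<lambda>k l. gop \<Gamma> a (c k l) (d k l)) \<longleftrightarrow>
        (\<forall>n. \<forall>X\<in>K n. mat_block_pos n m (\<lambda>k l. lme \<Gamma> n X (c k l) (d k l)))) \<and>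
     (\<forall>p c d c0 d0. nc_poly_in g p \<longrightarrow>
        (op_eval (fst a) (map (\<lambda>j. gop \<Gamma> a (c j) (d j)) [0..<g]) p = gop \<Gamma> a c0 d0 \<longleftrightarrow>
         (\<forall>n. \<forall>X\<in>K n. mat_eval n (map (\<lambda>j. lme \<Gamma> n X (c j) (d j)) [0..<g]) p = lme \<Gamma> n X c0 d0)))"

locale gamma_tuple =
  fixes g :: nat and \<Gamma> :: "ncpoly list"
  assumes g_pos: "1 \<le> g" and g_le: "g \<le> length \<Gamma>"
    and poly_in: "\<And>j. j < length \<Gamma> \<Longrightarrow> nc_poly_in g (\<Gamma> ! j)"
    and poly_star: "\<And>j. j < length \<Gamma> \<Longrightarrow> nc_star (\<Gamma> ! j) = \<Gamma> ! j"
    and vars: "\<And>j. j < g \<Longrightarrow> \<Gamma> ! j = nc_var j"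
    and zero: "\<And>j. j < length \<Gamma> \<Longrightarrow> mat_eval 1 (replicate g (0\<^sub>m 1 1)) (\<Gamma> ! j) = 0\<^sub>m 1 1"
begin

section \<open>Boundedness, equality and generators in a realized system\<close>

lemma gop_bounded:
  assumes "\<And>j. j < g \<Longrightarrow> bounded_op (fst a) (snd a ! j)"
  shows "bounded_op (fst a) (gop \<Gamma> a c d)"
proof -
  have "bounded_op (fst a) (\<lambda>f i. c * id_op (fst a) f i +
      1 * (\<Sum>j<length \<Gamma>. d j * op_eval (fst a) (snd a) (\<Gamma> ! j) f i))"
    using op_eval_bounded[OF assms poly_in] by (intro bounded_op_lin bounded_op_sum) auto
  then show ?thesis by (simp add: gop_def)
qed

lemma realizes_bounded:
  assumes "realizes g \<Gamma> a K"
  shows "j < g \<Longrightarrow> bounded_op (fst a) (snd a ! j)" "bounded_op (fst a) (gop \<Gamma> a c d)"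
    "P \<in> Rsys \<Gamma> a \<Longrightarrow> bounded_op (fst a) P" "length (snd a) = g"
proof -
  show *: "bounded_op (fst a) (snd a ! j)" if "j < g" for j
    using assms that by (auto simp: realizes_def)
  show "bounded_op (fst a) (gop \<Gamma> a c d)" for c d by (rule gop_bounded[OF *])
  then show "P \<in> Rsys \<Gamma> a \<Longrightarrow> bounded_op (fst a) P" by (auto simp: Rsys_gop)
qed (use assms in \<open>simp add: realizes_def\<close>)

lemma realizes_pos:
  "realizes g \<Gamma> a K \<Longrightarrow> block_positive (fst a) m (\<lambda>k l. gop \<Gamma> a (c k l) (d k l)) \<longleftrightarrow>
        (\<forall>n. \<forall>X\<in>K n. mat_block_pos n m (\<lambda>k l. lme \<Gamma> n X (c k l) (d k l)))"
  by (simp add: realizes_def)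

lemma realizes_eval:
  "realizes g \<Gamma> a K \<Longrightarrow> nc_poly_in g p \<Longrightarrow>
    op_eval (fst a) (map (\<lambda>j. gop \<Gamma> a (c j) (d j)) [0..<g]) p = gop \<Gamma> a c0 d0 \<longleftrightarrow>
         (\<forall>n. \<forall>X\<in>K n. mat_eval n (map (\<lambda>j. lme \<Gamma> n X (c j) (d j)) [0..<g]) p = lme \<Gamma> n X c0 d0)"
  by (simp add: realizes_def)

lemma lme_tuple: "map (\<lambda>j. lme \<Gamma> n X (c j) (d j)) [0..<g] \<in> mtuples g n"
  by (auto simp: mtuples_def)

text \<open>Equality is the polynomial relation for the first variable, at the constant tuple of the
  given element; \<open>1 \<le> g\<close> provides that variable.\<close>

lemma realizes_eq:
  assumes "realizes g \<Gamma> a K"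
  shows "gop \<Gamma> a c d = gop \<Gamma> a c' d' \<longleftrightarrow> (\<forall>n. \<forall>X\<in>K n. lme \<Gamma> n X c d = lme \<Gamma> n X c' d')"
proof -
  have "op_eval (fst a) (map (\<lambda>j. gop \<Gamma> a c d) [0..<g]) (nc_var 0) = gop \<Gamma> a c d"
    using g_pos realizes_bounded(2)[OF assms] by (subst op_eval_var) auto
  moreover have "mat_eval n (map (\<lambda>j. lme \<Gamma> n X c d) [0..<g]) (nc_var 0) = lme \<Gamma> n X c d" for n X
    using g_pos mat_eval_var[OF lme_tuple, of 0 n X "\<lambda>_. c" "\<lambda>_. d"] by simp
  ultimately show ?thesis
    using realizes_eval[OF assms, of "nc_var 0" "\<lambda>_. c" "\<lambda>_. d" c' d'] g_pos by simp
qed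

lemma realizes_gen:
  assumes "realizes g \<Gamma> a K" "j < g"
  shows "gop \<Gamma> a 0 (\<lambda>l. if l = j then 1 else 0) = snd a ! j"
  using gop_gen[of j \<Gamma> a] vars[OF assms(2)] op_eval_var[OF realizes_bounded(1)[OF assms]] assms(2) g_le
  by simp

lemma lme_gen: "j < length \<Gamma> \<Longrightarrow> lme \<Gamma> n X 0 (\<lambda>l. if l = j then 1 else 0) = mat_eval n X (\<Gamma> ! j)"
  by (intro eq_matI) (auto simp: lme_entry if_distrib[of "\<lambda>x. x * _"] cong: if_cong)

lemma mat_eval_gen: "X \<in> mtuples g n \<Longrightarrow> j < g \<Longrightarrow> mat_eval n X (\<Gamma> ! j) = X ! j"
  using mat_eval_var vars by simp

lemma gen_in_Rsys:
  assumes "realizes g \<Gamma> a K" "P \<in> set (snd a)"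
  shows "P \<in> Rsys \<Gamma> a"
proof -
  obtain j where "j < g" "P = snd a ! j"
    using assms realizes_bounded(4)[OF assms(1)] by (auto simp: in_set_conv_nth)
  then show ?thesis
    using realizes_gen[OF assms(1), of j] gop_in[of \<Gamma> a 0 "\<lambda>l. if l = j then 1 else 0"] by (simp only:)
qed

lemma hat_gens:
  assumes K: "graded g K" "gbounded g K"
  shows "j < g \<Longrightarrow> bounded_op (dsum_index K) (snd (hat g K) ! j)"
    and "gop \<Gamma> (hat g K) c d = dsum_op K (\<lambda>X. lme \<Gamma> (dimt X) X c d)"
proof -
  let ?S = "dsum_index K" and ?A = "map (\<lambda>j. dsum_op K (\<lambda>X. X ! j)) [0..<g]"
  have hat: "fst (hat g K) = ?S" "snd (hat g K) = ?A" by (simp_all add: hat_def dsum_sys_def)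
  have tup: "X \<in> mtuples g n" if "X \<in> K n" for n X
    using graded_tuples(1)[OF K(1) that] by (rule sa_tuples_mtuples)
  have dim: "dimt X = n" if "X \<in> K n" for n X using dimt[OF tup[OF that] g_pos] .
  obtain C where C: "\<And>n X j. X \<in> K n \<Longrightarrow> j < g \<Longrightarrow> sqbound n (X ! j) C"
    by (rule gbounded_sqbound[OF K(2,1)]) (rule that)
  have bd: "bounded_op ?S (?A ! j)" if "j < g" for j
  proof -
    have "bounded_op ?S (dsum_op K (\<lambda>X. X ! j))" by (rule dsum_op_bounded) (rule C[OF _ that])
    then show ?thesis using that by simp
  qed
  show "bounded_op (dsum_index K) (snd (hat g K) ! j)" if "j < g" using bd[OF that] by (simp only: hat)
  show "gop \<Gamma> (hat g K) c d = dsum_op K (\<lambda>X. lme \<Gamma> (dimt X) X c d)"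
  proof (rule ext)+
    fix f and x :: dsix
    obtain n X i where x: "x = (n, X, i)" by (cases x)
    have ev: "op_eval ?S ?A (\<Gamma> ! j) = dsum_op K (\<lambda>X. mat_eval (dimt X) X (\<Gamma> ! j))" if "j < length \<Gamma>" for j
    proof (rule op_eval_dsum_op[where g = g and F = "\<lambda>X. X"])
      show "?A ! j = dsum_op K (\<lambda>X. X ! j)" "bounded_op ?S (?A ! j)" if "j < g" for j
        using that bd[OF that] by simp_all
    qed (fact tup dim poly_in[OF that])+
    show "gop \<Gamma> (hat g K) c d f x = dsum_op K (\<lambda>X. lme \<Gamma> (dimt X) X c d) f x"
    proof (cases "f \<in> ell2 ?S \<and> X \<in> K n \<and> i < n")
      case True
      then have f: "f \<in> ell2 ?S" and X: "X \<in> K n" and i: "i < n" by auto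
      show ?thesis
        unfolding gop_def hat x dsum_op_apply[OF f] dim[OF X] using X i
        by (simp add: mact_lme ev dsum_op_apply[OF f] dim[OF X] id_op_def f)
    next
      case False
      then show ?thesis using ell2_off[of f ?S x] by (auto simp: gop_def hat ev x dsum_op_def id_op_def)
    qed
  qed
qed

text \<open>Evaluation, equality and positivity are blockwise on a direct sum, and by
  \<open>hat_gens\<close> the block of \<open>gop\<close> at \<open>X\<close> is the value
  \<open>lme\<close> at \<open>X\<close>.\<close>

lemma hat_realizes:
  assumes K: "graded g K" "gbounded g K"
  shows "realizes g \<Gamma> (hat g K) K"
proof -
  let ?S = "dsum_index K" and ?A = "map (\<lambda>j. dsum_op K (\<lambda>X. X ! j)) [0..<g]"
  have hat: "fst (hat g K) = ?S" "snd (hat g K) = ?A" by (simp_all add: hat_def dsum_sys_def)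
  have tup: "X \<in> mtuples g n" if "X \<in> K n" for n X
    using graded_tuples(1)[OF K(1) that] by (rule sa_tuples_mtuples)
  have dim: "dimt X = n" if "X \<in> K n" for n X using dimt[OF tup[OF that] g_pos] .
  note bd = hat_gens(1)[OF K, unfolded hat] and gop_hat = hat_gens(2)[OF K]
  have gbd: "bounded_op ?S (gop \<Gamma> (hat g K) c d)" for c d
    using gop_bounded[of "hat g K"] bd by (simp add: hat)
  have pos: "block_positive (fst (hat g K)) m (\<lambda>k l. gop \<Gamma> (hat g K) (c k l) (d k l)) \<longleftrightarrow>
      (\<forall>n. \<forall>X\<in>K n. mat_block_pos n m (\<lambda>k l. lme \<Gamma> n X (c k l) (d k l)))" for m c d
    unfolding gop_hat hat
    by (subst block_positive_dsum) (use gbd gop_hat dim in auto)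
  have eval: "op_eval (fst (hat g K)) (map (\<lambda>j. gop \<Gamma> (hat g K) (c j) (d j)) [0..<g]) p = gop \<Gamma> (hat g K) c0 d0 \<longleftrightarrow>
     (\<forall>n. \<forall>X\<in>K n. mat_eval n (map (\<lambda>j. lme \<Gamma> n X (c j) (d j)) [0..<g]) p = lme \<Gamma> n X c0 d0)"
    if p: "nc_poly_in g p" for p c d c0 d0
  proof -
    let ?F = "\<lambda>X. map (\<lambda>j. lme \<Gamma> (dimt X) X (c j) (d j)) [0..<g]"
    have F: "?F X \<in> mtuples g n" if "X \<in> K n" for n X using lme_tuple dim[OF that] by simp
    have "op_eval ?S (map (\<lambda>j. gop \<Gamma> (hat g K) (c j) (d j)) [0..<g]) p = dsum_op K (\<lambda>X. mat_eval (dimt X) (?F X) p)"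
    proof (rule op_eval_dsum_op[where g = g and F = ?F])
      fix j assume "j < g"
      then show "map (\<lambda>j. gop \<Gamma> (hat g K) (c j) (d j)) [0..<g] ! j = dsum_op K (\<lambda>X. ?F X ! j)"
        "bounded_op ?S (map (\<lambda>j. gop \<Gamma> (hat g K) (c j) (d j)) [0..<g] ! j)"
        using gbd by (simp_all add: gop_hat)
    qed (use F dim p in auto)
    moreover have "dsum_op K (\<lambda>X. mat_eval (dimt X) (?F X) p) = dsum_op K (\<lambda>X. lme \<Gamma> (dimt X) X c0 d0) \<longleftrightarrow>
        (\<forall>n. \<forall>X\<in>K n. mat_eval (dimt X) (?F X) p = lme \<Gamma> (dimt X) X c0 d0)"
      by (rule dsum_op_eq_iff) (use dim in auto)
    ultimately show ?thesis using dim by (simp add: hat gop_hat)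
  qed
  show ?thesis
    unfolding realizes_def using pos eval bd by (auto simp: hat in_set_conv_nth)
qed

lemma hat_bounded:
  "graded g K \<Longrightarrow> gbounded g K \<Longrightarrow> P \<in> set (snd (hat g K)) \<Longrightarrow> bounded_op (fst (hat g K)) P"
  using hat_realizes[of K] unfolding realizes_def by blast

text \<open>A unitary that intertwines the generators intertwines all polynomials in elements of the
  two systems, and so matches forms and equalities on both sides.\<close>

lemma realizes_transfer:
  assumes ue: "unitarily_equiv a b" and b: "realizes g \<Gamma> b K"
  shows "realizes g \<Gamma> a K"
proof -
  obtain S A T B where ab: "a = (S, A)" "b = (T, B)" by (cases a, cases b) auto
  from ue obtain U where len: "length A = length B" and bdA: "\<forall>P\<in>set A. bounded_op S P"
    and bdB: "\<forall>P\<in>set B. bounded_op T P" and surj: "U ` ell2 S = ell2 T"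
    and lin': "\<forall>f\<in>ell2 S. \<forall>h\<in>ell2 S. \<forall>c d. U (\<lambda>i. c * f i + d * h i) = (\<lambda>i. c * U f i + d * U h i)"
    and iso': "\<forall>f\<in>ell2 S. \<forall>h\<in>ell2 S. l2_inner (U f) (U h) = l2_inner f h"
    and tw': "\<forall>j<length A. \<forall>f\<in>ell2 S. U ((A ! j) f) = (B ! j) (U f)"
    unfolding unitarily_equiv_def ab prod.case by (elim conjE exE) (rule that)
  have lin: "U (\<lambda>i. c * f i + d * h i) = (\<lambda>i. c * U f i + d * U h i)"
    if "f \<in> ell2 S" "h \<in> ell2 S" for f h c d using lin' that by blast
  have iso: "l2_inner (U f) (U h) = l2_inner f h" if "f \<in> ell2 S" "h \<in> ell2 S" for f h
    using iso' that by blast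
  have tw: "U ((A ! j) f) = (B ! j) (U f)" if "j < length A" "f \<in> ell2 S" for j f
    using tw' that by blast
  have lenB: "length B = g" using realizes_bounded(4)[OF b] by (simp add: ab)
  have U0: "U (\<lambda>_. 0) = (\<lambda>_. 0)" using lin[of "\<lambda>_. 0" "\<lambda>_. 0" 0 0] by simp
  have Uin: "U f \<in> ell2 T" if "f \<in> ell2 S" for f using surj that by blast
  \<comment> \<open>The difference of two vectors with the same image has norm 0 because
    \<open>U\<close> preserves inner products.\<close>
  have inj: "f = h" if f: "f \<in> ell2 S" and h: "h \<in> ell2 S" and eq: "U f = U h" for f h
  proof -
    let ?d = "\<lambda>i. 1 * f i + (- 1) * h i"
    have d: "?d \<in> ell2 S" by (rule ell2_lin[OF f h])
    have "U ?d = (\<lambda>_. 0)" using lin[OF f h, of 1 "-1"] eq by simp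
    then have "sqn ?d = 0" using iso[OF d d] l2_inner_self[OF d] by (simp add: l2_inner_def)
    then show ?thesis using sqn_zero_iff[OF d] by (simp add: fun_eq_iff)
  qed
  \<comment> \<open>The relation of being intertwined by \<open>U\<close>; it survives composition
    and linear combination, so it passes from the generators to everything built from them.\<close>
  define tws where "tws P Q \<longleftrightarrow> bounded_op S P \<and> bounded_op T Q \<and> (\<forall>f\<in>ell2 S. U (P f) = Q (U f))" for P Q
  have tws_comp: "tws (P \<circ> P') (Q \<circ> Q')" if "tws P Q" "tws P' Q'" for P Q P' Q'
    using that bounded_opD(1)[of S P'] by (auto simp: tws_def intro: bounded_op_comp)
  have tws_id: "tws (id_op S) (id_op T)" using Uin by (simp add: tws_def id_op_def)
  have tws_lin: "tws (\<lambda>f i. c * P f i + d * P' f i) (\<lambda>f i. c * Q f i + d * Q' f i)"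
    if "tws P Q" "tws P' Q'" for P Q P' Q' c d
    using that bounded_opD(1)[of S P'] bounded_opD(1)[of S P] by (auto simp: tws_def lin intro: bounded_op_lin)
  have tws_sum: "tws (\<lambda>f i. \<Sum>w\<in>F. c w * P w f i) (\<lambda>f i. \<Sum>w\<in>F. c w * Q w f i)"
    if "finite F" "\<And>w. w \<in> F \<Longrightarrow> tws (P w) (Q w)" for P Q c and F :: "'x set"
    using that
  proof (induction F rule: finite_induct)
    case empty
    then show ?case by (simp add: tws_def U0)
  next
    case (insert w F)
    then show ?case using tws_lin[of "P w" "Q w" "\<lambda>f i. \<Sum>w\<in>F. c w * P w f i" "\<lambda>f i. \<Sum>w\<in>F. c w * Q w f i" "c w" 1] by simp
  qed
  have tws_eval: "tws (op_eval S E p) (op_eval T F p)"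
    if "\<And>j. j < g \<Longrightarrow> tws (E ! j) (F ! j)" "nc_poly_in g p" for E F p
  proof -
    have "tws (op_word S E w) (op_word T F w)" if "set w \<subseteq> {..<g}" for w
      using that by (induction w) (auto simp: tws_id op_word_Cons intro!: tws_comp \<open>\<And>j. j < g \<Longrightarrow> tws (E ! j) (F ! j)\<close>)
    then show ?thesis unfolding op_eval_def using nc_poly_in_keys[OF that(2)] by (intro tws_sum) auto
  qed
  have tws_A: "tws (A ! j) (B ! j)" if "j < g" for j
    using that bdA bdB tw len lenB by (simp add: tws_def)
  have tws_gop: "tws (gop \<Gamma> a c d) (gop \<Gamma> b c d)" for c d
  proof -
    have "tws (\<lambda>f i. c * id_op S f i + 1 * (\<Sum>j<length \<Gamma>. d j * op_eval S A (\<Gamma> ! j) f i))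
        (\<lambda>f i. c * id_op T f i + 1 * (\<Sum>j<length \<Gamma>. d j * op_eval T B (\<Gamma> ! j) f i))"
      using tws_eval[OF tws_A poly_in] by (intro tws_lin tws_id tws_sum) auto
    then show ?thesis by (simp add: gop_def ab)
  qed
  \<comment> \<open>On \<open>ell2\<close> the correspondence is faithful in both directions because
    \<open>U\<close> is onto and injective; off \<open>ell2\<close> bounded operators vanish by
    convention.\<close>
  have tws_eq: "P = P' \<longleftrightarrow> Q = Q'" if t: "tws P Q" "tws P' Q'" for P P' Q Q'
  proof
    assume eq: "P = P'"
    show "Q = Q'"
    proof
      fix h show "Q h = Q' h"
      proof (cases "h \<in> ell2 T")
        case True
        then obtain f where "f \<in> ell2 S" "h = U f" using surj by blast
        then show ?thesis using t eq by (simp add: tws_def)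
      next
        case False
        then show ?thesis using t bounded_opD(2)[of T Q h] bounded_opD(2)[of T Q' h] by (simp add: tws_def)
      qed
    qed
  next
    assume eq: "Q = Q'"
    show "P = P'"
    proof
      fix f show "P f = P' f"
      proof (cases "f \<in> ell2 S")
        case True
        then have "U (P f) = U (P' f)" using t eq by (simp add: tws_def)
        moreover have "P f \<in> ell2 S" "P' f \<in> ell2 S"
          using True t bounded_opD(1)[of S P f] bounded_opD(1)[of S P' f] by (simp_all add: tws_def)
        ultimately show ?thesis by (intro inj)
      next
        case False
        then show ?thesis using t bounded_opD(2)[of S P f] bounded_opD(2)[of S P' f] by (simp add: tws_def)
      qed
    qed
  qed
  have tws_inner: "l2_inner (P f) h = l2_inner (Q (U f)) (U h)" if "tws P Q" "f \<in> ell2 S" "h \<in> ell2 S" for P Q f h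
    using that iso[of "P f" h] bounded_opD(1)[of S P f] by (simp add: tws_def)
  have pos: "block_positive S m P \<longleftrightarrow> block_positive T m Q"
    if t: "\<And>k l. tws (P k l) (Q k l)" for m P Q
  proof
    assume L: "block_positive S m P"
    show "block_positive T m Q"
      unfolding block_positive_def
    proof (intro allI impI)
      fix v :: "nat \<Rightarrow> 'b \<Rightarrow> complex" assume "\<forall>k<m. v k \<in> ell2 T"
      then have v: "v k \<in> U ` ell2 S" if "k < m" for k using surj that by blast
      define u where "u k = inv_into (ell2 S) U (v k)" for k
      have u: "u k \<in> ell2 S" "U (u k) = v k" if "k < m" for k
        unfolding u_def using inv_into_into[OF v[OF that]] f_inv_into_f[OF v[OF that]] .
      have "0 \<le> (\<Sum>k<m. \<Sum>l<m. l2_inner (P k l (u l)) (u k))" using L u(1) by (simp add: block_positive_def)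
      then show "0 \<le> (\<Sum>k<m. \<Sum>l<m. l2_inner (Q k l (v l)) (v k))" using tws_inner[OF t] u by simp
    qed
  next
    assume R: "block_positive T m Q"
    show "block_positive S m P"
      unfolding block_positive_def
    proof (intro allI impI)
      fix v :: "nat \<Rightarrow> 'a \<Rightarrow> complex" assume v: "\<forall>k<m. v k \<in> ell2 S"
      have "0 \<le> (\<Sum>k<m. \<Sum>l<m. l2_inner (Q k l (U (v l))) (U (v k)))"
        using R Uin v by (simp add: block_positive_def)
      then show "0 \<le> (\<Sum>k<m. \<Sum>l<m. l2_inner (P k l (v l)) (v k))" using tws_inner[OF t] v by simp
    qed
  qed
  have eval: "op_eval S (map (\<lambda>j. gop \<Gamma> a (c j) (d j)) [0..<g]) p = gop \<Gamma> a c0 d0 \<longleftrightarrow>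
      op_eval T (map (\<lambda>j. gop \<Gamma> b (c j) (d j)) [0..<g]) p = gop \<Gamma> b c0 d0"
    if "nc_poly_in g p" for p c d c0 d0
  proof (rule tws_eq[OF _ tws_gop])
    show "tws (op_eval S (map (\<lambda>j. gop \<Gamma> a (c j) (d j)) [0..<g]) p)
        (op_eval T (map (\<lambda>j. gop \<Gamma> b (c j) (d j)) [0..<g]) p)"
      by (rule tws_eval) (use tws_gop that in auto)
  qed
  have "block_positive (fst a) m (\<lambda>k l. gop \<Gamma> a (c k l) (d k l)) \<longleftrightarrow>
      (\<forall>n. \<forall>X\<in>K n. mat_block_pos n m (\<lambda>k l. lme \<Gamma> n X (c k l) (d k l)))" for m c d
  proof -
    have "block_positive S m (\<lambda>k l. gop \<Gamma> a (c k l) (d k l)) \<longleftrightarrow>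
        block_positive T m (\<lambda>k l. gop \<Gamma> b (c k l) (d k l))"
      by (rule pos) (rule tws_gop)
    then show ?thesis using realizes_pos[OF b, of m c d] by (simp only: ab fst_conv)
  qed
  moreover have "op_eval (fst a) (map (\<lambda>j. gop \<Gamma> a (c j) (d j)) [0..<g]) p = gop \<Gamma> a c0 d0 \<longleftrightarrow>
      (\<forall>n. \<forall>X\<in>K n. mat_eval n (map (\<lambda>j. lme \<Gamma> n X (c j) (d j)) [0..<g]) p = lme \<Gamma> n X c0 d0)"
    if "nc_poly_in g p" for p c d c0 d0
    using eval[OF that, of c d c0 d0] realizes_eval[OF b that, of c d c0 d0] by (simp only: ab fst_conv)
  moreover have "length (snd a) = g" "\<forall>P\<in>set (snd a). bounded_op (fst a) P"
    using len lenB bdA by (simp_all add: ab)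
  ultimately show ?thesis unfolding realizes_def by (intro conjI allI impI)
qed

end


section \<open>Matrix inequalities and compressions\<close>

lemma sum_lessThan_add: "(\<Sum>i<a + b. f i) = (\<Sum>i<a. f i) + (\<Sum>i<b. f (a + i))" for f :: "nat \<Rightarrow> 'x :: comm_monoid_add"
  by (induction b) (simp_all add: add.assoc)

text \<open>The perturbation \<open>\<epsilon> n I + F\<close> with entries of \<open>F\<close> bounded by \<open>\<epsilon>\<close> is diagonally dominant:
  it is \<open>\<epsilon>/2\<close> times the sum of the rank-one matrices of \<open>e\<^sub>a + (F\<^sub>a\<^sub>b/\<epsilon>) e\<^sub>b\<close> plus a
  non-negative diagonal.\<close>

lemma diag_dominant_in_cone:
  fixes R :: "(nat \<Rightarrow> nat \<Rightarrow> complex) \<Rightarrow> bool" and F :: "nat \<Rightarrow> nat \<Rightarrow> complex"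
  assumes add: "\<And>A B. R A \<Longrightarrow> R B \<Longrightarrow> R (\<lambda>k l. A k l + B k l)"
    and scl: "\<And>A t. R A \<Longrightarrow> 0 \<le> t \<Longrightarrow> R (\<lambda>k l. complex_of_real t * A k l)"
    and rank1: "\<And>u. R (\<lambda>k l. u l * cnj (u k))"
    and herm: "\<And>k l. k < n \<Longrightarrow> l < n \<Longrightarrow> F l k = cnj (F k l)"
    and eps: "0 < \<epsilon>" and le: "\<And>k l. k < n \<Longrightarrow> l < n \<Longrightarrow> cmod (F k l) \<le> \<epsilon>"
  obtains M where "R M" "\<And>k l. k < n \<Longrightarrow> l < n \<Longrightarrow> M k l = (if k = l then of_real (\<epsilon> * n) else 0) + F k l"
proof -
  have zero: "R (\<lambda>_ _. 0)" using scl[OF rank1[of "\<lambda>_. 0"], of 0] by simp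
  have sum: "R (\<lambda>k l. \<Sum>a\<in>A. B a k l)" if "finite A" "\<And>a. a \<in> A \<Longrightarrow> R (B a)" for A and B :: "'x \<Rightarrow> _"
    using that by (induction A rule: finite_induct) (auto intro: add zero)
  define w where "w a b = F a b / of_real \<epsilon>" for a b
  define \<delta> :: "nat \<Rightarrow> nat \<Rightarrow> complex" where "\<delta> k l = (if k = l then 1 else 0)" for k l
  define u where "u a b l = \<delta> a l + w a b * \<delta> b l" for a b l
  define s where "s b = (\<Sum>a<n. (cmod (w a b))\<^sup>2)" for b
  have cnj_\<delta>: "cnj (\<delta> k l) = \<delta> k l" for k l by (simp add: \<delta>_def)
  have w_herm: "cnj (w l k) = w k l" if "k < n" "l < n" for k l
    using herm[OF that] eps by (simp add: w_def)
  have w_le: "cmod (w k l) \<le> 1" if "k < n" "l < n" for k l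
    using le[OF that] eps by (simp add: w_def norm_divide)
  have s_le: "s b \<le> n" if "b < n" for b
  proof -
    have "s b \<le> (\<Sum>a<n. 1)" unfolding s_def using w_le that by (intro sum_mono) (simp add: power_le_one)
    then show ?thesis by simp
  qed
  \<comment> \<open>What is left of the diagonal entry \<open>\<epsilon> * n\<close> after the
    rank-one terms have contributed \<open>\<epsilon> / 2 * (n + s b)\<close>;
    \<open>s b \<le> n\<close> makes it nonnegative.\<close>
  define t where "t b = \<epsilon> * n - \<epsilon> / 2 * (n + s b)" for b
  have t: "0 \<le> t b" if "b < n" for b
  proof -
    have "\<epsilon> * (n + s b) \<le> \<epsilon> * (n + n)" using s_le[OF that] eps by (intro mult_left_mono) auto
    then show ?thesis by (simp add: t_def algebra_simps)
  qed
  define M where "M k l = complex_of_real (\<epsilon> / 2) * (\<Sum>a<n. \<Sum>b<n. u a b l * cnj (u a b k)) +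
      (\<Sum>b<n. complex_of_real (t b) * (\<delta> b l * cnj (\<delta> b k)))" for k l
  have "R M"
    unfolding M_def using eps t by (intro add scl sum rank1) auto
  moreover have "M k l = (if k = l then of_real (\<epsilon> * n) else 0) + F k l" if "k < n" "l < n" for k l
  proof -
    have sel: "(\<Sum>a<n. \<delta> a j * f a) = f j" if "j < n" for j and f :: "nat \<Rightarrow> complex"
      using that by (simp add: \<delta>_def if_distrib[of "\<lambda>x. x * _"] cong: if_cong)
    have sel1: "(\<Sum>a<n. \<delta> a j) = 1" if "j < n" for j
      using sel[OF that, of "\<lambda>_. 1"] by simp
    have \<delta>\<delta>: "\<delta> b l * \<delta> b k = \<delta> b l * \<delta> k l" for b by (simp add: \<delta>_def)
    \<comment> \<open>Summed over \<open>a\<close> and \<open>b\<close>, the two cross terms give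
      \<open>cnj (w l k) + w k l\<close>, which is \<open>2 * w k l\<close>; the other two
      contribute to the diagonal only.\<close>
    have "u a b l * cnj (u a b k) = \<delta> a l * \<delta> k l + \<delta> a l * (\<delta> b k * cnj (w a b)) + \<delta> a k * (\<delta> b l * w a b)
        + \<delta> b l * (\<delta> k l * of_real ((cmod (w a b))\<^sup>2))" for a b
    proof -
      have "u a b l * cnj (u a b k) = \<delta> a l * \<delta> a k + \<delta> a l * (\<delta> b k * cnj (w a b)) + \<delta> a k * (\<delta> b l * w a b)
        + \<delta> b l * \<delta> b k * (w a b * cnj (w a b))"
        by (simp add: u_def cnj_\<delta> algebra_simps)
      then show ?thesis unfolding \<delta>\<delta> by (simp only: complex_norm_square mult.assoc)
    qed
    then have "(\<Sum>a<n. \<Sum>b<n. u a b l * cnj (u a b k)) =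
        of_nat n * \<delta> k l + cnj (w l k) + w k l + \<delta> k l * of_real (s l)"
      using that by (simp add: sum.distrib sel sel1 sum_distrib_left[symmetric] sum_distrib_right[symmetric] s_def mult.commute)
    also have "\<dots> = 2 * w k l + \<delta> k l * of_real (n + s l)"
      using w_herm[OF that] by (simp add: algebra_simps)
    finally have A: "(\<Sum>a<n. \<Sum>b<n. u a b l * cnj (u a b k)) = 2 * w k l + \<delta> k l * of_real (n + s l)" .
    have B: "(\<Sum>b<n. complex_of_real (t b) * (\<delta> b l * cnj (\<delta> b k))) = \<delta> k l * of_real (t l)"
      using sel[OF that(2), of "\<lambda>b. \<delta> k l * complex_of_real (t b)"]
      unfolding cnj_\<delta> \<delta>\<delta> by (simp only: mult_ac)
    have "complex_of_real (\<epsilon> / 2) * (2 * w k l) = F k l" using eps by (simp add: w_def)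
    then have "M k l = F k l + \<delta> k l * of_real (\<epsilon> / 2 * (n + s l) + t l)"
      unfolding M_def A B distrib_left of_real_add of_real_mult by (simp only: mult_ac add_ac distrib_left)
    moreover have "\<epsilon> / 2 * (n + s l) + t l = \<epsilon> * n" by (simp add: t_def)
    ultimately show ?thesis by (simp only: \<delta>_def) simp
  qed
  ultimately show thesis by (rule that)
qed

text \<open>The \<open>(k, l)\<close> entry of \<open>V\<^sup>* M V\<close>, where \<open>v k\<close> is the \<open>k\<close>-th column of \<open>V\<close>.\<close>

definition qform :: "nat \<Rightarrow> complex mat \<Rightarrow> (nat \<Rightarrow> nat \<Rightarrow> complex) \<Rightarrow> nat \<Rightarrow> nat \<Rightarrow> complex" where
  "qform n M v k l = (\<Sum>i<n. mact n M (v l) i * cnj (v k i))"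

section \<open>Hermitian matrices and their forms\<close>

lemma qform_herm:
  assumes "M \<in> carrier_mat n n" "mat_adjoint M = M"
  shows "qform n M v l k = cnj (qform n M v k l)"
proof -
  have M: "M $$ (j, i) = cnj (M $$ (i, j))" if "i < n" "j < n" for i j
  proof -
    have "M $$ (j, i) = mat_adjoint M $$ (j, i)" using assms(2) by simp
    then show ?thesis using assms(1) that by simp
  qed
  have "qform n M v l k = (\<Sum>i<n. \<Sum>j<n. M $$ (i, j) * v k j * cnj (v l i))"
    by (simp add: qform_def mact_def sum_distrib_right)
  also have "\<dots> = (\<Sum>j<n. \<Sum>i<n. M $$ (i, j) * v k j * cnj (v l i))" by (rule sum.swap)
  also have "\<dots> = (\<Sum>j<n. \<Sum>i<n. cnj (M $$ (j, i) * v l i * cnj (v k j)))"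
  proof (intro sum.cong refl)
    fix i j assume "j \<in> {..<n}" "i \<in> {..<n}"
    then have "cnj (M $$ (j, i)) = M $$ (i, j)" using M[of j i] by simp
    then show "M $$ (i, j) * v k j * cnj (v l i) = cnj (M $$ (j, i) * v l i * cnj (v k j))" by simp
  qed
  also have "\<dots> = cnj (qform n M v k l)" by (simp add: qform_def mact_def sum_distrib_right)
  finally show ?thesis .
qed

lemma qform_herm_real:
  assumes "M \<in> carrier_mat n n" "mat_adjoint M = M"
  shows "Im (qform n M (\<lambda>_. v) 0 0) = 0"
  using arg_cong[OF qform_herm[OF assms, of "\<lambda>_. v" 0 0], of Im] by simp

text \<open>Polarization: unit vectors give a real diagonal, the vector
  \<open>e\<^sub>a + e\<^sub>b\<close> gives opposite imaginary parts at \<open>(a, b)\<close> and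
  \<open>(b, a)\<close>, and \<open>e\<^sub>a + \<i> e\<^sub>b\<close> gives equal real
  parts.\<close>

lemma herm_of_real_qform:
  assumes M: "M \<in> carrier_mat n n" and real: "\<And>v. Im (qform n M (\<lambda>_. v) 0 0) = 0"
  shows "mat_adjoint M = M"
proof (rule eq_matI)
  fix a b assume "a < dim_row M" "b < dim_col M"
  then have ab: "a < n" "b < n" using M by auto
  define \<delta> :: "nat \<Rightarrow> nat \<Rightarrow> complex" where "\<delta> c i = (if i = c then 1 else 0)" for c i
  have cnj_\<delta>: "cnj (\<delta> c i) = \<delta> c i" for c i by (simp add: \<delta>_def)
  have sel: "(\<Sum>i<n. f i * \<delta> c i) = f c" if "c < n" for c and f :: "nat \<Rightarrow> complex"
    using that by (simp add: \<delta>_def if_distrib[of "\<lambda>x. _ * x"] cong: if_cong)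
  have q: "qform n M (\<lambda>_ i. x * \<delta> a i + y * \<delta> b i) 0 0 =
      (x * M $$ (a, a) + y * M $$ (a, b)) * cnj x + (x * M $$ (b, a) + y * M $$ (b, b)) * cnj y" for x y
  proof -
    have "mact n M (\<lambda>i. x * \<delta> a i + y * \<delta> b i) j = (\<Sum>k<n. (M $$ (j, k) * x) * \<delta> a k) + (\<Sum>k<n. (M $$ (j, k) * y) * \<delta> b k)" for j
      unfolding mact_def sum.distrib[symmetric] by (intro sum.cong refl) (simp only: distrib_left mult.assoc)
    then have m: "mact n M (\<lambda>i. x * \<delta> a i + y * \<delta> b i) j = x * M $$ (j, a) + y * M $$ (j, b)" for j
      using ab by (simp only: sel) (simp only: mult.commute)
    have "qform n M (\<lambda>_ i. x * \<delta> a i + y * \<delta> b i) 0 0 =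
        (\<Sum>i<n. ((x * M $$ (i, a) + y * M $$ (i, b)) * cnj x) * \<delta> a i) +
        (\<Sum>i<n. ((x * M $$ (i, a) + y * M $$ (i, b)) * cnj y) * \<delta> b i)"
      unfolding qform_def m sum.distrib[symmetric] complex_cnj_add complex_cnj_mult cnj_\<delta>
      by (intro sum.cong refl) (simp only: distrib_left mult.assoc)
    then show ?thesis using ab by (simp only: sel)
  qed
  have "Im (M $$ (a, a)) = 0" "Im (M $$ (b, b)) = 0"
    using q[of 1 0] q[of 0 1] real[of "\<lambda>i. 1 * \<delta> a i + 0 * \<delta> b i"] real[of "\<lambda>i. 0 * \<delta> a i + 1 * \<delta> b i"]
    by simp_all
  moreover have "Im (M $$ (a, a) + M $$ (a, b) + M $$ (b, a) + M $$ (b, b)) = 0"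
    using q[of 1 1] real[of "\<lambda>i. 1 * \<delta> a i + 1 * \<delta> b i"] by simp
  moreover have "Im (M $$ (a, a) + \<i> * M $$ (a, b) - \<i> * M $$ (b, a) + M $$ (b, b)) = 0"
    using arg_cong[OF q[of 1 \<i>], of Im] real[of "\<lambda>i. 1 * \<delta> a i + \<i> * \<delta> b i"] by (simp add: algebra_simps)
  ultimately show "mat_adjoint M $$ (a, b) = M $$ (a, b)"
    using ab M by (simp add: complex_eq_iff)
qed (use M in auto)

text \<open>The columns \<open>v\<close> and \<open>w\<close> are stacked on top of each other;
  through this, direct sums of points become sums of compressions.\<close>

lemma qform_dsum:
  assumes A: "A \<in> carrier_mat n n" and B: "B \<in> carrier_mat m m"
  shows "qform (n + m) (four_block_mat A (0\<^sub>m n m) (0\<^sub>m m n) B) (\<lambda>k i. if i < n then v k i else w k (i - n)) k l =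
    qform n A v k l + qform m B w k l"
proof -
  let ?M = "four_block_mat A (0\<^sub>m n m) (0\<^sub>m m n) B"
  have "mact (n + m) ?M (\<lambda>i. if i < n then v l i else w l (i - n)) i = mact n A (v l) i" if "i < n" for i
    using that A B unfolding mact_def sum_lessThan_add by simp
  moreover have "mact (n + m) ?M (\<lambda>i. if i < n then v l i else w l (i - n)) (n + i) = mact m B (w l) i"
    if "i < m" for i
    using that A B unfolding mact_def sum_lessThan_add by simp
  ultimately show ?thesis unfolding qform_def sum_lessThan_add by simp
qed

text \<open>Against Hermitian data \<open>q\<close>, averaging \<open>h\<close> with its adjoint
  replaces the pairing by its real part. A real-linear separating functional becomes in this way the
  coefficient array of a matrix inequality.\<close>

lemma herm_pairing:
  fixes h :: "nat \<times> nat \<times> nat \<Rightarrow> complex" and q :: "nat \<Rightarrow> nat \<Rightarrow> nat \<Rightarrow> complex"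
  assumes "\<And>j k l. j \<le> r \<Longrightarrow> k < n \<Longrightarrow> l < n \<Longrightarrow> q j l k = cnj (q j k l)"
  shows "(\<Sum>k<n. \<Sum>l<n. \<Sum>j\<le>r. (cnj (h (j, k, l)) + h (j, l, k)) / 2 * q j k l) =
    of_real (Re (\<Sum>(j, k, l)\<in>{..r} \<times> {..<n} \<times> {..<n}. cnj (h (j, k, l)) * q j k l))"
proof -
  have split: "(\<Sum>(j, k, l)\<in>{..r} \<times> {..<n} \<times> {..<n}. f j k l) = (\<Sum>j\<le>r. \<Sum>k<n. \<Sum>l<n. f j k l)" for f :: "_ \<Rightarrow> _ \<Rightarrow> _ \<Rightarrow> complex"
    by (simp add: sum.cartesian_product[symmetric])
  have half: "(z + cnj z) / 2 = complex_of_real (Re z)" for z by (simp add: complex_add_cnj)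
  let ?s = "\<Sum>j\<le>r. \<Sum>k<n. \<Sum>l<n. cnj (h (j, k, l)) * q j k l"
  have "(\<Sum>k<n. \<Sum>l<n. \<Sum>j\<le>r. (cnj (h (j, k, l)) + h (j, l, k)) / 2 * q j k l) =
      (\<Sum>j\<le>r. \<Sum>k<n. \<Sum>l<n. (cnj (h (j, k, l)) + h (j, l, k)) / 2 * q j k l)"
    by (rule sum3_rotate[symmetric])
  also have "\<dots> = (?s + (\<Sum>j\<le>r. \<Sum>k<n. \<Sum>l<n. h (j, l, k) * q j k l)) / 2"
  proof -
    have *: "(x + y) / 2 * z = (x * z + y * z) / 2" for x y z :: complex by (simp add: distrib_right)
    show ?thesis by (simp only: * sum_divide_distrib[symmetric] sum.distrib)
  qed
  \<comment> \<open>Exchanging the names of \<open>k\<close> and \<open>l\<close> and using that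
    \<open>q\<close> is Hermitian turns the second half into the conjugate of the first.\<close>
  also have "(\<Sum>j\<le>r. \<Sum>k<n. \<Sum>l<n. h (j, l, k) * q j k l) = cnj ?s"
    unfolding cnj_sum
  proof (rule sum.cong[OF refl])
    fix j assume j: "j \<in> {..r}"
    have "(\<Sum>k<n. \<Sum>l<n. h (j, l, k) * q j k l) = (\<Sum>l<n. \<Sum>k<n. h (j, l, k) * q j k l)" by (rule sum.swap)
    also have "\<dots> = (\<Sum>l<n. \<Sum>k<n. cnj (cnj (h (j, l, k)) * q j l k))"
    proof (rule sum.cong[OF refl], rule sum.cong[OF refl])
      fix l k assume "l \<in> {..<n}" "k \<in> {..<n}"
      then have "q j k l = cnj (q j l k)" using assms[of j l k] j by simp
      then show "h (j, l, k) * q j k l = cnj (cnj (h (j, l, k)) * q j l k)"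
        by (simp only: complex_cnj_mult complex_cnj_cnj)
    qed
    finally show "(\<Sum>k<n. \<Sum>l<n. h (j, l, k) * q j k l) = (\<Sum>k<n. \<Sum>l<n. cnj (cnj (h (j, k, l)) * q j k l))" .
  qed
  also have "(?s + cnj ?s) / 2 = of_real (Re ?s)" by (rule half)
  finally show ?thesis by (simp only: split)
qed

section \<open>Uniform bounds and shifts to positive forms\<close>

lemma sqbound_one: "sqbound n (1\<^sub>m n) 1"
  by (simp add: sqbound_def mact_one)

text \<open>Cauchy-Schwarz over the words of \<open>p\<close>, and submultiplicativity along each
  word; the constant depends on \<open>p\<close> and \<open>C\<close> alone, not on the level or the
  tuple.\<close>

lemma sqbound_mat_eval:
  assumes p: "nc_poly_in g p" and "0 \<le> C"
  obtains D where "0 \<le> D"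
    "\<And>n X. X \<in> mtuples g n \<Longrightarrow> \<forall>j<g. sqbound n (X ! j) C \<Longrightarrow> sqbound n (mat_eval n X p) D"
proof -
  let ?W = "Poly_Mapping.keys p" and ?c = "Poly_Mapping.lookup p"
  \<comment> \<open>\<open>card ?W\<close> is the factor of \<open>cmod_sum_square_le\<close>, and
    \<open>C ^ length w\<close> bounds the square of the norm of the word \<open>w\<close>.\<close>
  define D where "D = real (card ?W) * (\<Sum>w\<in>?W. (cmod (?c w))\<^sup>2 * C ^ length w)"
  have "0 \<le> D" unfolding D_def using assms(2) by (intro mult_nonneg_nonneg sum_nonneg) auto
  moreover have "sqbound n (mat_eval n X p) D"
    if X: "X \<in> mtuples g n" and C: "\<forall>j<g. sqbound n (X ! j) C" for n X
    unfolding sqbound_def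
  proof
    fix v :: "nat \<Rightarrow> complex"
    let ?v = "\<Sum>i<n. (cmod (v i))\<^sup>2"
    have word: "sqbound n (mat_word n X w) (C ^ length w)" if "set w \<subseteq> {..<g}" for w
      using that
    proof (induction w)
      case (Cons j w)
      then have j: "j < g" and w: "set w \<subseteq> {..<g}" by auto
      show ?case
        using sqbound_mult[OF mtuples_nth[OF X j] mat_word_carrier[OF X w] C[rule_format, OF j] Cons.IH[OF w] assms(2)]
        by (simp add: mat_word_Cons)
    qed (simp add: sqbound_one)
    have m: "mact n (mat_eval n X p) v i = (\<Sum>w\<in>?W. ?c w * mact n (mat_word n X w) v i)" if "i < n" for i
    proof -
      have "mact n (mat_eval n X p) v i = (\<Sum>k<n. \<Sum>w\<in>?W. ?c w * mat_word n X w $$ (i, k) * v k)"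
        using that by (simp add: mact_def mat_eval_entry[OF X p] sum_distrib_right)
      also have "\<dots> = (\<Sum>w\<in>?W. ?c w * mact n (mat_word n X w) v i)"
        by (subst sum.swap) (simp add: mact_def sum_distrib_left mult.assoc)
      finally show ?thesis .
    qed
    have "(\<Sum>i<n. (cmod (mact n (mat_eval n X p) v i))\<^sup>2) \<le>
        (\<Sum>i<n. real (card ?W) * (\<Sum>w\<in>?W. (cmod (?c w))\<^sup>2 * (cmod (mact n (mat_word n X w) v i))\<^sup>2))"
    proof (rule sum_mono)
      fix i assume "i \<in> {..<n}"
      then show "(cmod (mact n (mat_eval n X p) v i))\<^sup>2 \<le>
          real (card ?W) * (\<Sum>w\<in>?W. (cmod (?c w))\<^sup>2 * (cmod (mact n (mat_word n X w) v i))\<^sup>2)"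
        using cmod_sum_square_le[of ?W "\<lambda>w. ?c w * mact n (mat_word n X w) v i"]
        by (simp only: m lessThan_iff norm_mult power_mult_distrib finite_keys)
    qed
    also have "\<dots> = real (card ?W) * (\<Sum>w\<in>?W. (cmod (?c w))\<^sup>2 * (\<Sum>i<n. (cmod (mact n (mat_word n X w) v i))\<^sup>2))"
      unfolding sum_distrib_left[of "real (card ?W)", symmetric] by (subst sum.swap) (simp add: sum_distrib_left)
    also have "\<dots> \<le> real (card ?W) * (\<Sum>w\<in>?W. (cmod (?c w))\<^sup>2 * (C ^ length w * ?v))"
      using word nc_poly_in_keys[OF p] by (intro mult_left_mono sum_mono) (auto simp: sqbound_def)
    also have "\<dots> = D * ?v" by (simp add: D_def sum_distrib_right mult.assoc)
    finally show "(\<Sum>i<n. (cmod (mact n (mat_eval n X p) v i))\<^sup>2) \<le> D * ?v" .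
  qed
  ultimately show thesis by (rule that)
qed

text \<open>By the inequality of arithmetic and geometric means, the form is at most half of
  \<open>C + 1\<close> times the squared norm of \<open>v\<close> in absolute value; this way the
  norm itself, a square root, never appears.\<close>

lemma qform_shift_nonneg:
  assumes M: "M \<in> carrier_mat n n" "mat_adjoint M = M" and C: "sqbound n M C"
  shows "0 \<le> of_real (C + 1) * (\<Sum>i<n. v i * cnj (v i)) + qform n M (\<lambda>_. v) 0 0"
proof -
  let ?v = "\<Sum>i<n. (cmod (v i))\<^sup>2"
  have "cmod (qform n M (\<lambda>_. v) 0 0) \<le> (\<Sum>i<n. cmod (mact n M v i) * cmod (v i))"
    unfolding qform_def by (rule sum_norm_le) (simp add: norm_mult)
  also have "\<dots> \<le> (\<Sum>i<n. ((cmod (mact n M v i))\<^sup>2 + (cmod (v i))\<^sup>2) / 2)"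
  proof (rule sum_mono)
    fix i
    have "0 \<le> (cmod (mact n M v i) - cmod (v i))\<^sup>2" by simp
    then show "cmod (mact n M v i) * cmod (v i) \<le> ((cmod (mact n M v i))\<^sup>2 + (cmod (v i))\<^sup>2) / 2"
      by (simp add: power2_diff)
  qed
  also have "\<dots> = ((\<Sum>i<n. (cmod (mact n M v i))\<^sup>2) + ?v) / 2"
    by (simp add: sum.distrib flip: sum_divide_distrib)
  also have "\<dots> \<le> (C * ?v + ?v) / 2" using C by (auto simp: sqbound_def)
  finally have "- Re (qform n M (\<lambda>_. v) 0 0) \<le> (C + 1) * ?v / 2"
    using abs_Re_le_cmod[of "qform n M (\<lambda>_. v) 0 0"] by (simp add: algebra_simps)
  \<comment> \<open>\<open>sqbound\<close> forces \<open>C * ?v\<close> to be nonnegative, so a sign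
    for \<open>C\<close> is not presupposed.\<close>
  moreover have "0 \<le> (C + 1) * ?v"
  proof -
    have "0 \<le> (\<Sum>i<n. (cmod (mact n M v i))\<^sup>2)" "0 \<le> ?v" by (auto intro: sum_nonneg)
    moreover have "(\<Sum>i<n. (cmod (mact n M v i))\<^sup>2) \<le> C * ?v" using C by (auto simp: sqbound_def)
    ultimately show ?thesis by (simp add: distrib_right)
  qed
  moreover have "(\<Sum>i<n. v i * cnj (v i)) = of_real ?v" by (simp only: of_real_sum complex_norm_square)
  ultimately show ?thesis using qform_herm_real[OF M, of v] by (simp add: less_eq_complex_def)
qed

section \<open>Forms as entries of compressions\<close>

lemma mat_block_pos_qform:
  "mat_block_pos n m M \<longleftrightarrow> (\<forall>v. 0 \<le> (\<Sum>k<m. \<Sum>l<m. qform n (M k l) v k l))"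
  by (simp add: mat_block_pos_def qform_def)

lemma compress_entry:
  fixes v :: "nat \<Rightarrow> nat \<Rightarrow> complex"
  assumes G: "G \<in> carrier_mat N N" and kl: "k < n" "l < n"
  defines "V \<equiv> mat N n (\<lambda>(i, l). v l i)"
  shows "(mat_adjoint V * G * V) $$ (k, l) = qform N G v k l"
proof -
  have V: "V \<in> carrier_mat N n" "mat_adjoint V \<in> carrier_mat n N"
    using mat_adjoint_carrier[of V N n] by (simp_all add: V_def)
  have "(mat_adjoint V * G * V) $$ (k, l) = (mat_adjoint V * (G * V)) $$ (k, l)"
    using assoc_mult_mat[OF V(2) G V(1)] by simp
  also have "\<dots> = (\<Sum>i<N. mat_adjoint V $$ (k, i) * (G * V) $$ (i, l))"
    using V G kl by (intro mult_entry) auto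
  also have "\<dots> = (\<Sum>i<N. cnj (v k i) * mact N G (v l) i)"
  proof (rule sum.cong[OF refl])
    fix i assume "i \<in> {..<N}"
    then have i: "i < N" by simp
    have "(G * V) $$ (i, l) = mact N G (v l) i"
      using mult_entry[OF G V(1) i kl(2)] kl by (simp add: mact_def V_def)
    moreover have "mat_adjoint V $$ (k, i) = cnj (v k i)" using i kl by (simp add: V_def)
    ultimately show "mat_adjoint V $$ (k, i) * (G * V) $$ (i, l) = cnj (v k i) * mact N G (v l) i" by simp
  qed
  finally show ?thesis by (simp add: qform_def mult.commute)
qed

lemma qform_one: "qform n (1\<^sub>m n) v k l = (\<Sum>i<n. v l i * cnj (v k i))"
  by (simp add: qform_def mact_one)

lemma qform_zero: "qform n (0\<^sub>m n n) v k l = 0"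
  by (simp add: qform_def mact_def)

lemma qform_scale: "qform n M (\<lambda>k i. of_real t * v k i) k l = of_real (t\<^sup>2) * qform n M v k l"
proof -
  have "mact n M (\<lambda>i. of_real t * v l i) i = of_real t * mact n M (v l) i" for i
    by (simp add: mact_def sum_distrib_left mult_ac)
  then show ?thesis by (simp add: qform_def sum_distrib_left power2_eq_square mult_ac)
qed

lemma qform_unit:
  assumes "k < n" "l < n"
  shows "qform n M (\<lambda>k i. if i = k then 1 else 0) k l = M $$ (k, l)"
proof -
  have "mact n M (\<lambda>i. if i = l then 1 else 0) i = M $$ (i, l)" for i
    using assms by (simp add: mact_def if_distrib[of "\<lambda>x. _ * x"] cong: if_cong)
  then show ?thesis
    using assms by (simp add: qform_def if_distrib[of "\<lambda>x. _ * x"] if_distrib[of cnj] cong: if_cong)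
qed

context gamma_tuple
begin

text \<open>Coordinate 0 is the identity and the polynomials are shifted by one, so
  \<open>V\<^sup>* V\<close> and the compressed polynomials form a single tuple.\<close>

definition gmat :: "nat \<Rightarrow> mtuple \<Rightarrow> nat \<Rightarrow> complex mat" where
  "gmat n X j = (case j of 0 \<Rightarrow> 1\<^sub>m n | Suc j \<Rightarrow> mat_eval n X (\<Gamma> ! j))"

lemma gmat_carrier [simp]: "gmat n X j \<in> carrier_mat n n"
  by (simp add: gmat_def split: nat.split)

lemma gmat_herm:
  assumes "X \<in> sa_tuples g n" "j \<le> length \<Gamma>"
  shows "mat_adjoint (gmat n X j) = gmat n X j"
proof (cases j)
  case 0
  have "mat_adjoint (1\<^sub>m n) = (1\<^sub>m n :: complex mat)" by (intro eq_matI) auto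
  then show ?thesis using 0 by (simp add: gmat_def)
next
  case (Suc i)
  then show ?thesis using assms mat_eval_adjoint[OF assms(1) poly_in poly_star] by (simp add: gmat_def)
qed

lemma gmat_dsum:
  assumes "X \<in> mtuples g n" "Y \<in> mtuples g m" "j \<le> length \<Gamma>"
  shows "gmat (n + m) (tuple_dsum n m X Y) j = four_block_mat (gmat n X j) (0\<^sub>m n m) (0\<^sub>m m n) (gmat m Y j)"
proof (cases j)
  case 0
  then show ?thesis by (intro eq_matI) (auto simp: gmat_def)
next
  case (Suc i)
  then show ?thesis using assms mat_eval_dsum[OF assms(1,2) poly_in] by (simp add: gmat_def)
qed

text \<open>A matrix inequality thus becomes a linear condition on the tuple of forms of
  \<open>gmat\<close>, which a separating functional can supply.\<close>

lemma qform_lme: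
  "qform n (lme \<Gamma> n X c d) v k l =
    (\<Sum>j\<le>length \<Gamma>. (case j of 0 \<Rightarrow> c | Suc j \<Rightarrow> d j) * qform n (gmat n X j) v k l)"
proof -
  have "qform n (lme \<Gamma> n X c d) v k l = (\<Sum>i<n. c * (v l i * cnj (v k i)) +
      (\<Sum>j<length \<Gamma>. d j * (mact n (mat_eval n X (\<Gamma> ! j)) (v l) i * cnj (v k i))))"
    unfolding qform_def by (intro sum.cong refl) (simp add: mact_lme distrib_right sum_distrib_right mult.assoc)
  also have "\<dots> = c * qform n (1\<^sub>m n) v k l + (\<Sum>i<n. \<Sum>j<length \<Gamma>. d j * (mact n (mat_eval n X (\<Gamma> ! j)) (v l) i * cnj (v k i)))"
    by (simp add: sum.distrib sum_distrib_left qform_one)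
  also have "(\<Sum>i<n. \<Sum>j<length \<Gamma>. d j * (mact n (mat_eval n X (\<Gamma> ! j)) (v l) i * cnj (v k i))) =
      (\<Sum>j<length \<Gamma>. d j * qform n (mat_eval n X (\<Gamma> ! j)) v k l)"
    by (subst sum.swap) (simp add: qform_def sum_distrib_left)
  finally show ?thesis by (simp add: sum.atMost_shift gmat_def)
qed

text \<open>The one consequence of being the tuple of a \<open>\<Gamma>\<close>-ucp map that the
  separation argument works with; no operator system appears in it.\<close>

definition dominated :: "gset \<Rightarrow> nat \<Rightarrow> mtuple \<Rightarrow> bool" where
  "dominated K n Y \<longleftrightarrow> Y \<in> mtuples g n \<and>
    (\<forall>m c d. (\<forall>N. \<forall>X\<in>K N. mat_block_pos N m (\<lambda>k l. lme \<Gamma> N X (c k l) (d k l))) \<longrightarrow>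
       mat_block_pos n m (\<lambda>k l. lme \<Gamma> n Y (c k l) (d k l)))"

text \<open>On the bounded set \<open>K\<close>, a scalar shift makes
  \<open>\<gamma>\<^sub>j\<close> positive uniformly in all points. The resulting inequality holds
  at \<open>Y\<close>, and positivity there contains that the form of
  \<open>\<gamma>\<^sub>j(Y)\<close> is real.\<close>

lemma dominated_gmat_herm:
  assumes K: "graded g K" "gbounded g K" and Y: "dominated K n Y" and j: "j < length \<Gamma>"
  shows "mat_adjoint (mat_eval n Y (\<Gamma> ! j)) = mat_eval n Y (\<Gamma> ! j)"
proof -
  obtain C where C: "0 \<le> C" "\<And>n X j. X \<in> K n \<Longrightarrow> j < g \<Longrightarrow> sqbound n (X ! j) C"
    by (rule gbounded_sqbound[OF K(2,1)]) (rule that)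
  obtain D where D: "0 \<le> D"
    "\<And>n X. X \<in> mtuples g n \<Longrightarrow> \<forall>j<g. sqbound n (X ! j) C \<Longrightarrow> sqbound n (mat_eval n X (\<Gamma> ! j)) D"
    by (rule sqbound_mat_eval[OF poly_in[OF j] C(1)]) (rule that)
  \<comment> \<open>The shift of \<open>qform_shift_nonneg\<close>, with \<open>D\<close> a squared
    norm bound for \<open>\<gamma>\<^sub>j\<close> on all of \<open>K\<close>.\<close>
  let ?c = "complex_of_real (D + 1)" and ?d = "\<lambda>l. if l = j then 1 else 0 :: complex"
  have val: "qform n (lme \<Gamma> n X ?c ?d) v 0 0 =
      ?c * (\<Sum>i<n. v 0 i * cnj (v 0 i)) + qform n (mat_eval n X (\<Gamma> ! j)) (\<lambda>_. v 0) 0 0" for n X v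
  proof -
    have "qform n (lme \<Gamma> n X ?c ?d) v 0 0 =
        ?c * qform n (1\<^sub>m n) v 0 0 + (\<Sum>l<length \<Gamma>. ?d l * qform n (mat_eval n X (\<Gamma> ! l)) v 0 0)"
      by (simp add: qform_lme sum.atMost_shift gmat_def)
    also have "(\<Sum>l<length \<Gamma>. ?d l * qform n (mat_eval n X (\<Gamma> ! l)) v 0 0) = qform n (mat_eval n X (\<Gamma> ! j)) v 0 0"
      using j by (simp add: if_distrib[of "\<lambda>x. x * _"] cong: if_cong)
    finally show ?thesis by (simp add: qform_one) (simp add: qform_def)
  qed
  have pos: "mat_block_pos N 1 (\<lambda>k l. lme \<Gamma> N X ?c ?d)" if X: "X \<in> K N" for N X
    unfolding mat_block_pos_qform
  proof
    fix v :: "nat \<Rightarrow> nat \<Rightarrow> complex"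
    note Xs = graded_tuples(1)[where K = K, OF K(1) X]
    note Xm = sa_tuples_mtuples[OF Xs]
    have "sqbound N (mat_eval N X (\<Gamma> ! j)) D" using D(2)[OF Xm] C(2)[OF X] by blast
    then have "0 \<le> ?c * (\<Sum>i<N. v 0 i * cnj (v 0 i)) + qform N (mat_eval N X (\<Gamma> ! j)) (\<lambda>_. v 0) 0 0"
      by (intro qform_shift_nonneg mat_eval_carrier mat_eval_adjoint[OF Xs poly_in[OF j] poly_star[OF j]])
    then show "0 \<le> (\<Sum>k<1. \<Sum>l<1. qform N (lme \<Gamma> N X ?c ?d) v k l)" using val[of N X v] by simp
  qed
  have "mat_block_pos n 1 (\<lambda>k l. lme \<Gamma> n Y ?c ?d)"
    by (rule Y[unfolded dominated_def, THEN conjunct2, rule_format, of 1 "\<lambda>_ _. ?c" "\<lambda>_ _. ?d"]) (rule pos)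
  then have nn: "0 \<le> qform n (lme \<Gamma> n Y ?c ?d) v 0 0" for v
    by (simp add: mat_block_pos_qform)
  show ?thesis
  proof (rule herm_of_real_qform)
    fix v :: "nat \<Rightarrow> complex"
    have "(\<Sum>i<n. v i * cnj (v i)) = of_real (\<Sum>i<n. (cmod (v i))\<^sup>2)" by (simp only: of_real_sum complex_norm_square)
    then have "Im (?c * (\<Sum>i<n. v i * cnj (v i))) = 0" by simp
    then show "Im (qform n (mat_eval n Y (\<Gamma> ! j)) (\<lambda>_. v) 0 0) = 0"
      using nn[of "\<lambda>_. v"] unfolding val less_eq_complex_def plus_complex.sel zero_complex.sel by linarith
  qed simp
qed

lemma dominated_sa:
  assumes K: "graded g K" "gbounded g K" and Y: "dominated K n Y"
  shows "Y \<in> sa_tuples g n"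
proof -
  have Ym: "Y \<in> mtuples g n" using Y by (simp add: dominated_def)
  have "mat_adjoint (Y ! j) = Y ! j" if "j < g" for j
    using dominated_gmat_herm[OF K Y, of j] mat_eval_gen[OF Ym that] that g_le by simp
  then show ?thesis using Ym by (auto simp: sa_tuples_def mtuples_def in_set_conv_nth)
qed

text \<open>The convex cone of the tuples \<open>(V\<^sup>* V, V\<^sup>* \<gamma>\<^sub>1(X) V, \<dots>, V\<^sup>* \<gamma>\<^sub>r(X) V)\<close> with \<open>X\<close> in \<open>K\<close>.\<close>

definition attains :: "gset \<Rightarrow> (nat \<Rightarrow> nat \<Rightarrow> nat \<Rightarrow> complex) \<Rightarrow> bool" where
  "attains K q \<longleftrightarrow> (\<exists>N X v. X \<in> K N \<and> (\<forall>j\<le>length \<Gamma>. \<forall>k l. q j k l = qform N (gmat N X j) v k l))"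

lemma attainsI:
  "X \<in> K N \<Longrightarrow> (\<And>j k l. j \<le> length \<Gamma> \<Longrightarrow> q j k l = qform N (gmat N X j) v k l) \<Longrightarrow> attains K q"
  unfolding attains_def by (intro exI[of _ N] exI[of _ X] exI[of _ v]) simp

text \<open>Freeness enters here: the sum is attained at the direct sum of the two points, with
  stacked columns.\<close>

lemma attains_add:
  assumes K: "free_set g K" and "attains K q" "attains K q'"
  shows "attains K (\<lambda>j k l. q j k l + q' j k l)"
proof -
  have gr: "graded g K" using K by (simp add: free_set_def)
  obtain N X v where X: "X \<in> K N" and q: "\<forall>j\<le>length \<Gamma>. \<forall>k l. q j k l = qform N (gmat N X j) v k l"
    using assms(2) unfolding attains_def by (elim exE conjE) (rule that)
  obtain N' X' v' where X': "X' \<in> K N'" and q': "\<forall>j\<le>length \<Gamma>. \<forall>k l. q' j k l = qform N' (gmat N' X' j) v' k l"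
    using assms(3) unfolding attains_def by (elim exE conjE) (rule that)
  have Xm: "X \<in> mtuples g N" "X' \<in> mtuples g N'"
    using graded_tuples(1)[where K = K, OF gr X] graded_tuples(1)[where K = K, OF gr X']
    by (auto intro: sa_tuples_mtuples)
  show ?thesis
  proof (rule attainsI)
    show "tuple_dsum N N' X X' \<in> K (N + N')" using K X X' by (simp add: free_set_def)
    fix j k l assume "j \<le> length \<Gamma>"
    then show "q j k l + q' j k l = qform (N + N') (gmat (N + N') (tuple_dsum N N' X X') j)
        (\<lambda>k i. if i < N then v k i else v' k (i - N)) k l"
      unfolding gmat_dsum[OF Xm \<open>j \<le> length \<Gamma>\<close>] qform_dsum[OF gmat_carrier gmat_carrier] using q q' by simp
  qed
qed

lemma attains_scale:
  assumes "attains K q" "0 \<le> t"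
  shows "attains K (\<lambda>j k l. complex_of_real t * q j k l)"
proof -
  obtain N X v where X: "X \<in> K N" and q: "\<forall>j\<le>length \<Gamma>. \<forall>k l. q j k l = qform N (gmat N X j) v k l"
    using assms(1) unfolding attains_def by (elim exE conjE) (rule that)
  show ?thesis
  proof (rule attainsI[where K = K and N = N and X = X, OF X])
    fix j k l assume "j \<le> length \<Gamma>"
    \<comment> \<open>Forms are quadratic in the columns, hence the square root.\<close>
    then show "complex_of_real t * q j k l = qform N (gmat N X j) (\<lambda>k i. of_real (sqrt t) * v k i) k l"
      unfolding qform_scale using q assms(2) by simp
  qed
qed

text \<open>A functional separating \<open>(I, \<gamma>\<^sub>1(Y), \<dots>, \<gamma>\<^sub>r(Y))\<close> from the cone, made Hermitian, is the
  coefficient array of a matrix inequality that holds on \<open>K\<close> and fails at \<open>Y\<close>.\<close>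

lemma dominated_approx:
  assumes K: "free_set g K" "gbounded g K" "replicate g (0\<^sub>m 1 1) \<in> K 1"
    and Y: "dominated K n Y" and n: "0 < n" and eps: "0 < \<epsilon>"
  obtains N X v where "X \<in> K N"
    and "\<And>j k l. j \<le> length \<Gamma> \<Longrightarrow> k < n \<Longrightarrow> l < n \<Longrightarrow> cmod (qform N (gmat N X j) v k l - gmat n Y j $$ (k, l)) \<le> \<epsilon>"
proof -
  have gr: "graded g K" using K(1) by (simp add: free_set_def)
  let ?r = "length \<Gamma>"
  let ?I = "{..?r} \<times> {..<n} \<times> {..<n}"
  define p where "p = (\<lambda>(j, k, l). gmat n Y j $$ (k, l))"
  \<comment> \<open>\<open>attains\<close> provides a column for every natural number; the sums over
    \<open>?I\<close> read the first \<open>n\<close> of them.\<close>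
  define Q where "Q = {q. attains K (\<lambda>j k l. q (j, k, l))}"
  have QI: "q \<in> Q" if "X \<in> K N" "\<And>j k l. j \<le> ?r \<Longrightarrow> q (j, k, l) = qform N (gmat N X j) v k l" for q N X v
    unfolding Q_def mem_Collect_eq by (rule attainsI[where K = K and N = N and X = X, OF that])
  have "\<exists>q\<in>Q. (\<Sum>i\<in>?I. (cmod (q i - p i))\<^sup>2) < \<epsilon>\<^sup>2"
  proof (rule ccontr)
    assume "\<not> ?thesis"
    then have gap: "\<epsilon>\<^sup>2 \<le> (\<Sum>i\<in>?I. (cmod (q i - p i))\<^sup>2)" if "q \<in> Q" for q using that by force
    have ne: "(\<lambda>(j, k, l). qform 1 (gmat 1 (replicate g (0\<^sub>m 1 1)) j) (\<lambda>_ _. 0) k l) \<in> Q"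
      by (rule QI[OF K(3)]) simp
    have add: "(\<lambda>i. q i + q' i) \<in> Q" if "q \<in> Q" "q' \<in> Q" for q q'
      using attains_add[OF K(1)] that by (simp add: Q_def)
    have scl: "(\<lambda>i. complex_of_real t * q i) \<in> Q" if "q \<in> Q" "0 \<le> t" for q t
      using attains_scale that by (simp add: Q_def)
    have fin: "finite ?I" and neQ: "Q \<noteq> {}" and eps2: "0 < \<epsilon>\<^sup>2" using ne eps by auto
    obtain h :: "nat \<times> nat \<times> nat \<Rightarrow> complex" where h: "\<And>q. q \<in> Q \<Longrightarrow> 0 \<le> Re (\<Sum>i\<in>?I. cnj (h i) * q i)" and hp: "Re (\<Sum>i\<in>?I. cnj (h i) * p i) < 0"
      by (rule cone_separation[OF fin neQ add scl eps2 gap]) (assumption | rule that)+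
    \<comment> \<open>The Hermitian part of \<open>h\<close>: with it the block form on
      \<open>K\<close> equals the real part of the pairing with \<open>h\<close>, as
      \<open>pair\<close> states.\<close>
    define H where "H j k l = (cnj (h (j, k, l)) + h (j, l, k)) / 2" for j k l
    have pair: "(\<Sum>k<n. \<Sum>l<n. qform N (lme \<Gamma> N X (H 0 k l) (\<lambda>j. H (Suc j) k l)) v k l) =
        of_real (Re (\<Sum>(j, k, l)\<in>?I. cnj (h (j, k, l)) * qform N (gmat N X j) v k l))"
      if herm: "\<And>j. j \<le> ?r \<Longrightarrow> mat_adjoint (gmat N X j) = gmat N X j" for N X v
    proof -
      have case_H: "(case j of 0 \<Rightarrow> H 0 k l | Suc j \<Rightarrow> H (Suc j) k l) = H j k l" for j k l by (cases j) auto
      show ?thesis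
        unfolding qform_lme case_H unfolding H_def
        by (rule herm_pairing) (rule qform_herm[OF gmat_carrier herm])
    qed
    have pos: "mat_block_pos N n (\<lambda>k l. lme \<Gamma> N X (H 0 k l) (\<lambda>j. H (Suc j) k l))" if X: "X \<in> K N" for N X
      unfolding mat_block_pos_qform
    proof
      fix v
      have "(\<lambda>(j, k, l). qform N (gmat N X j) v k l) \<in> Q" by (rule QI[OF X]) simp
      from h[OF this] have "0 \<le> Re (\<Sum>(j, k, l)\<in>?I. cnj (h (j, k, l)) * qform N (gmat N X j) v k l)"
        by (simp add: case_prod_beta)
      moreover have "mat_adjoint (gmat N X j) = gmat N X j" if "j \<le> ?r" for j
        by (rule gmat_herm[OF graded_tuples(1)[where K = K, OF gr X] that])
      ultimately show "0 \<le> (\<Sum>k<n. \<Sum>l<n. qform N (lme \<Gamma> N X (H 0 k l) (\<lambda>j. H (Suc j) k l)) v k l)"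
        using pair[of N X v] by (simp only: less_eq_complex_def Re_complex_of_real Im_complex_of_real zero_complex.sel)
    qed
    have "mat_block_pos n n (\<lambda>k l. lme \<Gamma> n Y (H 0 k l) (\<lambda>j. H (Suc j) k l))"
      by (rule Y[unfolded dominated_def, THEN conjunct2, rule_format, of n "\<lambda>k l. H 0 k l" "\<lambda>k l j. H (Suc j) k l"])
        (rule pos)
    \<comment> \<open>The unit vectors as columns turn the forms into the entries of
      \<open>gmat n Y j\<close>, so the inequality at \<open>Y\<close> becomes the pairing of
      \<open>h\<close> with \<open>p\<close>, which is negative.\<close>
    then have "0 \<le> (\<Sum>k<n. \<Sum>l<n. qform n (lme \<Gamma> n Y (H 0 k l) (\<lambda>j. H (Suc j) k l)) (\<lambda>k i. if i = k then 1 else 0) k l)"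
      unfolding mat_block_pos_qform by (rule spec)
    also have "\<dots> = of_real (Re (\<Sum>(j, k, l)\<in>?I. cnj (h (j, k, l)) * qform n (gmat n Y j) (\<lambda>k i. if i = k then 1 else 0) k l))"
      by (rule pair, rule gmat_herm[OF dominated_sa[OF gr K(2) Y]])
    also have "(\<Sum>(j, k, l)\<in>?I. cnj (h (j, k, l)) * qform n (gmat n Y j) (\<lambda>k i. if i = k then 1 else 0) k l) =
        (\<Sum>i\<in>?I. cnj (h i) * p i)"
      by (rule sum.cong[OF refl]) (auto simp: p_def qform_unit)
    finally show False using hp by (simp add: less_eq_complex_def)
  qed
  then obtain q where "q \<in> Q" and close: "(\<Sum>i\<in>?I. (cmod (q i - p i))\<^sup>2) < \<epsilon>\<^sup>2" by blast
  then obtain N X v where X: "X \<in> K N" and q: "\<forall>j\<le>?r. \<forall>k l. q (j, k, l) = qform N (gmat N X j) v k l"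
    unfolding Q_def attains_def mem_Collect_eq by (elim exE conjE) (rule that)
  show thesis
  proof (rule that[OF X])
    fix j k l assume jkl: "j \<le> ?r" "k < n" "l < n"
    have "(cmod (q (j, k, l) - p (j, k, l)))\<^sup>2 \<le> (\<Sum>i\<in>?I. (cmod (q i - p i))\<^sup>2)"
      by (rule member_le_sum[of "(j, k, l)" ?I "\<lambda>i. (cmod (q i - p i))\<^sup>2"]) (use jkl in auto)
    then have "(cmod (q (j, k, l) - p (j, k, l)))\<^sup>2 \<le> \<epsilon>\<^sup>2" using close by linarith
    then have "cmod (q (j, k, l) - p (j, k, l)) \<le> \<epsilon>" by (rule power2_le_imp_le) (use eps in simp)
    then show "cmod (qform N (gmat N X j) v k l - gmat n Y j $$ (k, l)) \<le> \<epsilon>" using q jkl by (simp add: p_def)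
  qed
qed

text \<open>Since \<open>0 \<in> K\<close> and \<open>\<Gamma>(0) = 0\<close>, the cone contains \<open>(u u\<^sup>*, 0, \<dots>, 0)\<close> for every \<open>u\<close>, hence also
  the correction that turns \<open>V\<^sup>* V \<approx> I\<close> into an equality.\<close>

lemma dominated_approx_isometric:
  assumes K: "free_set g K" "gbounded g K" and zero_mem: "replicate g (0\<^sub>m 1 1) \<in> K 1"
    and Y: "dominated K n Y" and n: "0 < n" and e: "0 < e"
  obtains N X v where "X \<in> K N" "\<And>k l. k < n \<Longrightarrow> l < n \<Longrightarrow> qform N (1\<^sub>m N) v k l = (if k = l then 1 else 0)"
    and "\<And>j k l. j < length \<Gamma> \<Longrightarrow> k < n \<Longrightarrow> l < n \<Longrightarrow>
      cmod (qform N (mat_eval N X (\<Gamma> ! j)) v k l - mat_eval n Y (\<Gamma> ! j) $$ (k, l)) \<le> e"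
proof -
  let ?r = "length \<Gamma>"
  have gr: "graded g K" using K(1) by (simp add: free_set_def)
  define B where "B = (\<Sum>j<?r. \<Sum>k<n. \<Sum>l<n. cmod (mat_eval n Y (\<Gamma> ! j) $$ (k, l)))"
  have B: "cmod (mat_eval n Y (\<Gamma> ! j) $$ (k, l)) \<le> B" if "j < ?r" "k < n" "l < n" for j k l
  proof -
    have "cmod (mat_eval n Y (\<Gamma> ! j) $$ (k, l)) \<le> (\<Sum>l<n. cmod (mat_eval n Y (\<Gamma> ! j) $$ (k, l)))"
      by (rule member_le_sum[of l "{..<n}" "\<lambda>l. cmod (mat_eval n Y (\<Gamma> ! j) $$ (k, l))"]) (use that in auto)
    also have "\<dots> \<le> (\<Sum>k<n. \<Sum>l<n. cmod (mat_eval n Y (\<Gamma> ! j) $$ (k, l)))"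
      by (rule member_le_sum[of k "{..<n}" "\<lambda>k. \<Sum>l<n. cmod (mat_eval n Y (\<Gamma> ! j) $$ (k, l))"])
        (use that in \<open>auto intro!: sum_nonneg\<close>)
    also have "\<dots> \<le> B" unfolding B_def
      by (rule member_le_sum[of j "{..<?r}" "\<lambda>j. \<Sum>k<n. \<Sum>l<n. cmod (mat_eval n Y (\<Gamma> ! j) $$ (k, l))"])
        (use that in \<open>auto intro!: sum_nonneg\<close>)
    finally show ?thesis .
  qed
  have "0 \<le> B" unfolding B_def by (auto intro!: sum_nonneg)
  \<comment> \<open>The final error is at most \<open>\<epsilon> + \<epsilon> * n * B\<close>: the
    approximation error, and the effect on entries of size at most \<open>B\<close> of scaling by
    \<open>1 - \<epsilon> * n\<close>. This is at most \<open>\<epsilon> * s\<close>.\<close>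
  define s where "s = 1 + n * (B + 1)"
  have s: "0 < s" using \<open>0 \<le> B\<close> by (simp add: s_def add_pos_nonneg)
  \<comment> \<open>The bound \<open>1 / n\<close> keeps the scaling factor
    \<open>1 - \<epsilon> * n\<close> nonnegative, and \<open>e / s\<close> meets the error
    budget.\<close>
  define \<epsilon> where "\<epsilon> = min (1 / n) (e / s)"
  have eps: "0 < \<epsilon>" "\<epsilon> * n \<le> 1" "\<epsilon> * s \<le> e"
    using n e s by (auto simp: \<epsilon>_def min_def field_simps)
  have "\<epsilon> * 1 \<le> \<epsilon> * n" using eps(1) n by (intro mult_left_mono) auto
  then have "\<epsilon> \<le> 1" using eps(2) by simp
  obtain N X v where X: "X \<in> K N"
    and close: "\<And>j k l. j \<le> ?r \<Longrightarrow> k < n \<Longrightarrow> l < n \<Longrightarrow> cmod (qform N (gmat N X j) v k l - gmat n Y j $$ (k, l)) \<le> \<epsilon>"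
    by (rule dominated_approx[OF K zero_mem Y n eps(1)]) (rule that)
  let ?q = "\<lambda>j k l. qform N (gmat N X j) v k l"
  define \<delta> where "\<delta> k l = (if k = l then 1 else 0 :: complex)" for k l :: nat
  \<comment> \<open>After scaling by \<open>1 - \<epsilon> * n\<close>, the identity coordinate
    falls short of the identity by \<open>\<epsilon> * n\<close> on the diagonal plus
    \<open>F\<close>. Scaling reserves the diagonal part, which makes the correction diagonally
    dominant.\<close>
  define F where "F k l = of_real (1 - \<epsilon> * n) * (\<delta> k l - ?q 0 k l)" for k l
  define R where "R A \<longleftrightarrow> attains K (\<lambda>j k l. if j = 0 then A k l else 0)" for A
  have zero_gmat: "gmat 1 (replicate g (0\<^sub>m 1 1)) j = (if j = 0 then 1\<^sub>m 1 else 0\<^sub>m 1 1)" if "j \<le> ?r" for j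
    using that zero by (cases j) (simp_all add: gmat_def)
  obtain M where M: "R M" "\<And>k l. k < n \<Longrightarrow> l < n \<Longrightarrow> M k l = (if k = l then of_real (\<epsilon> * n) else 0) + F k l"
  proof (rule diag_dominant_in_cone[where n = n and \<epsilon> = \<epsilon> and F = F and R = R])
    show "R (\<lambda>k l. A k l + A' k l)" if "R A" "R A'" for A A'
    proof -
      have "attains K (\<lambda>j k l. (if j = 0 then A k l else 0) + (if j = 0 then A' k l else 0))"
        using attains_add[OF K(1)] that unfolding R_def .
      moreover have "(\<lambda>j k l. (if j = 0 then A k l else 0) + (if j = 0 then A' k l else 0)) =
          (\<lambda>j k l. if j = (0 :: nat) then A k l + A' k l else 0)" by (simp add: fun_eq_iff)
      ultimately show ?thesis by (simp only: R_def)
    qed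
    show "R (\<lambda>k l. complex_of_real t * A k l)" if "R A" "0 \<le> t" for A t
    proof -
      have "attains K (\<lambda>j k l. of_real t * (if j = 0 then A k l else 0))"
        using attains_scale that unfolding R_def .
      moreover have "(\<lambda>j k l. of_real t * (if j = 0 then A k l else 0)) =
          (\<lambda>j k l. if j = (0 :: nat) then of_real t * A k l else 0)" by (simp add: fun_eq_iff)
      ultimately show ?thesis by (simp only: R_def)
    qed
    show "R (\<lambda>k l. u l * cnj (u k))" for u
      unfolding R_def
      by (rule attainsI[where K = K and N = 1 and X = "replicate g (0\<^sub>m 1 1)" and v = "\<lambda>k _. u k", OF zero_mem])
        (auto simp only: zero_gmat qform_one qform_zero split: if_split, simp)
    show "F l k = cnj (F k l)" if "k < n" "l < n" for k l
    proof -
      have "?q 0 l k = cnj (?q 0 k l)"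
        by (rule qform_herm[OF gmat_carrier gmat_herm[OF graded_tuples(1)[where K = K, OF gr X]]]) simp
      then show ?thesis by (simp add: F_def \<delta>_def)
    qed
    show "0 < \<epsilon>" by (rule eps(1))
    show "cmod (F k l) \<le> \<epsilon>" if "k < n" "l < n" for k l
    proof -
      have "cmod (F k l) = \<bar>1 - \<epsilon> * n\<bar> * cmod (?q 0 k l - gmat n Y 0 $$ (k, l))"
        using that unfolding F_def norm_mult norm_of_real by (simp add: gmat_def \<delta>_def norm_minus_commute)
      also have "\<dots> \<le> 1 * \<epsilon>" using eps close[OF _ that, of 0] by (intro mult_mono) auto
      finally show ?thesis by simp
    qed
  qed (rule that)
  have "attains K (\<lambda>j k l. of_real (1 - \<epsilon> * n) * ?q j k l + (if j = 0 then M k l else 0))"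
  proof (rule attains_add[OF K(1) attains_scale])
    show "attains K ?q" by (rule attainsI[where K = K and N = N and X = X, OF X]) simp
    show "attains K (\<lambda>j k l. if j = 0 then M k l else 0)" using M(1) by (simp only: R_def)
  qed (use eps(2) in simp)
  then obtain N' X' v' where X': "X' \<in> K N'" and q': "\<forall>j\<le>?r. \<forall>k l.
      of_real (1 - \<epsilon> * n) * ?q j k l + (if j = 0 then M k l else 0) = qform N' (gmat N' X' j) v' k l"
    unfolding attains_def by (elim exE conjE) (rule that)
  show thesis
  proof (rule that[OF X'])
    fix k l assume kl: "k < n" "l < n"
    have "qform N' (1\<^sub>m N') v' k l = of_real (1 - \<epsilon> * n) * ?q 0 k l + M k l"
      using q'[rule_format, of 0 k l] by (simp add: gmat_def)
    then show "qform N' (1\<^sub>m N') v' k l = (if k = l then 1 else 0)"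
      unfolding M(2)[OF kl] F_def \<delta>_def by (cases "k = l") (simp_all add: algebra_simps)
  next
    fix j k l assume j: "j < ?r" and kl: "k < n" "l < n"
    let ?z = "mat_eval n Y (\<Gamma> ! j) $$ (k, l)" and ?p = "?q (Suc j) k l"
    have "qform N' (mat_eval N' X' (\<Gamma> ! j)) v' k l = of_real (1 - \<epsilon> * n) * ?p"
      using q'[rule_format, of "Suc j" k l] j by (simp add: gmat_def)
    \<comment> \<open>The correction is attained at the point 0, where all polynomials vanish, so it
      leaves these coordinates alone; only the scaling changes them.\<close>
    then have "qform N' (mat_eval N' X' (\<Gamma> ! j)) v' k l - ?z = of_real (1 - \<epsilon> * n) * (?p - ?z) - of_real (\<epsilon> * n) * ?z"
      by (simp add: algebra_simps)
    then have "cmod (qform N' (mat_eval N' X' (\<Gamma> ! j)) v' k l - ?z) \<le>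
        cmod (of_real (1 - \<epsilon> * n) * (?p - ?z)) + cmod (of_real (\<epsilon> * n) * ?z)"
      by (simp only: norm_triangle_ineq4)
    also have "\<dots> \<le> 1 * \<epsilon> + (\<epsilon> * n) * B"
    proof (rule add_mono)
      have "cmod (?p - ?z) \<le> \<epsilon>" using close[of "Suc j" k l] j kl by (simp add: gmat_def)
      then show "cmod (of_real (1 - \<epsilon> * n) * (?p - ?z)) \<le> 1 * \<epsilon>"
        unfolding norm_mult norm_of_real using eps by (intro mult_mono) auto
      show "cmod (of_real (\<epsilon> * n) * ?z) \<le> (\<epsilon> * n) * B"
        unfolding norm_mult norm_of_real using eps B[OF j kl] by (intro mult_mono) auto
    qed
    also have "\<dots> \<le> \<epsilon> * s" using eps n \<open>0 \<le> B\<close> by (simp add: s_def algebra_simps)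
    finally show "cmod (qform N' (mat_eval N' X' (\<Gamma> ! j)) v' k l - ?z) \<le> e" using eps(3) by linarith
  qed
qed

end


section \<open>Finite-dimensional \<open>\<Gamma>\<close>-ucp maps\<close>

lemma isometry_of_qform:
  fixes v :: "nat \<Rightarrow> nat \<Rightarrow> complex"
  assumes "\<And>k l. k < n \<Longrightarrow> l < n \<Longrightarrow> qform N (1\<^sub>m N) v k l = (if k = l then 1 else 0)"
  shows "isometry N n (mat N n (\<lambda>(i, l). v l i))"
proof -
  let ?V = "mat N n (\<lambda>(i, l). v l i)"
  have V: "?V \<in> carrier_mat N n" by simp
  note V' = mat_adjoint_carrier[OF V]
  have "mat_adjoint ?V * 1\<^sub>m N * ?V = 1\<^sub>m n"
  proof (rule eq_matI)
    fix k l assume "k < dim_row (1\<^sub>m n :: complex mat)" "l < dim_col (1\<^sub>m n :: complex mat)"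
    then have kl: "k < n" "l < n" by simp_all
    show "(mat_adjoint ?V * 1\<^sub>m N * ?V) $$ (k, l) = (1\<^sub>m n :: complex mat) $$ (k, l)"
      unfolding compress_entry[where v = v, OF one_carrier_mat kl] using assms[OF kl] kl by simp
  qed simp_all
  then have "mat_adjoint ?V * ?V = 1\<^sub>m n" unfolding right_mult_one_mat[OF V'] .
  then show ?thesis using V by (simp add: isometry_def)
qed

context gamma_tuple
begin

lemma dominated_mem:
  assumes obj: "Conv_obj g \<Gamma> K" and Y: "dominated K n Y" and n: "0 < n"
  shows "Y \<in> K n"
proof -
  let ?r = "length \<Gamma>"
  have K: "free_set g K" "gbounded g K" and zero_mem: "replicate g (0\<^sub>m 1 1) \<in> K 1"
    and pre: "K = Gam_preimage g \<Gamma> (gclosure ?r (matco ?r (Gam_image \<Gamma> K)))"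
    using obj unfolding Conv_obj_def Gamma_convex_def by blast+
  have gr: "graded g K" using K(1) by (simp add: free_set_def)
  note Ysa = dominated_sa[OF gr K(2) Y]
  have GY: "Gam \<Gamma> n Y ! j = mat_eval n Y (\<Gamma> ! j)" if "j < ?r" for j
    using that by (simp add: Gam_def)
  have ex: "\<exists>y\<in>matco ?r (Gam_image \<Gamma> K) n. \<forall>j<?r. \<forall>k<n. \<forall>l<n.
      cmod (y ! j $$ (k, l) - Gam \<Gamma> n Y ! j $$ (k, l)) \<le> 1 / real (Suc t)" for t
  proof -
    have e: "0 < 1 / real (Suc t)" by simp
    obtain N X v where X: "X \<in> K N"
      and one: "\<And>k l. k < n \<Longrightarrow> l < n \<Longrightarrow> qform N (1\<^sub>m N) v k l = (if k = l then 1 else 0)"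
      and close: "\<And>j k l. j < ?r \<Longrightarrow> k < n \<Longrightarrow> l < n \<Longrightarrow>
        cmod (qform N (mat_eval N X (\<Gamma> ! j)) v k l - mat_eval n Y (\<Gamma> ! j) $$ (k, l)) \<le> 1 / real (Suc t)"
      by (rule dominated_approx_isometric[OF K zero_mem Y n e]) (rule that)
    let ?V = "mat N n (\<lambda>(i, l). v l i)"
    have iso: "isometry N n ?V" by (rule isometry_of_qform) (rule one)
    \<comment> \<open>\<open>matco\<close> is an intersection, so membership is tested in an
      arbitrary matrix convex set containing the image of \<open>K\<close>.\<close>
    have "compress ?V (Gam \<Gamma> N X) \<in> M n"
      if M: "matrix_convex ?r M" "\<forall>k. Gam_image \<Gamma> K k \<subseteq> M k" for M
    proof -
      have "Gam \<Gamma> N X \<in> Gam_image \<Gamma> K N" using X unfolding Gam_image_def by (rule imageI)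
      then have "Gam \<Gamma> N X \<in> M N" by (rule subsetD[OF spec[OF M(2)]])
      then have "0 < n \<and> Gam \<Gamma> N X \<in> M N \<and> isometry N n ?V" using n iso by (intro conjI)
      then show ?thesis
        by (rule mp[OF conjunct2[OF M(1)[unfolded matrix_convex_def], THEN spec[of _ N], THEN spec[of _ n],
                THEN spec[of _ "Gam \<Gamma> N X"], THEN spec[of _ ?V]]])
    qed
    then have "compress ?V (Gam \<Gamma> N X) \<in> matco ?r (Gam_image \<Gamma> K) n"
      unfolding matco_def by (intro InterI) (elim CollectE exE conjE, simp)
    moreover have "cmod (compress ?V (Gam \<Gamma> N X) ! j $$ (k, l) - Gam \<Gamma> n Y ! j $$ (k, l)) \<le> 1 / real (Suc t)"
      if "j < ?r" "k < n" "l < n" for j k l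
    proof -
      have "compress ?V (Gam \<Gamma> N X) ! j $$ (k, l) = qform N (mat_eval N X (\<Gamma> ! j)) v k l"
        using that(1) compress_entry[where G = "mat_eval N X (\<Gamma> ! j)" and v = v, OF mat_eval_carrier that(2,3)]
        by (simp only: compress_def Gam_def nth_map length_map)
      then show ?thesis using close[OF that] GY[OF that(1)] by (simp only:)
    qed
    ultimately show ?thesis by (intro bexI[of _ "compress ?V (Gam \<Gamma> N X)"] allI impI)
  qed
  have "\<exists>y. \<forall>t. y t \<in> matco ?r (Gam_image \<Gamma> K) n \<and> (\<forall>j<?r. \<forall>k<n. \<forall>l<n.
      cmod (y t ! j $$ (k, l) - Gam \<Gamma> n Y ! j $$ (k, l)) \<le> 1 / real (Suc t))"
    using ex unfolding Bex_def by (intro choice allI)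
  then obtain y where y_yc: "\<forall>t. y t \<in> matco ?r (Gam_image \<Gamma> K) n \<and> (\<forall>j<?r. \<forall>k<n. \<forall>l<n.
      cmod (y t ! j $$ (k, l) - Gam \<Gamma> n Y ! j $$ (k, l)) \<le> 1 / real (Suc t))" ..
  have y: "\<And>t. y t \<in> matco ?r (Gam_image \<Gamma> K) n"
    and yc: "\<And>t. \<forall>j<?r. \<forall>k<n. \<forall>l<n. cmod (y t ! j $$ (k, l) - Gam \<Gamma> n Y ! j $$ (k, l)) \<le> 1 / real (Suc t)"
    using y_yc by blast+
  have lim: "(\<lambda>t. y t ! j $$ (k, l)) \<longlonglongrightarrow> Gam \<Gamma> n Y ! j $$ (k, l)" if "j < ?r" "k < n" "l < n" for j k l
  proof -
    have inv0: "(\<lambda>t. 1 / real (Suc t)) \<longlonglongrightarrow> 0"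
      using LIMSEQ_inverse_real_of_nat by (simp add: inverse_eq_divide)
    have "(\<lambda>t. y t ! j $$ (k, l) - Gam \<Gamma> n Y ! j $$ (k, l)) \<longlonglongrightarrow> 0"
      by (rule tendsto_0_le[OF inv0, of _ 1]) (use yc that in \<open>simp del: of_nat_Suc\<close>)
    then show ?thesis by (simp add: LIM_zero_iff)
  qed
  have "mat_adjoint (mat_eval n Y (\<Gamma> ! j)) = mat_eval n Y (\<Gamma> ! j)" if "j < ?r" for j
    by (rule mat_eval_adjoint[OF Ysa poly_in[OF that] poly_star[OF that]])
  \<comment> \<open>\<open>gclosure\<close> admits only self-adjoint limits.\<close>
  then have Gsa: "Gam \<Gamma> n Y \<in> sa_tuples ?r n"
    by (auto simp: sa_tuples_def Gam_def in_set_conv_nth)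
  have "Gam \<Gamma> n Y \<in> gclosure ?r (matco ?r (Gam_image \<Gamma> K)) n"
    unfolding gclosure_def using y lim by (intro CollectI conjI Gsa exI[of _ y]) simp_all
  then have "Y \<in> Gam_preimage g \<Gamma> (gclosure ?r (matco ?r (Gam_image \<Gamma> K))) n"
    unfolding Gam_preimage_def by (intro CollectI conjI Ysa)
  then show ?thesis by (simp only: pre[symmetric])
qed

section \<open>Matrix tuples as operator systems\<close>

lemma gop_op_of_mat:
  assumes X: "X \<in> mtuples g n"
  shows "gop \<Gamma> ({..<n}, map (op_of_mat n) X) c d = op_of_mat n (lme \<Gamma> n X c d)"
proof (rule ext)+
  fix f i
  have ev: "op_eval {..<n} (map (op_of_mat n) X) (\<Gamma> ! j) = op_of_mat n (mat_eval n X (\<Gamma> ! j))" if "j < length \<Gamma>" for j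
    by (rule op_eval_op_of_mat[OF X poly_in[OF that]])
  show "gop \<Gamma> ({..<n}, map (op_of_mat n) X) c d f i = op_of_mat n (lme \<Gamma> n X c d) f i"
  proof (cases "f \<in> ell2 {..<n} \<and> i < n")
    case True
    then show ?thesis by (simp add: gop_def ev op_of_mat_def mact_lme id_op_def)
  next
    case False
    then show ?thesis using ell2_off[of f "{..<n}" i]
      by (cases "f \<in> ell2 {..<n}") (auto simp: gop_def ev op_of_mat_def id_op_def)
  qed
qed

lemma block_positive_op_of_mat:
  "block_positive {..<n} m (\<lambda>k l. op_of_mat n (M k l)) \<longleftrightarrow> mat_block_pos n m M"
proof
  assume pos: "block_positive {..<n} m (\<lambda>k l. op_of_mat n (M k l))"
  show "mat_block_pos n m M"
    unfolding mat_block_pos_def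
  proof
    fix v :: "nat \<Rightarrow> nat \<Rightarrow> complex"
    let ?w = "\<lambda>k i. if i < n then v k i else 0"
    have w: "?w k \<in> ell2 {..<n}" for k by (simp add: ell2_fin)
    have "0 \<le> (\<Sum>k<m. \<Sum>l<m. l2_inner (op_of_mat n (M k l) (?w l)) (?w k))"
      using pos w unfolding block_positive_def by simp
    also have "\<dots> = (\<Sum>k<m. \<Sum>l<m. \<Sum>i<n. mact n (M k l) (v l) i * cnj (v k i))"
    proof (rule sum.cong[OF refl], rule sum.cong[OF refl])
      fix k l
      have "l2_inner (op_of_mat n (M k l) (?w l)) (?w k) = (\<Sum>i<n. op_of_mat n (M k l) (?w l) i * cnj (?w k i))"
        by (rule l2_inner_fin[OF bounded_opD(1)[OF op_of_mat_bounded w]])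
      also have "\<dots> = (\<Sum>i<n. mact n (M k l) (v l) i * cnj (v k i))"
        using w[of l] by (intro sum.cong) (auto simp: op_of_mat_def mact_def)
      finally show "l2_inner (op_of_mat n (M k l) (?w l)) (?w k) = (\<Sum>i<n. mact n (M k l) (v l) i * cnj (v k i))" .
    qed
    finally show "0 \<le> (\<Sum>k<m. \<Sum>l<m. \<Sum>i<n. mact n (M k l) (v l) i * cnj (v k i))" .
  qed
next
  assume pos: "mat_block_pos n m M"
  show "block_positive {..<n} m (\<lambda>k l. op_of_mat n (M k l))"
    unfolding block_positive_def
  proof (intro allI impI)
    fix v :: "nat \<Rightarrow> nat \<Rightarrow> complex" assume v: "\<forall>k<m. v k \<in> ell2 {..<n}"
    have "0 \<le> (\<Sum>k<m. \<Sum>l<m. \<Sum>i<n. mact n (M k l) (v l) i * cnj (v k i))"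
      using pos unfolding mat_block_pos_def by (rule spec)
    also have "\<dots> = (\<Sum>k<m. \<Sum>l<m. l2_inner (op_of_mat n (M k l) (v l)) (v k))"
    proof (rule sum.cong[OF refl], rule sum.cong[OF refl])
      fix k l assume "l \<in> {..<m}"
      then have w: "v l \<in> ell2 {..<n}" using v by simp
      have "l2_inner (op_of_mat n (M k l) (v l)) (v k) = (\<Sum>i<n. op_of_mat n (M k l) (v l) i * cnj (v k i))"
        by (rule l2_inner_fin[OF bounded_opD(1)[OF op_of_mat_bounded w]])
      also have "\<dots> = (\<Sum>i<n. mact n (M k l) (v l) i * cnj (v k i))"
        using w by (intro sum.cong) (auto simp: op_of_mat_def)
      finally show "(\<Sum>i<n. mact n (M k l) (v l) i * cnj (v k i)) = l2_inner (op_of_mat n (M k l) (v l)) (v k)" by simp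
    qed
    finally show "0 \<le> (\<Sum>k<m. \<Sum>l<m. l2_inner (op_of_mat n (M k l) (v l)) (v k))" .
  qed
qed

lemma Gamma_ucp_gop:
  assumes "Gamma_ucp \<Gamma> a T \<phi>"
  shows "\<phi> (gop \<Gamma> a c d) = gop \<Gamma> (T, map \<phi> (snd a)) c d"
proof -
  obtain S A where a: "a = (S, A)" by (cases a)
  have "lin_on (Rsys \<Gamma> a) \<phi>" "\<phi> (id_op S) = id_op T"
    "\<And>j. j < length \<Gamma> \<Longrightarrow> \<phi> (op_eval S A (\<Gamma> ! j)) = op_eval T (map \<phi> A) (\<Gamma> ! j)"
    using assms by (auto simp: Gamma_ucp_def a)
  then show ?thesis using lin_on_gop[of \<Gamma> a \<phi> c d] by (simp add: a gop_def)
qed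

text \<open>Recognizes a \<open>\<Gamma>\<close>-ucp map from its effect on coefficients. Positivity
  in the system of \<open>a\<close> is positivity on \<open>K\<close>, so complete positivity need
  only be tested on arrays that are positive at all points; the image tuple \<open>B\<close> is read
  off because the variables are among the polynomials.\<close>

lemma Gamma_ucpI:
  assumes a: "realizes g \<Gamma> a K" and B: "length B = g" "\<And>j. j < g \<Longrightarrow> bounded_op T (B ! j)"
    and \<phi>: "\<And>c d. \<phi> (gop \<Gamma> a c d) = gop \<Gamma> (T, B) c d"
    and pos: "\<And>m c d. (\<And>N X. X \<in> K N \<Longrightarrow> mat_block_pos N m (\<lambda>k l. lme \<Gamma> N X (c k l) (d k l))) \<Longrightarrow>
      block_positive T m (\<lambda>k l. gop \<Gamma> (T, B) (c k l) (d k l))"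
  shows "Gamma_ucp \<Gamma> a T \<phi>" and "map \<phi> (snd a) = B"
proof -
  obtain S A where aSA: "a = (S, A)" by (cases a)
  have bd: "bounded_op T (gop \<Gamma> (T, B) c d)" for c d
    using gop_bounded[of "(T, B)"] B(2) by simp
  have gen: "\<phi> (op_eval S A (\<Gamma> ! j)) = op_eval T B (\<Gamma> ! j)" if "j < length \<Gamma>" for j
    using \<phi>[of 0 "\<lambda>l. if l = j then 1 else 0"] gop_gen[OF that, of a] gop_gen[OF that, of "(T, B)"] by (simp add: aSA)
  show mp: "map \<phi> (snd a) = B"
  proof (rule nth_equalityI)
    fix j assume "j < length (map \<phi> (snd a))"
    then have j: "j < g" using realizes_bounded(4)[OF a] by simp
    have "op_eval T B (\<Gamma> ! j) = B ! j" using op_eval_var[OF B(2)[OF j]] vars[OF j] by simp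
    moreover have "op_eval S A (\<Gamma> ! j) = A ! j"
      using op_eval_var[OF realizes_bounded(1)[OF a j]] vars[OF j] by (simp add: aSA)
    ultimately show "map \<phi> (snd a) ! j = B ! j"
      using gen[of j] j g_le realizes_bounded(4)[OF a] by (simp add: aSA)
  qed (use B(1) realizes_bounded(4)[OF a] in simp)
  have "completely_positive S (Rsys \<Gamma> a) T \<phi>"
    unfolding completely_positive_def
  proof (intro allI impI)
    fix m P assume P: "(\<forall>k<m. \<forall>l<m. P k l \<in> Rsys \<Gamma> a) \<and> block_positive S m P"
    \<comment> \<open>Coefficients are chosen for every entry of the operator matrix; any choice
      will do, as \<open>\<phi>\<close> is already a function on elements.\<close>
    then have "\<forall>k l. \<exists>cd. k < m \<longrightarrow> l < m \<longrightarrow> P k l = gop \<Gamma> a (fst cd) (snd cd)" by (auto simp: Rsys_gop)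
    then obtain cd where cd: "\<And>k l. k < m \<Longrightarrow> l < m \<Longrightarrow> P k l = gop \<Gamma> a (fst (cd k l)) (snd (cd k l))"
      by metis
    have "block_positive S m (\<lambda>k l. gop \<Gamma> a (fst (cd k l)) (snd (cd k l)))"
      using P cd by (simp add: block_positive_def)
    then have "\<forall>N. \<forall>X\<in>K N. mat_block_pos N m (\<lambda>k l. lme \<Gamma> N X (fst (cd k l)) (snd (cd k l)))"
      using realizes_pos[OF a, of m "\<lambda>k l. fst (cd k l)" "\<lambda>k l. snd (cd k l)"] by (simp add: aSA)
    then have "block_positive T m (\<lambda>k l. gop \<Gamma> (T, B) (fst (cd k l)) (snd (cd k l)))"
      by (intro pos) blast
    then show "block_positive T m (\<lambda>k l. \<phi> (P k l))"
      using cd \<phi> by (simp add: block_positive_def)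
  qed
  moreover have "lin_on (Rsys \<Gamma> a) \<phi>"
    unfolding lin_on_def
  proof (intro ballI allI)
    fix P Q x y assume "P \<in> Rsys \<Gamma> a" "Q \<in> Rsys \<Gamma> a"
    then obtain c d c' d' where "P = gop \<Gamma> a c d" "Q = gop \<Gamma> a c' d'" by (auto simp: Rsys_gop)
    then show "\<phi> (\<lambda>f i. x * P f i + y * Q f i) = (\<lambda>f i. x * \<phi> P f i + y * \<phi> Q f i)"
      by (simp only: gop_lin \<phi>)
  qed
  moreover have "\<phi> (id_op S) = id_op T"
    using \<phi>[of 1 "\<lambda>_. 0"] gop_one[of \<Gamma> a] gop_one[of \<Gamma> "(T, B)"] by (simp add: aSA)
  moreover have "\<forall>P\<in>Rsys \<Gamma> a. bounded_op T (\<phi> P)" using bd \<phi> by (auto simp: Rsys_gop)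
  moreover have "\<phi> (op_eval S A p) = op_eval T (map \<phi> A) p" if "p \<in> set \<Gamma>" for p
    using gen mp that by (auto simp: in_set_conv_nth aSA)
  ultimately show "Gamma_ucp \<Gamma> a T \<phi>" by (simp add: Gamma_ucp_def aSA)
qed

text \<open>The choice in \<open>evm\<close> is immaterial when \<open>a\<close> realizes a graded set containing \<open>X\<close>
  (\<open>evm_gop\<close>).\<close>

definition evm :: "'i opsys \<Rightarrow> nat \<Rightarrow> mtuple \<Rightarrow> 'i op \<Rightarrow> complex mat" where
  "evm a n X P = (SOME M. \<exists>c d. P = gop \<Gamma> a c d \<and> M = lme \<Gamma> n X c d)"

lemma evm_gop:
  assumes "realizes g \<Gamma> a K" "X \<in> K n"
  shows "evm a n X (gop \<Gamma> a c d) = lme \<Gamma> n X c d"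
  unfolding evm_def
proof (rule some_equality)
  fix M assume "\<exists>c' d'. gop \<Gamma> a c d = gop \<Gamma> a c' d' \<and> M = lme \<Gamma> n X c' d'"
  then obtain c' d' where eq: "gop \<Gamma> a c d = gop \<Gamma> a c' d'" and M: "M = lme \<Gamma> n X c' d'" by blast
  show "M = lme \<Gamma> n X c d" using eq[unfolded realizes_eq[OF assms(1)]] assms(2) M by simp
qed blast

lemma evm_eq:
  assumes a: "realizes g \<Gamma> a K" and "P \<in> Rsys \<Gamma> a" "Q \<in> Rsys \<Gamma> a"
    and eq: "\<And>n X. X \<in> K n \<Longrightarrow> evm a n X P = evm a n X Q"
  shows "P = Q"
proof -
  obtain c d c' d' where P: "P = gop \<Gamma> a c d" and Q: "Q = gop \<Gamma> a c' d'" using assms by (auto simp: Rsys_gop)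
  have "lme \<Gamma> n X c d = lme \<Gamma> n X c' d'" if "X \<in> K n" for n X
    using eq[OF that] evm_gop[where K = K and n = n, OF a that] by (simp add: P Q)
  then show ?thesis unfolding P Q using realizes_eq[OF a] by blast
qed

lemma evm_gen:
  assumes "realizes g \<Gamma> a K" "X \<in> K n" "X \<in> mtuples g n" "j < g"
  shows "evm a n X (snd a ! j) = X ! j"
proof -
  have j: "j < length \<Gamma>" using assms(4) g_le by simp
  have "evm a n X (snd a ! j) = mat_eval n X (\<Gamma> ! j)"
    using evm_gop[where K = K and n = n, OF assms(1,2), of 0 "\<lambda>l. if l = j then 1 else 0"]
      realizes_gen[OF assms(1,4)] lme_gen[OF j] by simp
  then show ?thesis using mat_eval_gen[OF assms(3,4)] by simp
qed

text \<open>The map is specified by its values rather than fixed, so that the lemma covers both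
  \<open>evm\<close> and a composite that turns out to be an evaluation.\<close>

lemma point_evaluation:
  assumes a: "realizes g \<Gamma> a K" and K: "graded g K" and X: "X \<in> K n"
    and \<phi>: "\<And>c d. \<phi> (gop \<Gamma> a c d) = op_of_mat n (lme \<Gamma> n X c d)"
  shows "Gamma_ucp \<Gamma> a {..<n} \<phi>" and "mtuple_of n \<phi> a = X"
proof -
  let ?B = "map (op_of_mat n) X"
  have Xm: "X \<in> mtuples g n" using graded_tuples(1)[where K = K, OF K X] by (rule sa_tuples_mtuples)
  have B: "length ?B = g" "\<And>j. j < g \<Longrightarrow> bounded_op {..<n} (?B ! j)" using Xm by (simp_all add: mtuples_def)
  have pos: "block_positive {..<n} m (\<lambda>k l. gop \<Gamma> ({..<n}, ?B) (c k l) (d k l))"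
    if "\<And>N X. X \<in> K N \<Longrightarrow> mat_block_pos N m (\<lambda>k l. lme \<Gamma> N X (c k l) (d k l))" for m c d
    unfolding gop_op_of_mat[OF Xm] block_positive_op_of_mat by (rule that[OF X])
  have eq: "\<phi> (gop \<Gamma> a c d) = gop \<Gamma> ({..<n}, ?B) c d" for c d
    unfolding gop_op_of_mat[OF Xm] \<phi> ..
  show "Gamma_ucp \<Gamma> a {..<n} \<phi>"
    by (rule Gamma_ucpI(1)[where B = ?B, OF a]) (fact B eq pos)+
  have mp: "map \<phi> (snd a) = ?B"
    by (rule Gamma_ucpI(2)[where B = ?B and T = "{..<n}", OF a]) (fact B eq pos)+
  have "mtuple_of n \<phi> a = map (mat_of_op n) (map \<phi> (snd a))" by (simp add: mtuple_of_def)
  also have "\<dots> = map (\<lambda>M. mat_of_op n (op_of_mat n M)) X" by (simp add: mp o_def)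
  also have "\<dots> = X" using Xm mat_of_op_of_mat by (auto simp: mtuples_def intro!: map_idI)
  finally show "mtuple_of n \<phi> a = X" .
qed

text \<open>On the system, a \<open>\<Gamma>\<close>-ucp map into matrices is evaluation at its own
  tuple; in particular the tuple determines it there.\<close>

lemma Gamma_ucp_mat:
  assumes a: "realizes g \<Gamma> a K" and \<phi>: "Gamma_ucp \<Gamma> a {..<n} \<phi>"
  shows "mtuple_of n \<phi> a \<in> mtuples g n"
    and "\<phi> (gop \<Gamma> a c d) = op_of_mat n (lme \<Gamma> n (mtuple_of n \<phi> a) c d)"
proof -
  show Y: "mtuple_of n \<phi> a \<in> mtuples g n"
    using realizes_bounded(4)[OF a] by (auto simp: mtuples_def mtuple_of_def)
  have "map \<phi> (snd a) = map (op_of_mat n) (mtuple_of n \<phi> a)"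
  proof -
    have "bounded_op {..<n} (\<phi> P)" if "P \<in> set (snd a)" for P
      using \<phi> gen_in_Rsys[OF a that] by (auto simp: Gamma_ucp_def split: prod.splits)
    then show ?thesis by (simp add: mtuple_of_def op_of_mat_of_op)
  qed
  then show "\<phi> (gop \<Gamma> a c d) = op_of_mat n (lme \<Gamma> n (mtuple_of n \<phi> a) c d)"
    using Gamma_ucp_gop[OF \<phi>] gop_op_of_mat[OF Y] by simp
qed

text \<open>An inequality on \<open>K\<close> is positivity in the system, complete positivity
  carries it to matrices, and there it is the inequality at the tuple.\<close>

lemma Gamma_ucp_dominated:
  assumes a: "realizes g \<Gamma> a K" and \<phi>: "Gamma_ucp \<Gamma> a {..<n} \<phi>"
  shows "dominated K n (mtuple_of n \<phi> a)"
  unfolding dominated_def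
proof (intro conjI allI impI)
  show "mtuple_of n \<phi> a \<in> mtuples g n" by (rule Gamma_ucp_mat[OF a \<phi>])
  fix m c d assume "\<forall>N. \<forall>X\<in>K N. mat_block_pos N m (\<lambda>k l. lme \<Gamma> N X (c k l) (d k l))"
  then have "block_positive (fst a) m (\<lambda>k l. gop \<Gamma> a (c k l) (d k l))"
    by (simp only: realizes_pos[OF a])
  then have "block_positive {..<n} m (\<lambda>k l. \<phi> (gop \<Gamma> a (c k l) (d k l)))"
    using \<phi> gop_in unfolding Gamma_ucp_def completely_positive_def by (auto split: prod.splits)
  then show "mat_block_pos n m (\<lambda>k l. lme \<Gamma> n (mtuple_of n \<phi> a) (c k l) (d k l))"
    by (simp only: Gamma_ucp_mat(2)[OF a \<phi>] block_positive_op_of_mat)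
qed

lemma Conv_obj_graded:
  assumes "Conv_obj g \<Gamma> K"
  shows "graded g K" "gbounded g K"
  using assms unfolding Conv_obj_def Gamma_convex_def free_set_def by blast+

text \<open>Any system realizing \<open>K\<close> is allowed, so the result also covers those that
  are unitarily equivalent to \<open>hat g K\<close>.\<close>

lemma WGamma_realizes:
  assumes obj: "Conv_obj g \<Gamma> K" and a: "realizes g \<Gamma> a K"
  shows "WGamma \<Gamma> a = K"
proof (rule ext)
  fix n
  note K = Conv_obj_graded[OF obj]
  show "WGamma \<Gamma> a n = K n"
  proof (intro equalityI subsetI)
    fix Y assume "Y \<in> WGamma \<Gamma> a n"
    then obtain \<phi> where Y: "Y = mtuple_of n \<phi> a" and n: "0 < n" and \<phi>: "Gamma_ucp \<Gamma> a {..<n} \<phi>"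
      unfolding WGamma_def by blast
    show "Y \<in> K n" unfolding Y by (rule dominated_mem[OF obj Gamma_ucp_dominated[OF a \<phi>] n])
  next
    fix X assume X: "X \<in> K n"
    have "0 < n" using graded_tuples(2)[where K = K, OF K(1) X] .
    then show "X \<in> WGamma \<Gamma> a n"
      using point_evaluation[where K = K and n = n and \<phi> = "\<lambda>P. op_of_mat n (evm a n X P)", OF a K(1) X]
        evm_gop[where K = K and n = n, OF a X]
      unfolding WGamma_def by (intro CollectI exI[of _ "\<lambda>P. op_of_mat n (evm a n X P)"]) simp
  qed
qed


section \<open>Duality of morphisms\<close>

text \<open>The hypothesis says that linear relations among the generators of \<open>a\<close>
  persist in \<open>b\<close>; this makes the coefficientwise map well defined, and spanning makes
  it unique.\<close>

lemma gen_map_unique: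
  assumes wd: "\<And>c d c' d'. gop \<Gamma> a c d = gop \<Gamma> a c' d' \<Longrightarrow> gop \<Gamma> b c d = gop \<Gamma> b c' d'"
  shows "\<exists>!\<Psi>. is_gen_map \<Gamma> a b \<Psi>" and "is_gen_map \<Gamma> a b (gen_map \<Gamma> a b)"
    and "gen_map \<Gamma> a b (gop \<Gamma> a c d) = gop \<Gamma> b c d"
proof -
  have val: "\<Psi> (gop \<Gamma> a c d) = gop \<Gamma> b c d" if "is_gen_map \<Gamma> a b \<Psi>" for \<Psi> c d
  proof -
    have "lin_on (Rsys \<Gamma> a) \<Psi>" "\<Psi> (id_op (fst a)) = id_op (fst b)"
      "\<And>j. j < length \<Gamma> \<Longrightarrow> \<Psi> (op_eval (fst a) (snd a) (\<Gamma> ! j)) = op_eval (fst b) (snd b) (\<Gamma> ! j)"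
      using that by (auto simp: is_gen_map_def split: prod.splits)
    then show ?thesis using lin_on_gop[of \<Gamma> a \<Psi> c d] by (simp add: gop_def)
  qed
  \<comment> \<open>The choice runs over the coefficient representations of \<open>P\<close>;
    \<open>wd\<close> makes its outcome independent of the representation.\<close>
  define \<Psi> where "\<Psi> = restrict (\<lambda>P. SOME Q. \<exists>c d. P = gop \<Gamma> a c d \<and> Q = gop \<Gamma> b c d) (Rsys \<Gamma> a)"
  have \<Psi>: "\<Psi> (gop \<Gamma> a c d) = gop \<Gamma> b c d" for c d
  proof -
    have "(SOME Q. \<exists>c' d'. gop \<Gamma> a c d = gop \<Gamma> a c' d' \<and> Q = gop \<Gamma> b c' d') = gop \<Gamma> b c d"
    proof (rule some_equality)
      fix Q assume "\<exists>c' d'. gop \<Gamma> a c d = gop \<Gamma> a c' d' \<and> Q = gop \<Gamma> b c' d'"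
      then obtain c' d' where "gop \<Gamma> a c d = gop \<Gamma> a c' d'" "Q = gop \<Gamma> b c' d'" by blast
      then show "Q = gop \<Gamma> b c d" using wd[of c d c' d'] by simp
    qed blast
    then show ?thesis by (simp add: \<Psi>_def)
  qed
  have ex: "is_gen_map \<Gamma> a b \<Psi>"
  proof -
    have "lin_on (Rsys \<Gamma> a) \<Psi>"
      unfolding lin_on_def
    proof (intro ballI allI)
      fix P Q x y assume "P \<in> Rsys \<Gamma> a" "Q \<in> Rsys \<Gamma> a"
      then obtain c d c' d' where "P = gop \<Gamma> a c d" "Q = gop \<Gamma> a c' d'" by (auto simp: Rsys_gop)
      then show "\<Psi> (\<lambda>f i. x * P f i + y * Q f i) = (\<lambda>f i. x * \<Psi> P f i + y * \<Psi> Q f i)"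
        by (simp only: gop_lin \<Psi>)
    qed
    moreover have "\<Psi> (id_op (fst a)) = id_op (fst b)"
      using \<Psi>[of 1 "\<lambda>_. 0"] by (simp only: gop_one)
    moreover have "\<Psi> (op_eval (fst a) (snd a) (\<Gamma> ! j)) = op_eval (fst b) (snd b) (\<Gamma> ! j)" if "j < length \<Gamma>" for j
      using \<Psi>[of 0 "\<lambda>l. if l = j then 1 else 0"] by (simp only: gop_gen[OF that])
    moreover have "\<Psi> \<in> extensional (Rsys \<Gamma> a)" by (simp add: \<Psi>_def)
    ultimately show ?thesis by (auto simp: is_gen_map_def in_set_conv_nth split: prod.splits)
  qed
  show ex1: "\<exists>!\<Psi>. is_gen_map \<Gamma> a b \<Psi>"
  proof (rule ex1I[where a = \<Psi>])
    show "is_gen_map \<Gamma> a b \<Psi>" by (rule ex)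
    fix \<Psi>' assume g: "is_gen_map \<Gamma> a b \<Psi>'"
    then have "\<Psi>' \<in> extensional (Rsys \<Gamma> a)" "\<Psi> \<in> extensional (Rsys \<Gamma> a)"
      using ex by (auto simp: is_gen_map_def split: prod.splits)
    then show "\<Psi>' = \<Psi>"
      by (rule extensionalityI) (auto simp: Rsys_gop val[OF g] \<Psi>)
  qed
  show gm: "is_gen_map \<Gamma> a b (gen_map \<Gamma> a b)"
    unfolding gen_map_def by (rule theI'[where P = "is_gen_map \<Gamma> a b"]) (rule ex1)
  show "gen_map \<Gamma> a b (gop \<Gamma> a c d) = gop \<Gamma> b c d" by (rule val[OF gm])
qed

lemma lme_subst:
  assumes "\<And>j. j < length \<Gamma> \<Longrightarrow> mat_eval n Z (\<Gamma> ! j) = lme \<Gamma> n Y (c j) (d j)"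
  shows "lme \<Gamma> n Z c0 d0 =
    lme \<Gamma> n Y (c0 + (\<Sum>j<length \<Gamma>. d0 j * c j)) (\<lambda>l. \<Sum>j<length \<Gamma>. d0 j * d j l)"
proof (rule eq_matI)
  fix i k
  let ?r = "length \<Gamma>" and ?E = "\<lambda>l. mat_eval n Y (\<Gamma> ! l) $$ (i, k)"
  assume "i < dim_row (lme \<Gamma> n Y (c0 + (\<Sum>j<?r. d0 j * c j)) (\<lambda>l. \<Sum>j<?r. d0 j * d j l))"
    "k < dim_col (lme \<Gamma> n Y (c0 + (\<Sum>j<?r. d0 j * c j)) (\<lambda>l. \<Sum>j<?r. d0 j * d j l))"
  then have ik: "i < n" "k < n" by simp_all
  have "lme \<Gamma> n Z c0 d0 $$ (i, k) =
      c0 * (1\<^sub>m n) $$ (i, k) + (\<Sum>j<?r. d0 j * (c j * (1\<^sub>m n) $$ (i, k) + (\<Sum>l<?r. d j l * ?E l)))"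
    unfolding lme_entry[OF ik, of \<Gamma> Z]
    by (intro arg_cong2[where f = "(+)"] refl sum.cong) (simp add: assms lme_entry[OF ik])
  also have "\<dots> = c0 * (1\<^sub>m n) $$ (i, k) + ((\<Sum>j<?r. d0 j * c j * (1\<^sub>m n) $$ (i, k)) + (\<Sum>j<?r. \<Sum>l<?r. d0 j * d j l * ?E l))"
    by (simp only: distrib_left sum.distrib sum_distrib_left mult.assoc)
  also have "(\<Sum>j<?r. \<Sum>l<?r. d0 j * d j l * ?E l) = (\<Sum>l<?r. (\<Sum>j<?r. d0 j * d j l) * ?E l)"
    by (subst sum.swap) (simp only: sum_distrib_right)
  finally show "lme \<Gamma> n Z c0 d0 $$ (i, k) =
      lme \<Gamma> n Y (c0 + (\<Sum>j<?r. d0 j * c j)) (\<lambda>l. \<Sum>j<?r. d0 j * d j l) $$ (i, k)"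
    unfolding lme_entry[OF ik] by (simp only: distrib_right sum_distrib_right add.assoc)
qed simp_all

text \<open>The new coefficients are those of \<open>lme_subst\<close>, so the operator identity and
  its pointwise version can be compared directly.\<close>

lemma gop_subst:
  assumes "\<And>j. j < length \<Gamma> \<Longrightarrow> op_eval (fst b) B (\<Gamma> ! j) = gop \<Gamma> b (c j) (d j)"
  shows "gop \<Gamma> (fst b, B) c0 d0 =
    gop \<Gamma> b (c0 + (\<Sum>j<length \<Gamma>. d0 j * c j)) (\<lambda>l. \<Sum>j<length \<Gamma>. d0 j * d j l)"
proof (rule ext)+
  fix f i
  let ?r = "length \<Gamma>" and ?E = "\<lambda>l. op_eval (fst b) (snd b) (\<Gamma> ! l) f i" and ?I = "id_op (fst b) f i"
  have "gop \<Gamma> (fst b, B) c0 d0 f i = c0 * ?I + (\<Sum>j<?r. d0 j * (c j * ?I + (\<Sum>l<?r. d j l * ?E l)))"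
    using assms unfolding gop_def[of \<Gamma> "(fst b, B)"] fst_conv snd_conv
    by (simp add: gop_def)
  also have "\<dots> = c0 * ?I + ((\<Sum>j<?r. d0 j * c j * ?I) + (\<Sum>j<?r. \<Sum>l<?r. d0 j * d j l * ?E l))"
    by (simp only: distrib_left sum.distrib sum_distrib_left mult.assoc)
  also have "(\<Sum>j<?r. \<Sum>l<?r. d0 j * d j l * ?E l) = (\<Sum>l<?r. (\<Sum>j<?r. d0 j * d j l) * ?E l)"
    by (subst sum.swap) (simp only: sum_distrib_right)
  finally show "gop \<Gamma> (fst b, B) c0 d0 f i =
      gop \<Gamma> b (c0 + (\<Sum>j<?r. d0 j * c j)) (\<lambda>l. \<Sum>j<?r. d0 j * d j l) f i"
    by (simp only: gop_def distrib_right sum_distrib_right add.assoc)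
qed

text \<open>\<open>\<Psi>\<close> and \<open>\<Phi>\<close> correspond to each other under evaluation at points: \<open>(\<Psi> P)(Y) = P(\<Phi> Y)\<close>.
  Each determines the other, which gives functoriality and naturality of both assignments.\<close>

definition dual_to ::
    "'i opsys \<Rightarrow> 'k opsys \<Rightarrow> gset \<Rightarrow> gset \<Rightarrow> ('i op \<Rightarrow> 'k op) \<Rightarrow> (mtuple \<Rightarrow> mtuple) \<Rightarrow> bool" where
  "dual_to a b K L \<Psi> \<Phi> \<longleftrightarrow> \<Psi> ` Rsys \<Gamma> a \<subseteq> Rsys \<Gamma> b \<and>
    (\<forall>n. \<forall>Y\<in>L n. \<Phi> Y \<in> K n \<and> (\<forall>P\<in>Rsys \<Gamma> a. evm b n Y (\<Psi> P) = evm a n (\<Phi> Y) P))"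

lemma dual_toD:
  assumes "dual_to a b K L \<Psi> \<Phi>"
  shows "P \<in> Rsys \<Gamma> a \<Longrightarrow> \<Psi> P \<in> Rsys \<Gamma> b" "Y \<in> L n \<Longrightarrow> \<Phi> Y \<in> K n"
    "Y \<in> L n \<Longrightarrow> P \<in> Rsys \<Gamma> a \<Longrightarrow> evm b n Y (\<Psi> P) = evm a n (\<Phi> Y) P"
  using assms by (auto simp: dual_to_def)

text \<open>An element of the system of \<open>b\<close> is determined by its values at the points
  of \<open>L\<close>.\<close>

lemma dual_to_unique_left:
  assumes b: "realizes g \<Gamma> b L" and d: "dual_to a b K L \<Psi> \<Phi>" "dual_to a b K L \<Psi>' \<Phi>"
    and e: "\<Psi> \<in> extensional (Rsys \<Gamma> a)" "\<Psi>' \<in> extensional (Rsys \<Gamma> a)"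
  shows "\<Psi> = \<Psi>'"
proof (rule extensionalityI[OF e])
  fix P assume P: "P \<in> Rsys \<Gamma> a"
  show "\<Psi> P = \<Psi>' P"
  proof (rule evm_eq[OF b dual_toD(1)[OF d(1) P] dual_toD(1)[OF d(2) P]])
    fix n Y assume Y: "Y \<in> L n"
    show "evm b n Y (\<Psi> P) = evm b n Y (\<Psi>' P)"
      using dual_toD(3)[where n = n and L = L, OF d(1) Y P] dual_toD(3)[where n = n and L = L, OF d(2) Y P] by simp
  qed
qed

text \<open>A point is recovered from the values of the coordinate generators at it.\<close>

lemma dual_to_unique_right:
  assumes a: "realizes g \<Gamma> a K" and K: "graded g K" and d: "dual_to a b K L \<Psi> \<Phi>" "dual_to a b K L \<Psi> \<Phi>'"
    and e: "\<Phi> \<in> extensional (points L)" "\<Phi>' \<in> extensional (points L)"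
  shows "\<Phi> = \<Phi>'"
proof (rule extensionalityI[OF e])
  fix Y assume "Y \<in> points L"
  then obtain n where Y: "Y \<in> L n" by (auto simp: points_def)
  note m = dual_toD(2)[where n = n and L = L, OF d(1) Y] dual_toD(2)[where n = n and L = L, OF d(2) Y]
  note t = sa_tuples_mtuples[OF graded_tuples(1)[where K = K and n = n, OF K m(1)]]
    sa_tuples_mtuples[OF graded_tuples(1)[where K = K and n = n, OF K m(2)]]
  show "\<Phi> Y = \<Phi>' Y"
  proof (rule nth_equalityI)
    show "length (\<Phi> Y) = length (\<Phi>' Y)" using t by (simp add: mtuples_def)
    fix j assume "j < length (\<Phi> Y)"
    then have j: "j < g" using t by (simp add: mtuples_def)
    have A: "snd a ! j \<in> Rsys \<Gamma> a" using gen_in_Rsys[OF a] realizes_bounded(4)[OF a] j by simp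
    show "\<Phi> Y ! j = \<Phi>' Y ! j"
      using evm_gen[where n = n and K = K, OF a m(1) t(1) j] evm_gen[where n = n and K = K, OF a m(2) t(2) j]
        dual_toD(3)[where n = n and L = L, OF d(1) Y A] dual_toD(3)[where n = n and L = L, OF d(2) Y A] by simp
  qed
qed

lemma dual_to_id: "dual_to a a K K (restrict (\<lambda>P. P) (Rsys \<Gamma> a)) (restrict (\<lambda>X. X) (points K))"
  by (auto simp: dual_to_def points_def)

lemma dual_to_comp:
  assumes d: "dual_to a b K L \<Psi> \<Phi>" "dual_to b c L M \<Psi>' \<Phi>'"
  shows "dual_to a c K M (compose (Rsys \<Gamma> a) \<Psi>' \<Psi>) (compose (points M) \<Phi> \<Phi>')"
  unfolding dual_to_def
proof (intro conjI allI ballI image_subsetI)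
  show "compose (Rsys \<Gamma> a) \<Psi>' \<Psi> P \<in> Rsys \<Gamma> c" if "P \<in> Rsys \<Gamma> a" for P
    using dual_toD(1)[OF d(2) dual_toD(1)[OF d(1) that]] that by (simp add: compose_def)
  fix n Z assume Z: "Z \<in> M n"
  then have Zp: "Z \<in> points M" by (auto simp: points_def)
  note Y = dual_toD(2)[where n = n and L = M, OF d(2) Z]
  show "compose (points M) \<Phi> \<Phi>' Z \<in> K n"
    using dual_toD(2)[where n = n and L = L, OF d(1) Y] Zp by (simp add: compose_def)
  fix P assume P: "P \<in> Rsys \<Gamma> a"
  show "evm c n Z (compose (Rsys \<Gamma> a) \<Psi>' \<Psi> P) = evm a n (compose (points M) \<Phi> \<Phi>' Z) P"
    using dual_toD(3)[where n = n and L = M, OF d(2) Z dual_toD(1)[OF d(1) P]]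
      dual_toD(3)[where n = n and L = L, OF d(1) Y P] P Zp by (simp add: compose_def)
qed

text \<open>The tuple of \<open>b'\<close> is \<open>\<Phi>\<close> applied to the generators of
  \<open>b\<close>. It is written with the coefficients of \<open>\<Phi>\<close> because
  \<open>b\<close> is an abstract system in which \<open>\<Phi>\<close> cannot be applied block by
  block. Relations and inequalities valid on \<open>K\<close> are pulled back to \<open>L\<close>
  along \<open>\<Phi>\<close>, which gives well-definedness and complete positivity.\<close>

lemma affine_dual:
  fixes a :: "'i opsys" and b :: "'k opsys"
  assumes K: "Conv_obj g \<Gamma> K" and L: "Conv_obj g \<Gamma> L"
    and a: "realizes g \<Gamma> a K" and b: "realizes g \<Gamma> b L"
    and \<Phi>: "\<And>n Y. Y \<in> L n \<Longrightarrow> \<Phi> Y \<in> K n"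
    and aff: "\<And>n Y j. Y \<in> L n \<Longrightarrow> j < length \<Gamma> \<Longrightarrow> mat_eval n (\<Phi> Y) (\<Gamma> ! j) = lme \<Gamma> n Y (c j) (d j)"
    and b': "b' = (fst b, map (\<lambda>j. gop \<Gamma> b (c j) (d j)) [0..<g])"
  shows "\<exists>!\<Psi>. is_gen_map \<Gamma> a b' \<Psi>" and "is_gen_map \<Gamma> a b' (gen_map \<Gamma> a b')"
    and "gen_map \<Gamma> a b' \<in> extensional (Rsys \<Gamma> a)" "admissible \<Gamma> a b (gen_map \<Gamma> a b')"
    and "dual_to a b K L (gen_map \<Gamma> a b') \<Phi>"
proof -
  let ?r = "length \<Gamma>" and ?B = "map (\<lambda>j. gop \<Gamma> b (c j) (d j)) [0..<g]"
  let ?c = "\<lambda>c0 d0. c0 + (\<Sum>j<?r. d0 j * c j)" and ?d = "\<lambda>d0 l. \<Sum>j<?r. d0 j * d j l"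
  note Kg = Conv_obj_graded(1)[OF K]
  have tup: "\<Phi> Y \<in> mtuples g n" if "Y \<in> L n" for n Y
    using graded_tuples(1)[where K = K and n = n, OF Kg \<Phi>[OF that]] by (rule sa_tuples_mtuples)
  have tuple_eq: "map (\<lambda>j. lme \<Gamma> n Y (c j) (d j)) [0..<g] = \<Phi> Y" if Y: "Y \<in> L n" for n Y
  proof (rule nth_equalityI)
    show "length (map (\<lambda>j. lme \<Gamma> n Y (c j) (d j)) [0..<g]) = length (\<Phi> Y)" using tup[OF Y] by (simp add: mtuples_def)
    fix j assume "j < length (map (\<lambda>j. lme \<Gamma> n Y (c j) (d j)) [0..<g])"
    then have j: "j < g" "j < ?r" using g_le by auto
    show "map (\<lambda>j. lme \<Gamma> n Y (c j) (d j)) [0..<g] ! j = \<Phi> Y ! j"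
      using aff[OF Y j(2)] mat_eval_gen[OF tup[OF Y] j(1)] j(1) by simp
  qed
  \<comment> \<open>The relation clause of \<open>realizes\<close> lifts the affine formula from the
    points of \<open>L\<close> to the operator tuple.\<close>
  have ev: "op_eval (fst b) ?B (\<Gamma> ! j) = gop \<Gamma> b (c j) (d j)" if "j < ?r" for j
    unfolding realizes_eval[OF b poly_in[OF that]]
  proof (intro allI ballI)
    fix n Y assume Y: "Y \<in> L n"
    show "mat_eval n (map (\<lambda>j. lme \<Gamma> n Y (c j) (d j)) [0..<g]) (\<Gamma> ! j) = lme \<Gamma> n Y (c j) (d j)"
      unfolding tuple_eq[OF Y] by (rule aff[OF Y that])
  qed
  have gopB: "gop \<Gamma> b' c0 d0 = gop \<Gamma> b (?c c0 d0) (?d d0)" for c0 d0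
    unfolding b' by (rule gop_subst[OF ev])
  have lmeY: "lme \<Gamma> n (\<Phi> Y) c0 d0 = lme \<Gamma> n Y (?c c0 d0) (?d d0)" if "Y \<in> L n" for n Y c0 d0
    by (rule lme_subst[OF aff[OF that]])
  \<comment> \<open>A linear relation in \<open>a\<close> holds at all points of \<open>K\<close>,
    in particular at the points \<open>\<Phi> Y\<close>, where it reads as the relation for
    \<open>b'\<close> at \<open>Y\<close>.\<close>
  have wd: "gop \<Gamma> b' c0 d0 = gop \<Gamma> b' c1 d1" if "gop \<Gamma> a c0 d0 = gop \<Gamma> a c1 d1" for c0 d0 c1 d1
    unfolding gopB realizes_eq[OF b]
  proof (intro allI ballI)
    fix n Y assume Y: "Y \<in> L n"
    show "lme \<Gamma> n Y (?c c0 d0) (?d d0) = lme \<Gamma> n Y (?c c1 d1) (?d d1)"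
      using that[unfolded realizes_eq[OF a]] \<Phi>[OF Y] by (simp add: lmeY[OF Y, symmetric])
  qed
  show "\<exists>!\<Psi>. is_gen_map \<Gamma> a b' \<Psi>" "is_gen_map \<Gamma> a b' (gen_map \<Gamma> a b')"
    by (rule gen_map_unique[OF wd], assumption)+
  then show ext: "gen_map \<Gamma> a b' \<in> extensional (Rsys \<Gamma> a)" by (auto simp: is_gen_map_def split: prod.splits)
  have gm: "gen_map \<Gamma> a b' (gop \<Gamma> a c0 d0) = gop \<Gamma> b' c0 d0" for c0 d0
    by (rule gen_map_unique(3)[OF wd])
  have sub: "gen_map \<Gamma> a b' ` Rsys \<Gamma> a \<subseteq> Rsys \<Gamma> b"
  proof (rule image_subsetI)
    fix P assume "P \<in> Rsys \<Gamma> a"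
    then obtain c0 d0 where "P = gop \<Gamma> a c0 d0" by (auto simp: Rsys_gop)
    then show "gen_map \<Gamma> a b' P \<in> Rsys \<Gamma> b" by (simp add: gm gopB)
  qed
  have "Gamma_ucp \<Gamma> a (fst b) (gen_map \<Gamma> a b')"
  proof (rule Gamma_ucpI(1)[where B = ?B, OF a])
    show "bounded_op (fst b) (?B ! j)" if "j < g" for j using that realizes_bounded(2)[OF b] by simp
    show "gen_map \<Gamma> a b' (gop \<Gamma> a c0 d0) = gop \<Gamma> (fst b, ?B) c0 d0" for c0 d0 using gm by (simp add: b')
    fix m and c0 :: "nat \<Rightarrow> nat \<Rightarrow> complex" and d0
    assume pos: "\<And>N X. X \<in> K N \<Longrightarrow> mat_block_pos N m (\<lambda>k l. lme \<Gamma> N X (c0 k l) (d0 k l))"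
    show "block_positive (fst b) m (\<lambda>k l. gop \<Gamma> (fst b, ?B) (c0 k l) (d0 k l))"
      unfolding gopB[unfolded b'] realizes_pos[OF b]
    proof (intro allI ballI)
      fix n Y assume Y: "Y \<in> L n"
      show "mat_block_pos n m (\<lambda>k l. lme \<Gamma> n Y (?c (c0 k l) (d0 k l)) (?d (d0 k l)))"
        using pos[OF \<Phi>[OF Y]] by (simp only: lmeY[OF Y])
    qed
  qed simp
  \<comment> \<open>The tuple of \<open>\<phi>\<close> is a point of \<open>L\<close>, and the
    composite is evaluation at its image under \<open>\<Phi>\<close>, a point of
    \<open>K\<close>.\<close>
  moreover have "Gamma_ucp \<Gamma> a {..<n} (\<phi> \<circ> gen_map \<Gamma> a b')" if n: "0 < n" and \<phi>: "Gamma_ucp \<Gamma> b {..<n} \<phi>" for n :: nat and \<phi>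
  proof -
    let ?Y = "mtuple_of n \<phi> b"
    have Y: "?Y \<in> L n" by (rule dominated_mem[OF L Gamma_ucp_dominated[OF b \<phi>] n])
    show ?thesis
      by (rule point_evaluation(1)[where K = K and X = "\<Phi> ?Y", OF a Kg \<Phi>[OF Y]])
        (simp add: gm gopB Gamma_ucp_mat(2)[OF b \<phi>] lmeY[OF Y])
  qed
  ultimately show "admissible \<Gamma> a b (gen_map \<Gamma> a b')" using sub by (simp add: admissible_def)
  show "dual_to a b K L (gen_map \<Gamma> a b') \<Phi>"
    unfolding dual_to_def
  proof (intro conjI allI ballI)
    fix n Y assume Y: "Y \<in> L n"
    show "\<Phi> Y \<in> K n" by (rule \<Phi>[OF Y])
    fix P assume "P \<in> Rsys \<Gamma> a"
    then obtain c0 d0 where P: "P = gop \<Gamma> a c0 d0" by (auto simp: Rsys_gop)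
    show "evm b n Y (gen_map \<Gamma> a b' P) = evm a n (\<Phi> Y) P"
      unfolding P gm gopB evm_gop[where K = L and n = n, OF b Y] evm_gop[where K = K and n = n, OF a \<Phi>[OF Y]]
      by (rule lmeY[OF Y, symmetric])
  qed (rule sub)
qed

text \<open>The description in \<open>Phi_of\<close> has one solution: the tuple determines
  \<open>n\<close> as its matrix size and determines \<open>\<phi>\<close> on the system of
  \<open>b\<close>, into which \<open>\<Psi>\<close> sends the generators of
  \<open>a\<close>.\<close>

lemma Phi_of_mtuple:
  assumes b: "realizes g \<Gamma> b L" and adm: "admissible \<Gamma> a b \<Psi>" and a: "realizes g \<Gamma> a K"
    and n: "0 < n" and \<phi>: "Gamma_ucp \<Gamma> b {..<n} \<phi>"
  shows "Phi_of \<Gamma> a b \<Psi> (mtuple_of n \<phi> b) = mtuple_of n (\<phi> \<circ> \<Psi>) a"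
proof -
  let ?Y = "mtuple_of n \<phi> b"
  have Y: "?Y \<in> points (WGamma \<Gamma> b)"
    unfolding points_def WGamma_def using n \<phi> by blast
  have "(THE Z. \<exists>n'>0. \<exists>\<phi>'. Gamma_ucp \<Gamma> b {..<n'} \<phi>' \<and> ?Y = mtuple_of n' \<phi>' b \<and> Z = mtuple_of n' (\<phi>' \<circ> \<Psi>) a) =
      mtuple_of n (\<phi> \<circ> \<Psi>) a"
  proof (rule the_equality)
    show "\<exists>n'>0. \<exists>\<phi>'. Gamma_ucp \<Gamma> b {..<n'} \<phi>' \<and> ?Y = mtuple_of n' \<phi>' b \<and>
        mtuple_of n (\<phi> \<circ> \<Psi>) a = mtuple_of n' (\<phi>' \<circ> \<Psi>) a"
      using n \<phi> by blast
    fix Z assume "\<exists>n'>0. \<exists>\<phi>'. Gamma_ucp \<Gamma> b {..<n'} \<phi>' \<and> ?Y = mtuple_of n' \<phi>' b \<and> Z = mtuple_of n' (\<phi>' \<circ> \<Psi>) a"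
    then obtain n' \<phi>' where \<phi>': "Gamma_ucp \<Gamma> b {..<n'} \<phi>'" and eq: "?Y = mtuple_of n' \<phi>' b"
      and Z: "Z = mtuple_of n' (\<phi>' \<circ> \<Psi>) a" by blast
    have "n' = n"
      using dimt[OF Gamma_ucp_mat(1)[OF b \<phi>] g_pos] dimt[OF Gamma_ucp_mat(1)[OF b \<phi>'] g_pos] eq by simp
    have "\<phi>' Q = \<phi> Q" if Q: "Q \<in> Rsys \<Gamma> b" for Q
    proof -
      obtain c d where "Q = gop \<Gamma> b c d" using Q by (auto simp: Rsys_gop)
      then show ?thesis using Gamma_ucp_mat(2)[OF b \<phi>, of c d] Gamma_ucp_mat(2)[OF b \<phi>', of c d] eq \<open>n' = n\<close> by simp
    qed
    moreover have "\<Psi> P \<in> Rsys \<Gamma> b" if "P \<in> set (snd a)" for P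
      using adm gen_in_Rsys[OF a that] by (auto simp: admissible_def)
    ultimately show "Z = mtuple_of n (\<phi> \<circ> \<Psi>) a"
      unfolding Z \<open>n' = n\<close> by (simp add: mtuple_of_def)
  qed
  then show ?thesis unfolding Phi_of_def using Y by simp
qed

text \<open>A point of \<open>L\<close> is the tuple of some \<open>\<phi>\<close>; by admissibility
  \<open>\<phi> \<circ> \<Psi>\<close> is \<open>\<Gamma>\<close>-ucp, so its tuple lies in
  \<open>K\<close>. Both maps are evaluations at their tuples, which gives the duality.\<close>

lemma admissible_dual:
  fixes a :: "'i opsys" and b :: "'k opsys"
  assumes K: "Conv_obj g \<Gamma> K" and L: "Conv_obj g \<Gamma> L"
    and a: "realizes g \<Gamma> a K" and b: "realizes g \<Gamma> b L" and adm: "admissible \<Gamma> a b \<Psi>"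
  shows "Phi_of \<Gamma> a b \<Psi> \<in> extensional (points L)"
    and "coord_affine \<Gamma> L K (Phi_of \<Gamma> a b \<Psi>)"
    and "dual_to a b K L \<Psi> (Phi_of \<Gamma> a b \<Psi>)"
proof -
  let ?\<Phi> = "Phi_of \<Gamma> a b \<Psi>"
  show "?\<Phi> \<in> extensional (points L)"
    unfolding Phi_of_def WGamma_realizes[OF L b] by simp
  have sub: "\<Psi> P \<in> Rsys \<Gamma> b" if "P \<in> Rsys \<Gamma> a" for P using adm that by (auto simp: admissible_def)
  \<comment> \<open>Quantified over all coefficient representations, since none of them is
    canonical.\<close>
  have main: "?\<Phi> Y \<in> K n \<and> (\<forall>c d c' d'. \<Psi> (gop \<Gamma> a c d) = gop \<Gamma> b c' d' \<longrightarrow> lme \<Gamma> n (?\<Phi> Y) c d = lme \<Gamma> n Y c' d')"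
    if Y: "Y \<in> L n" for n Y
  proof -
    have "Y \<in> WGamma \<Gamma> b n" unfolding WGamma_realizes[OF L b] by (rule Y)
    then obtain \<phi> where n: "0 < n" and \<phi>: "Gamma_ucp \<Gamma> b {..<n} \<phi>" and Y\<phi>: "Y = mtuple_of n \<phi> b"
      unfolding WGamma_def by blast
    have \<Phi>Y: "?\<Phi> Y = mtuple_of n (\<phi> \<circ> \<Psi>) a"
      unfolding Y\<phi> by (rule Phi_of_mtuple[OF b adm a n \<phi>])
    have \<phi>\<Psi>: "Gamma_ucp \<Gamma> a {..<n} (\<phi> \<circ> \<Psi>)" using adm n \<phi> by (simp add: admissible_def)
    have "?\<Phi> Y \<in> K n" unfolding \<Phi>Y by (rule dominated_mem[OF K Gamma_ucp_dominated[OF a \<phi>\<Psi>] n])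
    moreover have "lme \<Gamma> n (?\<Phi> Y) c d = lme \<Gamma> n Y c' d'" if "\<Psi> (gop \<Gamma> a c d) = gop \<Gamma> b c' d'" for c d c' d'
    proof -
      have "op_of_mat n (lme \<Gamma> n (?\<Phi> Y) c d) = op_of_mat n (lme \<Gamma> n Y c' d')"
        using Gamma_ucp_mat(2)[OF a \<phi>\<Psi>, of c d] Gamma_ucp_mat(2)[OF b \<phi>, of c' d'] that
        unfolding \<Phi>Y unfolding Y\<phi> by simp
      then show ?thesis by (metis mat_of_op_of_mat lme_carrier)
    qed
    ultimately show ?thesis by blast
  qed
  note mem = main[THEN conjunct1] and val = main[THEN conjunct2, rule_format]
  show "dual_to a b K L \<Psi> ?\<Phi>"
    unfolding dual_to_def
  proof (intro conjI allI ballI image_subsetI)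
    fix n Y assume Y: "Y \<in> L n"
    show "?\<Phi> Y \<in> K n" by (rule mem[OF Y])
    fix P assume "P \<in> Rsys \<Gamma> a"
    then obtain c d where P: "P = gop \<Gamma> a c d" by (auto simp: Rsys_gop)
    obtain c' d' where Q: "\<Psi> P = gop \<Gamma> b c' d'" using sub[of P] P by (auto simp: Rsys_gop)
    show "evm b n Y (\<Psi> P) = evm a n (?\<Phi> Y) P"
      unfolding Q evm_gop[where K = L and n = n, OF b Y]
      unfolding P evm_gop[where K = K and n = n, OF a mem[OF Y]]
      by (rule val[OF Y, symmetric]) (use P Q in simp)
  qed (rule sub)
  \<comment> \<open>The coefficients of the images of the \<open>\<gamma>\<^sub>j(A)\<close> under
    \<open>\<Psi>\<close> are the scalars of the affine map.\<close>
  have "\<exists>cd. \<Psi> (gop \<Gamma> a 0 (\<lambda>l. if l = j then 1 else 0)) = gop \<Gamma> b (fst cd) (snd cd)" for j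
    using sub[OF gop_in] by (auto simp: Rsys_gop)
  then obtain cd where cd: "\<And>j. \<Psi> (gop \<Gamma> a 0 (\<lambda>l. if l = j then 1 else 0)) = gop \<Gamma> b (fst (cd j)) (snd (cd j))"
    by metis
  have aff: "mat_eval n (?\<Phi> Y) (\<Gamma> ! j) = lme \<Gamma> n Y (fst (cd j)) (snd (cd j))" if Y: "Y \<in> L n" and j: "j < length \<Gamma>" for n Y j
    using val[OF Y cd[of j]] by (simp add: lme_gen[OF j])
  show "coord_affine \<Gamma> L K ?\<Phi>"
    unfolding coord_affine_def lme_def[symmetric]
  proof (intro conjI allI ballI)
    show "?\<Phi> Y \<in> K n" if "Y \<in> L n" for n Y by (rule mem[OF that])
    show "\<exists>c d. \<forall>n. \<forall>X\<in>L n. \<forall>j<length \<Gamma>. mat_eval n (?\<Phi> X) (\<Gamma> ! j) = lme \<Gamma> n X (c j) (d j)"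
      by (intro exI[of _ "\<lambda>j. fst (cd j)"] exI[of _ "\<lambda>j. snd (cd j)"] allI ballI impI aff)
  qed
qed

end


section \<open>Functors\<close>

text \<open>Turns a pair of inverse arrows into a bijection whose extensional inverse is the given
  arrow, the form in which isomorphisms are stated in the end.\<close>

lemma bij_betw_of_compose_inverse:
  assumes f: "f \<in> A \<rightarrow> B" and k: "k \<in> B \<rightarrow> A" "k \<in> extensional B"
    and kf: "compose A k f = restrict (\<lambda>x. x) A" and fk: "compose B f k = restrict (\<lambda>x. x) B"
  shows "bij_betw f A B" and "restrict (inv_into A f) B = k"
proof -
  have 1: "k (f x) = x" if "x \<in> A" for x using fun_cong[OF kf, of x] that by (simp add: compose_def)
  have 2: "f (k y) = y" if "y \<in> B" for y using fun_cong[OF fk, of y] that by (simp add: compose_def)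
  show bij: "bij_betw f A B" by (rule bij_betw_byWitness[where f' = k]) (use 1 2 f k in auto)
  show "restrict (inv_into A f) B = k"
  proof (rule extensionalityI[OF restrict_extensional k(2)])
    fix y assume y: "y \<in> B"
    have "inv_into A f (f (k y)) = k y"
      using bij k(1) y by (intro inv_into_f_f) (auto simp: bij_betw_def)
    then show "restrict (inv_into A f) B y = k y" using y 2[OF y] by simp
  qed
qed

section \<open>The two categories and the functors between them\<close>

context gamma_tuple
begin

lemma Conv_simps [simp]:
  "K \<in> Obj (Conv g \<Gamma>) \<longleftrightarrow> Conv_obj g \<Gamma> K"
  "\<Phi> \<in> Hom (Conv g \<Gamma>) K L \<longleftrightarrow> \<Phi> \<in> extensional (points K) \<and> coord_affine \<Gamma> K L \<Phi>"
  "Idt (Conv g \<Gamma>) K = restrict (\<lambda>X. X) (points K)"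
  "Cmp (Conv g \<Gamma>) K L M \<Phi>' \<Phi> = compose (points K) \<Phi>' \<Phi>"
  by (simp_all add: Conv_def)

lemma OS_simps [simp]:
  "a \<in> Obj (OS g \<Gamma>) \<longleftrightarrow> OS_obj g \<Gamma> a"
  "\<Psi> \<in> Hom (OS g \<Gamma>) a b \<longleftrightarrow> \<Psi> \<in> extensional (Rsys \<Gamma> a) \<and> admissible \<Gamma> a b \<Psi>"
  "Idt (OS g \<Gamma>) a = restrict (\<lambda>P. P) (Rsys \<Gamma> a)"
  "Cmp (OS g \<Gamma>) a b c \<Psi>' \<Psi> = compose (Rsys \<Gamma> a) \<Psi>' \<Psi>"
  by (simp_all add: OS_def)

lemma coord_affine_lme:
  "coord_affine \<Gamma> K L \<Phi> \<longleftrightarrow> (\<forall>n. \<forall>X\<in>K n. \<Phi> X \<in> L n) \<and>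
    (\<exists>c d. \<forall>n. \<forall>X\<in>K n. \<forall>j<length \<Gamma>. mat_eval n (\<Phi> X) (\<Gamma> ! j) = lme \<Gamma> n X (c j) (d j))"
  by (simp only: coord_affine_def lme_def)

lemma coord_affine_points: "coord_affine \<Gamma> K L \<Phi> \<Longrightarrow> \<Phi> \<in> points K \<rightarrow> points L"
  by (auto simp: coord_affine_def points_def)

lemma coord_affine_id: "coord_affine \<Gamma> K K (restrict (\<lambda>X. X) (points K))"
proof -
  have "\<forall>n. \<forall>X\<in>K n. \<forall>j<length \<Gamma>. mat_eval n (restrict (\<lambda>X. X) (points K) X) (\<Gamma> ! j) =
      lme \<Gamma> n X 0 (\<lambda>l. if l = j then 1 else 0)"
    by (auto simp: points_def lme_gen)
  moreover have "\<forall>n. \<forall>X\<in>K n. restrict (\<lambda>X. X) (points K) X \<in> K n" by (auto simp: points_def)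
  ultimately show ?thesis
    unfolding coord_affine_lme by (intro conjI exI[of _ "\<lambda>_. 0"] exI[of _ "\<lambda>j l. if l = j then 1 else 0"])
qed

lemma coord_affine_comp:
  assumes "coord_affine \<Gamma> K L \<Phi>" "coord_affine \<Gamma> L M \<Phi>'"
  shows "coord_affine \<Gamma> K M (compose (points K) \<Phi>' \<Phi>)"
proof -
  from assms obtain c d c' d' where m: "\<forall>n. \<forall>X\<in>K n. \<Phi> X \<in> L n" "\<forall>n. \<forall>Y\<in>L n. \<Phi>' Y \<in> M n"
    and cd: "\<forall>n. \<forall>X\<in>K n. \<forall>j<length \<Gamma>. mat_eval n (\<Phi> X) (\<Gamma> ! j) = lme \<Gamma> n X (c j) (d j)"
    and cd': "\<forall>n. \<forall>Y\<in>L n. \<forall>j<length \<Gamma>. mat_eval n (\<Phi>' Y) (\<Gamma> ! j) = lme \<Gamma> n Y (c' j) (d' j)"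
    unfolding coord_affine_lme by (elim conjE exE) (rule that)
  have cmp: "compose (points K) \<Phi>' \<Phi> X = \<Phi>' (\<Phi> X)" if "X \<in> K n" for n X
    using that by (auto simp: compose_def points_def)
  have "mat_eval n (compose (points K) \<Phi>' \<Phi> X) (\<Gamma> ! j) =
      lme \<Gamma> n X (c' j + (\<Sum>i<length \<Gamma>. d' j i * c i)) (\<lambda>l. \<Sum>i<length \<Gamma>. d' j i * d i l)"
    if X: "X \<in> K n" and j: "j < length \<Gamma>" for n X j
  proof -
    have "mat_eval n (\<Phi>' (\<Phi> X)) (\<Gamma> ! j) = lme \<Gamma> n (\<Phi> X) (c' j) (d' j)" using cd' m(1) X j by simp
    also have "\<dots> = lme \<Gamma> n X (c' j + (\<Sum>i<length \<Gamma>. d' j i * c i)) (\<lambda>l. \<Sum>i<length \<Gamma>. d' j i * d i l)"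
      by (rule lme_subst) (use cd X in simp)
    finally show ?thesis using cmp[OF X] by simp
  qed
  moreover have "compose (points K) \<Phi>' \<Phi> X \<in> M n" if "X \<in> K n" for n X
    using m that cmp[OF that] by simp
  ultimately show ?thesis
    unfolding coord_affine_lme
    by (intro conjI exI[of _ "\<lambda>j. c' j + (\<Sum>i<length \<Gamma>. d' j i * c i)"]
        exI[of _ "\<lambda>j l. \<Sum>i<length \<Gamma>. d' j i * d i l"] allI ballI impI)
qed

lemma category_Conv: "category (Conv g \<Gamma>)"
  unfolding category_def
proof (intro conjI ballI)
  fix a b f assume "a \<in> Obj (Conv g \<Gamma>)" "b \<in> Obj (Conv g \<Gamma>)" and "f \<in> Hom (Conv g \<Gamma>) a b"
  then have f: "f \<in> points a \<rightarrow> points b" "f \<in> extensional (points a)" by (simp_all add: coord_affine_points)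
  show "Cmp (Conv g \<Gamma>) a a b f (Idt (Conv g \<Gamma>) a) = f" "Cmp (Conv g \<Gamma>) a b b (Idt (Conv g \<Gamma>) b) f = f"
    using compose_Id[OF f] Id_compose[OF f] by simp_all
  fix c d k h assume "c \<in> Obj (Conv g \<Gamma>)" "d \<in> Obj (Conv g \<Gamma>)" "k \<in> Hom (Conv g \<Gamma>) b c" "h \<in> Hom (Conv g \<Gamma>) c d"
  show "Cmp (Conv g \<Gamma>) a c d h (Cmp (Conv g \<Gamma>) a b c k f) = Cmp (Conv g \<Gamma>) a b d (Cmp (Conv g \<Gamma>) b c d h k) f"
    using compose_assoc[OF f(1)] by simp
qed (auto simp: coord_affine_id intro: coord_affine_comp)

lemma hat_OS_obj:
  assumes K: "Conv_obj g \<Gamma> K"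
  shows "OS_obj g \<Gamma> (hat g K)" "realizes g \<Gamma> (hat g K) K" "WGamma \<Gamma> (hat g K) = K"
proof -
  note gK = Conv_obj_graded[OF K]
  show r: "realizes g \<Gamma> (hat g K) K" by (rule hat_realizes[OF gK])
  show "WGamma \<Gamma> (hat g K) = K" by (rule WGamma_realizes[OF K r])
  have "unitarily_equiv (hat g K) (hat g K)"
    using hat_bounded[OF gK] unfolding unitarily_equiv_def
    by (auto split: prod.splits intro!: exI[of _ "\<lambda>f. f"])
  then show "OS_obj g \<Gamma> (hat g K)" using K unfolding OS_obj_def by (intro exI[of _ K] conjI)
qed

text \<open>The set witnessing that \<open>a\<close> is an object is recovered as
  \<open>WGamma \<Gamma> a\<close>, which replaces the existential witness from here on.\<close>

lemma OS_objD:
  assumes "OS_obj g \<Gamma> a"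
  shows "Conv_obj g \<Gamma> (WGamma \<Gamma> a)" "realizes g \<Gamma> a (WGamma \<Gamma> a)"
proof -
  obtain K where K: "Conv_obj g \<Gamma> K" and ue: "unitarily_equiv a (hat g K)"
    using assms unfolding OS_obj_def by (elim exE conjE) (rule that)
  have r: "realizes g \<Gamma> a K" by (rule realizes_transfer[OF ue hat_OS_obj(2)[OF K]])
  have "WGamma \<Gamma> a = K" by (rule WGamma_realizes[OF K r])
  then show "Conv_obj g \<Gamma> (WGamma \<Gamma> a)" "realizes g \<Gamma> a (WGamma \<Gamma> a)" using K r by simp_all
qed

abbreviation dual :: "'i opsys \<Rightarrow> 'k opsys \<Rightarrow> ('i op \<Rightarrow> 'k op) \<Rightarrow> (mtuple \<Rightarrow> mtuple) \<Rightarrow> bool" where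
  "dual a b \<equiv> dual_to a b (WGamma \<Gamma> a) (WGamma \<Gamma> b)"

lemma dual_left:
  "OS_obj g \<Gamma> b \<Longrightarrow> dual a b \<Psi> \<Phi> \<Longrightarrow> dual a b \<Psi>' \<Phi> \<Longrightarrow> \<Psi> \<in> extensional (Rsys \<Gamma> a) \<Longrightarrow>
    \<Psi>' \<in> extensional (Rsys \<Gamma> a) \<Longrightarrow> \<Psi> = \<Psi>'"
  by (rule dual_to_unique_left[OF OS_objD(2)])

lemma dual_right:
  "OS_obj g \<Gamma> a \<Longrightarrow> dual a b \<Psi> \<Phi> \<Longrightarrow> dual a b \<Psi> \<Phi>' \<Longrightarrow> \<Phi> \<in> extensional (points (WGamma \<Gamma> b)) \<Longrightarrow>
    \<Phi>' \<in> extensional (points (WGamma \<Gamma> b)) \<Longrightarrow> \<Phi> = \<Phi>'"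
  by (rule dual_to_unique_right[OF OS_objD(2) Conv_obj_graded(1)[OF OS_objD(1)]])

lemma admissible_Phi_of:
  assumes "OS_obj g \<Gamma> a" "OS_obj g \<Gamma> b" "admissible \<Gamma> a b \<Psi>"
  shows "Phi_of \<Gamma> a b \<Psi> \<in> extensional (points (WGamma \<Gamma> b))"
    and "coord_affine \<Gamma> (WGamma \<Gamma> b) (WGamma \<Gamma> a) (Phi_of \<Gamma> a b \<Psi>)"
    and "dual a b \<Psi> (Phi_of \<Gamma> a b \<Psi>)"
  using admissible_dual[OF OS_objD(1)[OF assms(1)] OS_objD(1)[OF assms(2)] OS_objD(2)[OF assms(1)]
      OS_objD(2)[OF assms(2)] assms(3)] .

lemma coord_affine_dual_exists:
  fixes a b :: "dsix opsys"
  assumes "OS_obj g \<Gamma> a" "OS_obj g \<Gamma> b" and aff: "coord_affine \<Gamma> (WGamma \<Gamma> b) (WGamma \<Gamma> a) \<Phi>"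
  obtains \<Psi> where "\<Psi> \<in> extensional (Rsys \<Gamma> a)" "admissible \<Gamma> a b \<Psi>" "dual a b \<Psi> \<Phi>"
proof -
  obtain c d where m: "\<forall>n. \<forall>Y\<in>WGamma \<Gamma> b n. \<Phi> Y \<in> WGamma \<Gamma> a n"
    and cd: "\<forall>n. \<forall>Y\<in>WGamma \<Gamma> b n. \<forall>j<length \<Gamma>. mat_eval n (\<Phi> Y) (\<Gamma> ! j) = lme \<Gamma> n Y (c j) (d j)"
    using aff unfolding coord_affine_lme by (elim conjE exE) (rule that)
  note A = affine_dual[where \<Phi> = \<Phi> and c = c and d = d, OF OS_objD(1)[OF assms(1)] OS_objD(1)[OF assms(2)]
      OS_objD(2)[OF assms(1)] OS_objD(2)[OF assms(2)] m[rule_format] cd[rule_format] refl]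
  show thesis by (rule that) (rule A; assumption)+
qed

text \<open>\<open>\<Psi>'\<close> is only known to preserve polynomials at the generators of
  \<open>b\<close>, whereas \<open>\<Psi>\<close> produces another tuple. So the dual maps of points
  are composed instead, and the admissible map dual to their composite is identified with the
  composite by uniqueness.\<close>

lemma admissible_comp:
  fixes a b c :: "dsix opsys"
  assumes ob: "OS_obj g \<Gamma> a" "OS_obj g \<Gamma> b" "OS_obj g \<Gamma> c"
    and adm: "admissible \<Gamma> a b \<Psi>" "admissible \<Gamma> b c \<Psi>'"
  shows "admissible \<Gamma> a c (compose (Rsys \<Gamma> a) \<Psi>' \<Psi>)"
proof -
  note P = admissible_Phi_of[OF ob(1,2) adm(1)] and P' = admissible_Phi_of[OF ob(2,3) adm(2)]
  obtain \<Theta> where \<Theta>: "\<Theta> \<in> extensional (Rsys \<Gamma> a)" "admissible \<Gamma> a c \<Theta>"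
    "dual a c \<Theta> (compose (points (WGamma \<Gamma> c)) (Phi_of \<Gamma> a b \<Psi>) (Phi_of \<Gamma> b c \<Psi>'))"
    by (rule coord_affine_dual_exists[OF ob(1,3) coord_affine_comp[OF P'(2) P(2)]])
  have "\<Theta> = compose (Rsys \<Gamma> a) \<Psi>' \<Psi>"
    by (rule dual_left[OF ob(3) \<Theta>(3) dual_to_comp[OF P(3) P'(3)] \<Theta>(1) compose_extensional])
  then show ?thesis using \<Theta>(2) by simp
qed

lemma admissible_id:
  fixes a :: "dsix opsys"
  assumes ob: "OS_obj g \<Gamma> a"
  shows "admissible \<Gamma> a a (restrict (\<lambda>P. P) (Rsys \<Gamma> a))"
proof -
  obtain \<Theta> where \<Theta>: "\<Theta> \<in> extensional (Rsys \<Gamma> a)" "admissible \<Gamma> a a \<Theta>"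
    "dual a a \<Theta> (restrict (\<lambda>X. X) (points (WGamma \<Gamma> a)))"
    by (rule coord_affine_dual_exists[OF ob ob coord_affine_id])
  have "\<Theta> = restrict (\<lambda>P. P) (Rsys \<Gamma> a)"
    by (rule dual_left[OF ob \<Theta>(3) dual_to_id \<Theta>(1) restrict_extensional])
  then show ?thesis using \<Theta>(2) by simp
qed

lemma admissible_Rsys: "admissible \<Gamma> a b \<Psi> \<Longrightarrow> \<Psi> \<in> Rsys \<Gamma> a \<rightarrow> Rsys \<Gamma> b"
  by (auto simp: admissible_def)

lemma category_OS: "category (OS g \<Gamma>)"
  unfolding category_def
proof (intro conjI ballI)
  fix a b f assume "a \<in> Obj (OS g \<Gamma>)" "b \<in> Obj (OS g \<Gamma>)" and "f \<in> Hom (OS g \<Gamma>) a b"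
  then have f: "f \<in> Rsys \<Gamma> a \<rightarrow> Rsys \<Gamma> b" "f \<in> extensional (Rsys \<Gamma> a)" by (simp_all add: admissible_Rsys)
  show "Cmp (OS g \<Gamma>) a a b f (Idt (OS g \<Gamma>) a) = f" "Cmp (OS g \<Gamma>) a b b (Idt (OS g \<Gamma>) b) f = f"
    using compose_Id[OF f] Id_compose[OF f] by simp_all
  fix c d k h assume "c \<in> Obj (OS g \<Gamma>)" "d \<in> Obj (OS g \<Gamma>)" "k \<in> Hom (OS g \<Gamma>) b c" "h \<in> Hom (OS g \<Gamma>) c d"
  show "Cmp (OS g \<Gamma>) a c d h (Cmp (OS g \<Gamma>) a b c k f) = Cmp (OS g \<Gamma>) a b d (Cmp (OS g \<Gamma>) b c d h k) f"
    using compose_assoc[OF f(1)] by simp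
qed (auto simp: admissible_id intro: admissible_comp)

text \<open>Puts the direct sum of the images into the coefficient form that
  \<open>affine_dual\<close> takes, so that \<open>Psi_of\<close> is an instance of it.\<close>

lemma dsum_sys_eq:
  assumes K: "Conv_obj g \<Gamma> K" and L: "Conv_obj g \<Gamma> L"
    and m: "\<And>n X. X \<in> K n \<Longrightarrow> \<Phi> X \<in> L n"
    and cd: "\<And>n X j. X \<in> K n \<Longrightarrow> j < length \<Gamma> \<Longrightarrow> mat_eval n (\<Phi> X) (\<Gamma> ! j) = lme \<Gamma> n X (c j) (d j)"
  shows "dsum_sys g K \<Phi> = (fst (hat g K), map (\<lambda>j. gop \<Gamma> (hat g K) (c j) (d j)) [0..<g])"
proof -
  note gK = Conv_obj_graded[OF K]
  have "dsum_op K (\<lambda>X. \<Phi> X ! j) = gop \<Gamma> (hat g K) (c j) (d j)" if j: "j < g" for j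
  proof -
    have \<Phi>m: "\<Phi> X \<in> mtuples g n" if "X \<in> K n" for n X
      using graded_tuples(1)[where K = L and n = n, OF Conv_obj_graded(1)[OF L] m[OF that]] by (rule sa_tuples_mtuples)
    have dim: "dimt X = n" if "X \<in> K n" for n X
      using dimt[OF sa_tuples_mtuples[OF graded_tuples(1)[where K = K and n = n, OF gK(1) that]] g_pos] .
    have "\<Phi> X ! j = lme \<Gamma> (dimt X) X (c j) (d j)" if X: "X \<in> K n" for n X
      using cd[OF X, of j] mat_eval_gen[OF \<Phi>m[OF X] j] j g_le dim[OF X] by simp
    moreover have "lme \<Gamma> (dimt X) X (c j) (d j) \<in> carrier_mat n n" if "X \<in> K n" for n X
      using dim[OF that] by simp
    moreover have "\<Phi> X ! j \<in> carrier_mat n n" if "X \<in> K n" for n X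
      by (rule mtuples_nth[OF \<Phi>m[OF that] j])
    ultimately have "dsum_op K (\<lambda>X. \<Phi> X ! j) = dsum_op K (\<lambda>X. lme \<Gamma> (dimt X) X (c j) (d j))"
      by (subst dsum_op_eq_iff) blast+
    then show ?thesis by (simp only: hat_gens(2)[OF gK])
  qed
  then show ?thesis by (simp add: dsum_sys_def hat_def)
qed

lemma Psi_of_dual:
  assumes K: "Conv_obj g \<Gamma> K" and L: "Conv_obj g \<Gamma> L" and aff: "coord_affine \<Gamma> K L \<Phi>"
  shows "\<exists>!\<Psi>. is_gen_map \<Gamma> (hat g L) (dsum_sys g K \<Phi>) \<Psi>"
    and "is_gen_map \<Gamma> (hat g L) (dsum_sys g K \<Phi>) (Psi_of g \<Gamma> K L \<Phi>)"
    and "Psi_of g \<Gamma> K L \<Phi> \<in> extensional (Rsys \<Gamma> (hat g L))"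
    and "admissible \<Gamma> (hat g L) (hat g K) (Psi_of g \<Gamma> K L \<Phi>)"
    and "dual (hat g L) (hat g K) (Psi_of g \<Gamma> K L \<Phi>) \<Phi>"
proof -
  obtain c d where m: "\<forall>n. \<forall>X\<in>K n. \<Phi> X \<in> L n"
    and cd: "\<forall>n. \<forall>X\<in>K n. \<forall>j<length \<Gamma>. mat_eval n (\<Phi> X) (\<Gamma> ! j) = lme \<Gamma> n X (c j) (d j)"
    using aff unfolding coord_affine_lme by (elim conjE exE) (rule that)
  note A = affine_dual[where \<Phi> = \<Phi> and c = c and d = d, OF L K hat_OS_obj(2)[OF L] hat_OS_obj(2)[OF K]
      m[rule_format] cd[rule_format] dsum_sys_eq[OF K L m[rule_format] cd[rule_format]]]
  show "\<exists>!\<Psi>. is_gen_map \<Gamma> (hat g L) (dsum_sys g K \<Phi>) \<Psi>"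
    and "is_gen_map \<Gamma> (hat g L) (dsum_sys g K \<Phi>) (Psi_of g \<Gamma> K L \<Phi>)"
    and "Psi_of g \<Gamma> K L \<Phi> \<in> extensional (Rsys \<Gamma> (hat g L))"
    and "admissible \<Gamma> (hat g L) (hat g K) (Psi_of g \<Gamma> K L \<Phi>)"
    and "dual (hat g L) (hat g K) (Psi_of g \<Gamma> K L \<Phi>) \<Phi>"
    unfolding Psi_of_def hat_OS_obj(3)[OF K] hat_OS_obj(3)[OF L] by (rule A; assumption)+
qed

text \<open>With equal sets of points the identity is a coordinate affine map, and its dual is the
  comparison map of the two systems; for \<open>hat g (WGamma \<Gamma> a)\<close> in the place of
  \<open>b\<close> it is the component of the natural isomorphism.\<close>

lemma gen_map_dual_id:
  fixes a b :: "dsix opsys"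
  assumes ob: "OS_obj g \<Gamma> a" "OS_obj g \<Gamma> b" and eq: "WGamma \<Gamma> a = WGamma \<Gamma> b"
  shows "is_gen_map \<Gamma> a b (gen_map \<Gamma> a b)"
    and "gen_map \<Gamma> a b \<in> extensional (Rsys \<Gamma> a)" "admissible \<Gamma> a b (gen_map \<Gamma> a b)"
    and "dual a b (gen_map \<Gamma> a b) (restrict (\<lambda>X. X) (points (WGamma \<Gamma> a)))"
proof -
  let ?\<Phi> = "restrict (\<lambda>X. X) (points (WGamma \<Gamma> a))" and ?d = "\<lambda>j l. if l = j then 1 else 0 :: complex"
  have m: "?\<Phi> Y \<in> WGamma \<Gamma> a n" and cd: "j < length \<Gamma> \<Longrightarrow> mat_eval n (?\<Phi> Y) (\<Gamma> ! j) = lme \<Gamma> n Y 0 (?d j)"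
    if "Y \<in> WGamma \<Gamma> b n" for n Y j
    using that eq by (auto simp: points_def lme_gen)
  \<comment> \<open>The identity has unit vectors as coefficients, so the transformed tuple of
    \<open>affine_dual\<close> is the tuple of \<open>b\<close> itself.\<close>
  have "snd b = map (\<lambda>j. gop \<Gamma> b 0 (?d j)) [0..<g]"
    using realizes_gen[OF OS_objD(2)[OF ob(2)]] realizes_bounded(4)[OF OS_objD(2)[OF ob(2)]]
    by (intro nth_equalityI) auto
  then have b: "b = (fst b, map (\<lambda>j. gop \<Gamma> b 0 (?d j)) [0..<g])" by (simp add: prod_eq_iff)
  note A = affine_dual[where \<Phi> = ?\<Phi> and c = "\<lambda>_. 0" and d = ?d, OF OS_objD(1)[OF ob(1)] OS_objD(1)[OF ob(2)]
      OS_objD(2)[OF ob(1)] OS_objD(2)[OF ob(2)] m cd b]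
  show "is_gen_map \<Gamma> a b (gen_map \<Gamma> a b)" "gen_map \<Gamma> a b \<in> extensional (Rsys \<Gamma> a)"
    "admissible \<Gamma> a b (gen_map \<Gamma> a b)" "dual a b (gen_map \<Gamma> a b) ?\<Phi>"
    by (rule A; assumption)+
qed

section \<open>Functor laws and natural isomorphisms\<close>

lemma contra_functor_hat: "contra_functor (Conv g \<Gamma>) (OS g \<Gamma>) (hat g) (Psi_of g \<Gamma>)"
  unfolding contra_functor_def
proof (intro conjI ballI)
  fix K assume "K \<in> Obj (Conv g \<Gamma>)"
  then have K: "Conv_obj g \<Gamma> K" by simp
  show "hat g K \<in> Obj (OS g \<Gamma>)" using hat_OS_obj(1)[OF K] by simp
  note P = Psi_of_dual[OF K K coord_affine_id]
  have "dual (hat g K) (hat g K) (restrict (\<lambda>P. P) (Rsys \<Gamma> (hat g K))) (restrict (\<lambda>X. X) (points K))"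
    using dual_to_id[of "hat g K" "WGamma \<Gamma> (hat g K)"] by (simp only: hat_OS_obj(3)[OF K])
  then have "Psi_of g \<Gamma> K K (restrict (\<lambda>X. X) (points K)) = restrict (\<lambda>P. P) (Rsys \<Gamma> (hat g K))"
    by (rule dual_left[OF hat_OS_obj(1)[OF K] P(5) _ P(3) restrict_extensional])
  then show "Psi_of g \<Gamma> K K (Idt (Conv g \<Gamma>) K) = Idt (OS g \<Gamma>) (hat g K)" by simp
  fix L f assume "L \<in> Obj (Conv g \<Gamma>)" "f \<in> Hom (Conv g \<Gamma>) K L"
  then have L: "Conv_obj g \<Gamma> L" and f: "coord_affine \<Gamma> K L f" by simp_all
  note Pf = Psi_of_dual[OF K L f]
  show "Psi_of g \<Gamma> K L f \<in> Hom (OS g \<Gamma>) (hat g L) (hat g K)" using Pf(3,4) by simp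
  fix M h assume "M \<in> Obj (Conv g \<Gamma>)" "h \<in> Hom (Conv g \<Gamma>) L M"
  then have M: "Conv_obj g \<Gamma> M" and h: "coord_affine \<Gamma> L M h" by simp_all
  note Ph = Psi_of_dual[OF L M h] and Phf = Psi_of_dual[OF K M coord_affine_comp[OF f h]]
  have "dual (hat g M) (hat g K) (compose (Rsys \<Gamma> (hat g M)) (Psi_of g \<Gamma> K L f) (Psi_of g \<Gamma> L M h)) (compose (points K) h f)"
    using dual_to_comp[OF Ph(5) Pf(5)] by (simp only: hat_OS_obj(3)[OF K])
  then have "Psi_of g \<Gamma> K M (compose (points K) h f) =
      compose (Rsys \<Gamma> (hat g M)) (Psi_of g \<Gamma> K L f) (Psi_of g \<Gamma> L M h)"
    by (rule dual_left[OF hat_OS_obj(1)[OF K] Phf(5) _ Phf(3) compose_extensional])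
  then show "Psi_of g \<Gamma> K M (Cmp (Conv g \<Gamma>) K L M h f) =
      Cmp (OS g \<Gamma>) (hat g M) (hat g L) (hat g K) (Psi_of g \<Gamma> K L f) (Psi_of g \<Gamma> L M h)" by simp
qed

lemma contra_functor_WGamma: "contra_functor (OS g \<Gamma>) (Conv g \<Gamma>) (WGamma \<Gamma>) (Phi_of \<Gamma>)"
  unfolding contra_functor_def
proof (intro conjI ballI)
  fix a assume "a \<in> Obj (OS g \<Gamma>)"
  then have a: "OS_obj g \<Gamma> a" by simp
  show "WGamma \<Gamma> a \<in> Obj (Conv g \<Gamma>)" using OS_objD(1)[OF a] by simp
  note P = admissible_Phi_of[OF a a admissible_id[OF a]]
  have "Phi_of \<Gamma> a a (restrict (\<lambda>P. P) (Rsys \<Gamma> a)) = restrict (\<lambda>X. X) (points (WGamma \<Gamma> a))"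
    by (rule dual_right[OF a P(3) dual_to_id P(1) restrict_extensional])
  then show "Phi_of \<Gamma> a a (Idt (OS g \<Gamma>) a) = Idt (Conv g \<Gamma>) (WGamma \<Gamma> a)" by simp
  fix b f assume "b \<in> Obj (OS g \<Gamma>)" "f \<in> Hom (OS g \<Gamma>) a b"
  then have b: "OS_obj g \<Gamma> b" and f: "admissible \<Gamma> a b f" by simp_all
  note Pf = admissible_Phi_of[OF a b f]
  show "Phi_of \<Gamma> a b f \<in> Hom (Conv g \<Gamma>) (WGamma \<Gamma> b) (WGamma \<Gamma> a)" using Pf(1,2) by simp
  fix c h assume "c \<in> Obj (OS g \<Gamma>)" "h \<in> Hom (OS g \<Gamma>) b c"
  then have c: "OS_obj g \<Gamma> c" and h: "admissible \<Gamma> b c h" by simp_all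
  note Ph = admissible_Phi_of[OF b c h] and Phf = admissible_Phi_of[OF a c admissible_comp[OF a b c f h]]
  have "Phi_of \<Gamma> a c (compose (Rsys \<Gamma> a) h f) = compose (points (WGamma \<Gamma> c)) (Phi_of \<Gamma> a b f) (Phi_of \<Gamma> b c h)"
    by (rule dual_right[OF a Phf(3) dual_to_comp[OF Pf(3) Ph(3)] Phf(1) compose_extensional])
  then show "Phi_of \<Gamma> a c (Cmp (OS g \<Gamma>) a b c h f) =
      Cmp (Conv g \<Gamma>) (WGamma \<Gamma> c) (WGamma \<Gamma> b) (WGamma \<Gamma> a) (Phi_of \<Gamma> a b f) (Phi_of \<Gamma> b c h)" by simp
qed

lemma Phi_of_Psi_of:
  assumes K: "Conv_obj g \<Gamma> K" and L: "Conv_obj g \<Gamma> L"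
    and \<Phi>: "coord_affine \<Gamma> K L \<Phi>" "\<Phi> \<in> extensional (points K)"
  shows "Phi_of \<Gamma> (hat g L) (hat g K) (Psi_of g \<Gamma> K L \<Phi>) = \<Phi>"
proof -
  note P = Psi_of_dual[OF K L \<Phi>(1)]
  note Q = admissible_Phi_of[OF hat_OS_obj(1)[OF L] hat_OS_obj(1)[OF K] P(4)]
  show ?thesis
    by (rule dual_right[OF hat_OS_obj(1)[OF L] Q(3) P(5) Q(1)]) (simp only: hat_OS_obj(3)[OF K] \<Phi>(2))
qed

text \<open>The inverse of a component is the generator map in the other direction, since both
  composites are dual to the identity on points. Both sides of a naturality square are dual to
  \<open>Phi_of \<Gamma> a b \<Psi>\<close>, hence equal.\<close>

lemma nat_iso_OS:
  "nat_iso_from_id (OS g \<Gamma>) (\<lambda>a. hat g (WGamma \<Gamma> a))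
     (\<lambda>a b \<Psi>. Psi_of g \<Gamma> (WGamma \<Gamma> b) (WGamma \<Gamma> a) (Phi_of \<Gamma> a b \<Psi>))
     (\<lambda>a. gen_map \<Gamma> a (hat g (WGamma \<Gamma> a)))"
  unfolding nat_iso_from_id_def
proof (intro conjI ballI)
  let ?h = "\<lambda>a. hat g (WGamma \<Gamma> a)" and ?e = "\<lambda>a. gen_map \<Gamma> a (hat g (WGamma \<Gamma> a))"
  let ?i = "\<lambda>K. restrict (\<lambda>X. X) (points K)"
  have h: "OS_obj g \<Gamma> (?h a)" "WGamma \<Gamma> (?h a) = WGamma \<Gamma> a" if "OS_obj g \<Gamma> a" for a
    using hat_OS_obj(1,3)[OF OS_objD(1)[OF that]] .
  have ii: "compose (points K) (?i K) (?i K) = ?i K" for K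
    by (auto simp: compose_def fun_eq_iff)
  fix a assume "a \<in> Obj (OS g \<Gamma>)"
  then have a: "OS_obj g \<Gamma> a" by simp
  note E = gen_map_dual_id[OF a h(1)[OF a] h(2)[OF a, symmetric]]
  note F = gen_map_dual_id[OF h(1)[OF a] a h(2)[OF a]]
  have "compose (Rsys \<Gamma> a) (gen_map \<Gamma> (?h a) a) (?e a) = restrict (\<lambda>P. P) (Rsys \<Gamma> a)"
    using dual_to_comp[OF E(4) F(4)] unfolding h(2)[OF a] ii
    by (rule dual_left[OF a _ dual_to_id compose_extensional restrict_extensional])
  moreover have "compose (Rsys \<Gamma> (?h a)) (?e a) (gen_map \<Gamma> (?h a) a) = restrict (\<lambda>P. P) (Rsys \<Gamma> (?h a))"
  proof (rule dual_left[OF h(1)[OF a] _ dual_to_id compose_extensional restrict_extensional])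
    show "dual (?h a) (?h a) (compose (Rsys \<Gamma> (?h a)) (?e a) (gen_map \<Gamma> (?h a) a)) (?i (WGamma \<Gamma> (?h a)))"
      using dual_to_comp[OF F(4) E(4)] by (simp only: h(2)[OF a] ii)
  qed
  ultimately show "iso_arrow (OS g \<Gamma>) a (?h a) (?e a)"
    unfolding iso_arrow_def using E(2,3) F(2,3) by (auto intro!: bexI[of _ "gen_map \<Gamma> (?h a) a"])
  fix b \<Psi> assume "b \<in> Obj (OS g \<Gamma>)" "\<Psi> \<in> Hom (OS g \<Gamma>) a b"
  then have b: "OS_obj g \<Gamma> b" and \<Psi>: "admissible \<Gamma> a b \<Psi>" by simp_all
  note E' = gen_map_dual_id[OF b h(1)[OF b] h(2)[OF b, symmetric]]
  note P = admissible_Phi_of[OF a b \<Psi>]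
  note Q = Psi_of_dual[OF OS_objD(1)[OF b] OS_objD(1)[OF a] P(2)]
  let ?\<Phi> = "Phi_of \<Gamma> a b \<Psi>" and ?\<Theta> = "Psi_of g \<Gamma> (WGamma \<Gamma> b) (WGamma \<Gamma> a) (Phi_of \<Gamma> a b \<Psi>)"
  have 1: "compose (points (WGamma \<Gamma> b)) ?\<Phi> (?i (WGamma \<Gamma> b)) = ?\<Phi>"
    by (rule compose_Id[OF coord_affine_points[OF P(2)] P(1)])
  have 2: "compose (points (WGamma \<Gamma> b)) (?i (WGamma \<Gamma> a)) ?\<Phi> = ?\<Phi>"
    by (rule Id_compose[OF coord_affine_points[OF P(2)] P(1)])
  have "dual a (?h b) (compose (Rsys \<Gamma> a) (?e b) \<Psi>) ?\<Phi>"
    using dual_to_comp[OF P(3) E'(4)] by (simp only: h(2)[OF b] 1)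
  moreover have "dual a (?h b) (compose (Rsys \<Gamma> a) ?\<Theta> (?e a)) ?\<Phi>"
    using dual_to_comp[OF E(4) Q(5)] by (simp only: h(2)[OF b] 2)
  ultimately have "compose (Rsys \<Gamma> a) (?e b) \<Psi> = compose (Rsys \<Gamma> a) ?\<Theta> (?e a)"
    by (rule dual_left[OF h(1)[OF b] _ _ compose_extensional compose_extensional])
  then show "Cmp (OS g \<Gamma>) a b (?h b) (?e b) \<Psi> = Cmp (OS g \<Gamma>) a (?h a) (?h b) ?\<Theta> (?e a)" by simp
qed

text \<open>On this side the identification is an equality of graded sets, so identity arrows serve
  as components and naturality reduces to \<open>Phi_of_Psi_of\<close>.\<close>

lemma nat_iso_Conv:
  "nat_iso_from_id (Conv g \<Gamma>) (\<lambda>K. WGamma \<Gamma> (hat g K))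
     (\<lambda>K L \<Phi>. Phi_of \<Gamma> (hat g L) (hat g K) (Psi_of g \<Gamma> K L \<Phi>)) (Idt (Conv g \<Gamma>))"
  unfolding nat_iso_from_id_def
proof (intro conjI ballI)
  fix K assume "K \<in> Obj (Conv g \<Gamma>)"
  then have K: "Conv_obj g \<Gamma> K" by simp
  have "compose (points K) (restrict (\<lambda>X. X) (points K)) (restrict (\<lambda>X. X) (points K)) = restrict (\<lambda>X. X) (points K)"
    by (auto simp: compose_def fun_eq_iff)
  then show "iso_arrow (Conv g \<Gamma>) K (WGamma \<Gamma> (hat g K)) (Idt (Conv g \<Gamma>) K)"
    unfolding iso_arrow_def hat_OS_obj(3)[OF K]
    by (auto simp: coord_affine_id intro!: bexI[of _ "restrict (\<lambda>X. X) (points K)"])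
  fix L \<Phi> assume "L \<in> Obj (Conv g \<Gamma>)" "\<Phi> \<in> Hom (Conv g \<Gamma>) K L"
  then have L: "Conv_obj g \<Gamma> L" and \<Phi>: "coord_affine \<Gamma> K L \<Phi>" "\<Phi> \<in> extensional (points K)" by simp_all
  show "Cmp (Conv g \<Gamma>) K L (WGamma \<Gamma> (hat g L)) (Idt (Conv g \<Gamma>) L) \<Phi> =
      Cmp (Conv g \<Gamma>) K (WGamma \<Gamma> (hat g K)) (WGamma \<Gamma> (hat g L))
        (Phi_of \<Gamma> (hat g L) (hat g K) (Psi_of g \<Gamma> K L \<Phi>)) (Idt (Conv g \<Gamma>) K)"
    using compose_Id[OF coord_affine_points[OF \<Phi>(1)] \<Phi>(2)] Id_compose[OF coord_affine_points[OF \<Phi>(1)] \<Phi>(2)]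
    by (simp add: Phi_of_Psi_of[OF K L \<Phi>])
qed

text \<open>Contravariance exchanges directions: the map from the system of \<open>K\<close> to that
  of \<open>L\<close> is built from the inverse of \<open>\<Phi>\<close>, and conversely
  \<open>\<Phi>\<close> from the inverse of \<open>\<Psi>\<close>. The composites are identities
  because they are dual to identities.\<close>

lemma Conv_iso_iff_OS_iso:
  assumes K: "Conv_obj g \<Gamma> K" and L: "Conv_obj g \<Gamma> L"
  shows "(\<exists>\<Phi>\<in>Hom (Conv g \<Gamma>) K L. bij_betw \<Phi> (points K) (points L) \<and>
           restrict (inv_into (points K) \<Phi>) (points L) \<in> Hom (Conv g \<Gamma>) L K)
        \<longleftrightarrow>
        (\<exists>\<Psi>\<in>Hom (OS g \<Gamma>) (hat g K) (hat g L).
           bij_betw \<Psi> (Rsys \<Gamma> (hat g K)) (Rsys \<Gamma> (hat g L)) \<and>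
           restrict (inv_into (Rsys \<Gamma> (hat g K)) \<Psi>) (Rsys \<Gamma> (hat g L))
             \<in> Hom (OS g \<Gamma>) (hat g L) (hat g K))" (is "?A \<longleftrightarrow> ?B")
proof
  note oK = hat_OS_obj[OF K] and oL = hat_OS_obj[OF L]
  show ?B if ?A
  proof -
    from that obtain \<Phi> where \<Phi>: "coord_affine \<Gamma> K L \<Phi>" and bij: "bij_betw \<Phi> (points K) (points L)"
      and inv: "coord_affine \<Gamma> L K (restrict (inv_into (points K) \<Phi>) (points L))" by auto
    let ?\<Phi>' = "restrict (inv_into (points K) \<Phi>) (points L)"
    have c1: "compose (points K) ?\<Phi>' \<Phi> = restrict (\<lambda>X. X) (points K)" by (rule compose_inv_into_id[OF bij])
    have c2: "compose (points L) \<Phi> ?\<Phi>' = restrict (\<lambda>X. X) (points L)"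
      using bij by (intro compose_id_inv_into) (simp add: bij_betw_def)
    note P = Psi_of_dual[OF K L \<Phi>] and Q = Psi_of_dual[OF L K inv]
    let ?\<Psi> = "Psi_of g \<Gamma> L K ?\<Phi>'" and ?\<Psi>' = "Psi_of g \<Gamma> K L \<Phi>"
    have "dual (hat g K) (hat g K) (compose (Rsys \<Gamma> (hat g K)) ?\<Psi>' ?\<Psi>) (restrict (\<lambda>X. X) (points (WGamma \<Gamma> (hat g K))))"
      using dual_to_comp[OF Q(5) P(5)] by (simp only: oK(3) c1)
    then have e1: "compose (Rsys \<Gamma> (hat g K)) ?\<Psi>' ?\<Psi> = restrict (\<lambda>P. P) (Rsys \<Gamma> (hat g K))"
      by (rule dual_left[OF oK(1) _ dual_to_id compose_extensional restrict_extensional])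
    have "dual (hat g L) (hat g L) (compose (Rsys \<Gamma> (hat g L)) ?\<Psi> ?\<Psi>') (restrict (\<lambda>X. X) (points (WGamma \<Gamma> (hat g L))))"
      using dual_to_comp[OF P(5) Q(5)] by (simp only: oL(3) c2)
    then have e2: "compose (Rsys \<Gamma> (hat g L)) ?\<Psi> ?\<Psi>' = restrict (\<lambda>P. P) (Rsys \<Gamma> (hat g L))"
      by (rule dual_left[OF oL(1) _ dual_to_id compose_extensional restrict_extensional])
    note B = bij_betw_of_compose_inverse[OF admissible_Rsys[OF Q(4)] admissible_Rsys[OF P(4)] P(3) e1 e2]
    show ?B using B P(3,4) Q(3,4) by (intro bexI[of _ ?\<Psi>]) simp_all
  qed
  show ?A if ?B
  proof -
    from that obtain \<Psi> where \<Psi>: "admissible \<Gamma> (hat g K) (hat g L) \<Psi>"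
      and bij: "bij_betw \<Psi> (Rsys \<Gamma> (hat g K)) (Rsys \<Gamma> (hat g L))"
      and inv: "admissible \<Gamma> (hat g L) (hat g K) (restrict (inv_into (Rsys \<Gamma> (hat g K)) \<Psi>) (Rsys \<Gamma> (hat g L)))"
      by auto
    let ?\<Psi>' = "restrict (inv_into (Rsys \<Gamma> (hat g K)) \<Psi>) (Rsys \<Gamma> (hat g L))"
    have c1: "compose (Rsys \<Gamma> (hat g K)) ?\<Psi>' \<Psi> = restrict (\<lambda>P. P) (Rsys \<Gamma> (hat g K))" by (rule compose_inv_into_id[OF bij])
    have c2: "compose (Rsys \<Gamma> (hat g L)) \<Psi> ?\<Psi>' = restrict (\<lambda>P. P) (Rsys \<Gamma> (hat g L))"
      using bij by (intro compose_id_inv_into) (simp add: bij_betw_def)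
    note P = admissible_Phi_of[OF oK(1) oL(1) \<Psi>] and Q = admissible_Phi_of[OF oL(1) oK(1) inv]
    let ?\<Phi> = "Phi_of \<Gamma> (hat g L) (hat g K) ?\<Psi>'" and ?\<Phi>' = "Phi_of \<Gamma> (hat g K) (hat g L) \<Psi>"
    have e1: "compose (points (WGamma \<Gamma> (hat g K))) ?\<Phi>' ?\<Phi> = restrict (\<lambda>X. X) (points (WGamma \<Gamma> (hat g K)))"
      using dual_to_comp[OF P(3) Q(3)] unfolding c1
      by (rule dual_right[OF oK(1) _ dual_to_id compose_extensional restrict_extensional])
    have e2: "compose (points (WGamma \<Gamma> (hat g L))) ?\<Phi> ?\<Phi>' = restrict (\<lambda>X. X) (points (WGamma \<Gamma> (hat g L)))"
      using dual_to_comp[OF Q(3) P(3)] unfolding c2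
      by (rule dual_right[OF oL(1) _ dual_to_id compose_extensional restrict_extensional])
    note B = bij_betw_of_compose_inverse[OF coord_affine_points[OF Q(2)] coord_affine_points[OF P(2)] P(1) e1 e2]
    show ?A using B P(1,2) Q(1,2) unfolding oK(3) oL(3) by (intro bexI[of _ ?\<Phi>]) simp_all
  qed
qed

end

theorem theoremC10:
  fixes g r :: nat and \<Gamma> :: "ncpoly list"
  assumes "1 \<le> g" and "g \<le> r" and "length \<Gamma> = r"
    and "\<forall>p\<in>set \<Gamma>. nc_poly_in g p \<and> nc_star p = p"
    and "\<forall>j<g. \<Gamma> ! j = nc_var j"
    and "Gam \<Gamma> 1 (replicate g (0\<^sub>m 1 1)) = replicate r (0\<^sub>m 1 1)"
  shows
    "category (Conv g \<Gamma>) \<and> category (OS g \<Gamma>)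
   \<and> (\<forall>K\<in>Obj (Conv g \<Gamma>). \<forall>L\<in>Obj (Conv g \<Gamma>). \<forall>\<Phi>\<in>Hom (Conv g \<Gamma>) K L.
        (\<exists>!\<Psi>. is_gen_map \<Gamma> (hat g L) (dsum_sys g K \<Phi>) \<Psi>)
        \<and> is_gen_map \<Gamma> (hat g L) (dsum_sys g K \<Phi>) (Psi_of g \<Gamma> K L \<Phi>))
   \<and> contra_functor (Conv g \<Gamma>) (OS g \<Gamma>) (hat g) (Psi_of g \<Gamma>)
   \<and> (\<forall>a\<in>Obj (OS g \<Gamma>). \<forall>b\<in>Obj (OS g \<Gamma>). \<forall>\<Psi>\<in>Hom (OS g \<Gamma>) a b. \<forall>n>0. \<forall>\<phi>.
        Gamma_ucp \<Gamma> b {..<n} \<phi> \<longrightarrow>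
        Phi_of \<Gamma> a b \<Psi> (mtuple_of n \<phi> b) = mtuple_of n (\<phi> \<circ> \<Psi>) a)
   \<and> contra_functor (OS g \<Gamma>) (Conv g \<Gamma>) (WGamma \<Gamma>) (Phi_of \<Gamma>)
   \<and> (\<forall>K\<in>Obj (Conv g \<Gamma>). WGamma \<Gamma> (hat g K) = K)
   \<and> (\<forall>K\<in>Obj (Conv g \<Gamma>). \<forall>L\<in>Obj (Conv g \<Gamma>). \<forall>\<Phi>\<in>Hom (Conv g \<Gamma>) K L.
        Phi_of \<Gamma> (hat g L) (hat g K) (Psi_of g \<Gamma> K L \<Phi>) = \<Phi>)
   \<and> (\<forall>a\<in>Obj (OS g \<Gamma>).
        is_gen_map \<Gamma> a (hat g (WGamma \<Gamma> a)) (gen_map \<Gamma> a (hat g (WGamma \<Gamma> a))))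
   \<and> nat_iso_from_id (OS g \<Gamma>)
        (\<lambda>a. hat g (WGamma \<Gamma> a))
        (\<lambda>a b \<Psi>. Psi_of g \<Gamma> (WGamma \<Gamma> b) (WGamma \<Gamma> a) (Phi_of \<Gamma> a b \<Psi>))
        (\<lambda>a. gen_map \<Gamma> a (hat g (WGamma \<Gamma> a)))
   \<and> contra_equivalent (Conv g \<Gamma>) (OS g \<Gamma>)
   \<and> (\<forall>K\<in>Obj (Conv g \<Gamma>). \<forall>L\<in>Obj (Conv g \<Gamma>).
        (\<exists>\<Phi>\<in>Hom (Conv g \<Gamma>) K L. bij_betw \<Phi> (points K) (points L) \<and>
           restrict (inv_into (points K) \<Phi>) (points L) \<in> Hom (Conv g \<Gamma>) L K)
        \<longleftrightarrow>
        (\<exists>\<Psi>\<in>Hom (OS g \<Gamma>) (hat g K) (hat g L).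
           bij_betw \<Psi> (Rsys \<Gamma> (hat g K)) (Rsys \<Gamma> (hat g L)) \<and>
           restrict (inv_into (Rsys \<Gamma> (hat g K)) \<Psi>) (Rsys \<Gamma> (hat g L))
             \<in> Hom (OS g \<Gamma>) (hat g L) (hat g K)))"
proof -
  interpret gamma_tuple g \<Gamma>
  proof
    show "1 \<le> g" "g \<le> length \<Gamma>" using assms(1-3) by simp_all
    show "nc_poly_in g (\<Gamma> ! j)" "nc_star (\<Gamma> ! j) = \<Gamma> ! j" if "j < length \<Gamma>" for j
      using assms(4) that by simp_all
    show "\<Gamma> ! j = nc_var j" if "j < g" for j using assms(5) that by simp
    show "mat_eval 1 (replicate g (0\<^sub>m 1 1)) (\<Gamma> ! j) = 0\<^sub>m 1 1" if "j < length \<Gamma>" for j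
      using arg_cong[OF assms(6), of "\<lambda>X. X ! j"] that assms(3) by (simp add: Gam_def)
  qed
  have equiv: "contra_equivalent (Conv g \<Gamma>) (OS g \<Gamma>)"
    unfolding contra_equivalent_def
    by (intro exI conjI) (rule contra_functor_hat contra_functor_WGamma nat_iso_Conv nat_iso_OS)+
  show ?thesis
  proof (intro conjI ballI allI impI)
    show "\<exists>!\<Psi>. is_gen_map \<Gamma> (hat g L) (dsum_sys g K \<Phi>) \<Psi>"
      and "is_gen_map \<Gamma> (hat g L) (dsum_sys g K \<Phi>) (Psi_of g \<Gamma> K L \<Phi>)"
      and "Phi_of \<Gamma> (hat g L) (hat g K) (Psi_of g \<Gamma> K L \<Phi>) = \<Phi>"
      if "K \<in> Obj (Conv g \<Gamma>)" "L \<in> Obj (Conv g \<Gamma>)" "\<Phi> \<in> Hom (Conv g \<Gamma>) K L" for K L \<Phi>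
      using that Psi_of_dual(1,2)[of K L \<Phi>] Phi_of_Psi_of[of K L \<Phi>] by simp_all
    show "Phi_of \<Gamma> a b \<Psi> (mtuple_of n \<phi> b) = mtuple_of n (\<phi> \<circ> \<Psi>) a"
      if "a \<in> Obj (OS g \<Gamma>)" "b \<in> Obj (OS g \<Gamma>)" "\<Psi> \<in> Hom (OS g \<Gamma>) a b" "0 < n"
        "Gamma_ucp \<Gamma> b {..<n} \<phi>" for a b \<Psi> n \<phi>
      using that Phi_of_mtuple[OF OS_objD(2)[of b] _ OS_objD(2)[of a] that(4,5), of \<Psi>] by simp
    show "WGamma \<Gamma> (hat g K) = K" if "K \<in> Obj (Conv g \<Gamma>)" for K
      using that hat_OS_obj(3) by simp
    show "is_gen_map \<Gamma> a (hat g (WGamma \<Gamma> a)) (gen_map \<Gamma> a (hat g (WGamma \<Gamma> a)))"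
      if "a \<in> Obj (OS g \<Gamma>)" for a
    proof -
      have a: "OS_obj g \<Gamma> a" using that by simp
      note h = hat_OS_obj(1,3)[OF OS_objD(1)[OF a]]
      show ?thesis by (rule gen_map_dual_id(1)[OF a h(1) h(2)[symmetric]])
    qed
  qed (rule category_Conv category_OS contra_functor_hat contra_functor_WGamma nat_iso_OS equiv
      Conv_iso_iff_OS_iso[OF Conv_simps(1)[THEN iffD1] Conv_simps(1)[THEN iffD1]]; assumption)+
qed

end
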